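(* Suppose there exists a probability measure $\mathbb{Q}'$ on $\mathcal{G}_\infty$, equivalent to $\mathbb{Q}$, such that hypothesis (H) holds under $\mathbb{Q}'$, i.e. every $(\mathbb{Q}',\mathbb{F})$-martingale is a $(\mathbb{Q}',\mathbb{G})$-martingale. Then the global optional splitting formula holds at $\tau$ with respect to $\mathbb{F}$.
   Context: Let $(\Omega,\mathcal{A},\mathbb{Q})$ be a probability space with a right-continuous filtration $\mathbb{F}=(\mathcal{F}_t)_{t\ge0}$ such that $\mathcal{F}_0$ contains $\mathcal{N}^{\mathcal{F}_\infty}$, where for a $\sigma$-algebra $\mathcal{T}\subset\mathcal{A}$, $\mathcal{N}^{\mathcal{T}}$ denotes the $\sigma$-algebra generated by all subsets of $\mathcal{T}$-measurable $\mathbb{Q}$-null sets. Let $\tau$ be a random variable with values in $[0,\infty]$, let $\mathcal{N}=\mathcal{N}^{\sigma(\tau)\vee\mathcal{F}_\infty}$, and let $\mathbb{G}=(\mathcal{G}_t)_{t\ge0}$ with $\mathcal{G}_t=\mathcal{N}\vee\bigcap_{s>t}(\mathcal{F}_s\vee\sigma(\tau\wedge s))$. Identities are understood up to indistinguishability outside an $\mathcal{N}$-measurable $\mathbb{Q}$-null set. The global optional splitting formula at $\tau$ holds if for every $\mathbb{G}$-optional process $Y$ there exist $Y'\in\mathcal{O}(\mathbb{F})$ and a $\mathcal{B}[0,\infty]\otimes\mathcal{O}(\mathbb{F})$-measurable function $Y''$ on $[0,\infty]\times(\mathbb{R}_+\times\Omega)$ with $Y=Y'\mathbf{1}_{[0,\tau)}+Y''(\tau)\mathbf{1}_{[\tau,\infty)}$,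 where $Y''(\tau)(t,\omega)=Y''(\tau(\omega),t,\omega)$. *)

theory Defs
  imports "HOL-Probability.Probability"
begin

text \<open>Sigma-algebras on the sample space are represented as sets of subsets of it.
  A filtration is a map from times (reals; only t \<ge> 0 matter) to such sets.\<close>

definition sig_join :: "'a set \<Rightarrow> 'a set set \<Rightarrow> 'a set set \<Rightarrow> 'a set set" where
  "sig_join \<Omega> A B = sigma_sets \<Omega> (A \<union> B)"

definition filt_infty :: "'a set \<Rightarrow> (real \<Rightarrow> 'a set set) \<Rightarrow> 'a set set" where
  "filt_infty \<Omega> F = sigma_sets \<Omega> (\<Union>t\<in>{0..}. F t)"

definition null_gen :: "'a measure \<Rightarrow> 'a set set \<Rightarrow> 'a set set" where
  "null_gen M T = sigma_sets (space M) {A. A \<subseteq> space M \<and> (\<exists>N\<in>T. N \<in> null_sets M \<and> A \<subseteq> N)}"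

definition is_filtration :: "'a measure \<Rightarrow> (real \<Rightarrow> 'a set set) \<Rightarrow> bool" where
  "is_filtration M F \<longleftrightarrow>
     (\<forall>t\<ge>0. sigma_algebra (space M) (F t) \<and> F t \<subseteq> sets M) \<and>
     (\<forall>s t. 0 \<le> s \<longrightarrow> s \<le> t \<longrightarrow> F s \<subseteq> F t)"

definition right_continuous_filtration :: "(real \<Rightarrow> 'a set set) \<Rightarrow> bool" where
  "right_continuous_filtration F \<longleftrightarrow> (\<forall>t\<ge>0. F t = (\<Inter>s\<in>{t<..}. F s))"

definition adapted :: "'a set \<Rightarrow> (real \<Rightarrow> 'a set set) \<Rightarrow> (real \<Rightarrow> 'a \<Rightarrow> real) \<Rightarrow> bool" where
  "adapted \<Omega> F X \<longleftrightarrow> (\<forall>t\<ge>0. \<forall>B\<in>sets borel. {\<omega>\<in>\<Omega>. X t \<omega> \<in> B} \<in> F t)"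

definition cadlag_paths :: "'a set \<Rightarrow> (real \<Rightarrow> 'a \<Rightarrow> real) \<Rightarrow> bool" where
  "cadlag_paths \<Omega> X \<longleftrightarrow> (\<forall>\<omega>\<in>\<Omega>.
      (\<forall>t\<ge>0. continuous (at_right t) (\<lambda>s. X s \<omega>)) \<and>
      (\<forall>t>0. \<exists>l. ((\<lambda>s. X s \<omega>) \<longlongrightarrow> l) (at_left t)))"

definition optional_measure :: "'a set \<Rightarrow> (real \<Rightarrow> 'a set set) \<Rightarrow> (real \<times> 'a) measure" where
  "optional_measure \<Omega> F = sigma ({0..} \<times> \<Omega>)
     {{(t, \<omega>) \<in> {0..} \<times> \<Omega>. X t \<omega> \<in> B} | X B.
        adapted \<Omega> F X \<and> cadlag_paths \<Omega> X \<and> B \<in> sets borel}"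

definition optional_process :: "'a set \<Rightarrow> (real \<Rightarrow> 'a set set) \<Rightarrow> (real \<Rightarrow> 'a \<Rightarrow> real) \<Rightarrow> bool" where
  "optional_process \<Omega> F Y \<longleftrightarrow> (\<lambda>(t, \<omega>). Y t \<omega>) \<in> borel_measurable (optional_measure \<Omega> F)"

text \<open>(P,H)-martingale (real valued): adapted, integrable, and the martingale
  property E[X_t | H_s] = X_s written out via integrals over H_s-sets.\<close>
definition martingale :: "'a measure \<Rightarrow> (real \<Rightarrow> 'a set set) \<Rightarrow> (real \<Rightarrow> 'a \<Rightarrow> real) \<Rightarrow> bool" where
  "martingale P H X \<longleftrightarrow>
     adapted (space P) H X \<and> (\<forall>t\<ge>0. integrable P (X t)) \<and>
     (\<forall>s t A. 0 \<le> s \<longrightarrow> s \<le> t \<longrightarrow> A \<in> H s \<longrightarrow>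
        (LINT \<omega>:A|P. X t \<omega>) = (LINT \<omega>:A|P. X s \<omega>))"

definition NG :: "'a measure \<Rightarrow> (real \<Rightarrow> 'a set set) \<Rightarrow> ('a \<Rightarrow> ereal) \<Rightarrow> 'a set set" where
  "NG M F \<tau> = null_gen M (sig_join (space M)
      {\<tau> -` B \<inter> space M | B. B \<in> sets (borel :: ereal measure)} (filt_infty (space M) F))"

definition sigma_stopped :: "'a set \<Rightarrow> ('a \<Rightarrow> ereal) \<Rightarrow> real \<Rightarrow> 'a set set" where
  "sigma_stopped \<Omega> \<tau> s = {(\<lambda>\<omega>. min (\<tau> \<omega>) (ereal s)) -` B \<inter> \<Omega> | B. B \<in> sets (borel :: ereal measure)}"

definition enlarged :: "'a measure \<Rightarrow> (real \<Rightarrow> 'a set set) \<Rightarrow> ('a \<Rightarrow> ereal) \<Rightarrow> real \<Rightarrow> 'a set set" where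
  "enlarged M F \<tau> t = sig_join (space M) (NG M F \<tau>)
      (\<Inter>s\<in>{t<..}. sig_join (space M) (F s) (sigma_stopped (space M) \<tau> s))"

definition global_optional_splitting :: "'a measure \<Rightarrow> (real \<Rightarrow> 'a set set) \<Rightarrow> ('a \<Rightarrow> ereal) \<Rightarrow> bool" where
  "global_optional_splitting M F \<tau> \<longleftrightarrow>
    (\<forall>Y. optional_process (space M) (enlarged M F \<tau>) Y \<longrightarrow>
      (\<exists>Y' Y''. optional_process (space M) F Y' \<and>
        (\<lambda>(u, (t, \<omega>)). Y'' u t \<omega>) \<in>
           borel_measurable (restrict_space (borel :: ereal measure) {0..} \<Otimes>\<^sub>M optional_measure (space M) F) \<and>
        (\<exists>N0\<in>NG M F \<tau>. N0 \<in> null_sets (completion M) \<and>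
          (\<forall>\<omega>\<in>space M - N0. \<forall>t\<ge>0.
             Y t \<omega> = (if ereal t < \<tau> \<omega> then Y' t \<omega> else Y'' (\<tau> \<omega>) t \<omega>)))))"

end

theory Submission
  imports Defs
begin

text \<open>Work under the measure \<open>Q'\<close>, and write \<open>F\<close>, \<open>G\<close> for the two filtrations. For \<open>B\<close> in some
  \<open>F n\<close>, hypothesis (H) says that the \<open>F\<close>-martingale of conditional probabilities of \<open>B\<close> is also its
  \<open>G\<close>-martingale; it has a cadlag version \<open>b\<close>, so on \<open>\<tau> \<le> t\<close> the \<open>G\<close>-martingale of
  \<open>{\<tau> \<in> C} \<inter> B\<close> is \<open>1\<^sub>C(\<tau>) * b t\<close>, which has the required form. The maximal inequality and a
  Dynkin argument extend this to every event of \<open>Q'\<close>. A nonnegative closed martingale stays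
  away from zero where its final value is positive, so the stochastic interval starting at a \<open>G\<close>-stopping
  time is described by zero sets of countably many such martingales and therefore splits after \<open>\<tau>\<close>.
  Before \<open>\<tau>\<close>, events of \<open>G t\<close> agree with events of \<open>F t\<close>, and right continuity of \<open>F\<close> turns
  the corresponding hitting times into \<open>F\<close>-stopping times. Finally, superlevel sets of cadlag adapted
  processes are countable combinations of such intervals, so these generate the optional sigma-algebra.\<close>

section \<open>Oscillations and one-sided limits along the rationals\<close>

text \<open>The obstacle is that time is uncountable: a splitting found separately for each
  \<open>t\<close> would come with a null set depending on \<open>t\<close>. Hence conditional
  probabilities are compared only at rational times, and a real time \<open>t\<close> enters through
  right limits along the rationals, with a single null set for all \<open>t\<close>
  (\<open>split_limit\<close>). Right limits do not commute with countable sums by themselves; the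
  maximal inequality, uniform in rational time, is what allows the exchange. Existence of these
  limits comes from an L2 estimate: on any grid, a martingale of conditional probabilities makes on
  average at most \<open>1 / e\<^sup>2\<close> greedy moves larger than \<open>e\<close>. The bound
  does not depend on the mesh, so Fatou applies along the grids with step \<open>1 / fact m\<close>.
  An event of \<open>G t\<close> alone gives no joint measurability in the value of \<tau> and in
  time. A debut \<open>S\<close> is therefore recovered from the events \<open>S \<ge> r\<close>,
  whose martingales have right limits of the form
  \<open>\<Psi> (\<tau> \<omega>, t, \<omega>)\<close>. The change of measure is harmless because
  the formula sees a measure only through its null sets, and those of \<open>Q'\<close> are covered
  by \<open>T\<close>-measurable null sets of \<open>M\<close>.\<close>

abbreviation Qp :: "real set" where
  "Qp \<equiv> \<rat> \<inter> {0..}"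

lemma countable_Qp: "countable Qp"
  using countable_rat by (rule countable_subset[rotated]) auto

lemma Qp_dense:
  assumes "0 \<le> a" "a < b"
  obtains q where "q \<in> Qp" "a < q" "q < b"
  using Rats_dense_in_real[OF assms(2)] assms(1) by (metis IntI atLeast_iff less_imp_le order_trans)

lemma at_Qp_right_nontrivial:
  assumes "0 \<le> t"
  shows "at t within (Qp \<inter> {t<..}) \<noteq> bot"
proof -
  have "t islimpt (Qp \<inter> {t<..})"
    unfolding islimpt_approachable
  proof (intro allI impI)
    fix e :: real assume "e > 0"
    then obtain q where "q \<in> Qp" "t < q" "q < t + e"
      using Qp_dense[of t "t + e"] assms by auto
    then show "\<exists>x'\<in>Qp \<inter> {t<..}. x' \<noteq> t \<and> dist x' t < e"
      by (intro bexI[of _ q]) (auto simp: dist_real_def)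
  qed
  then show ?thesis
    by (simp add: trivial_limit_within)
qed

lemma at_Qp_left_nontrivial:
  assumes "0 < t"
  shows "at t within (Qp \<inter> {..<t}) \<noteq> bot"
proof -
  have "t islimpt (Qp \<inter> {..<t})"
    unfolding islimpt_approachable
  proof (intro allI impI)
    fix e :: real assume "e > 0"
    then obtain q where "q \<in> Qp" "max 0 (t - e) < q" "q < t"
      using Qp_dense[of "max 0 (t - e)" t] assms by auto
    then show "\<exists>x'\<in>Qp \<inter> {..<t}. x' \<noteq> t \<and> dist x' t < e"
      by (intro bexI[of _ q]) (auto simp: dist_real_def)
  qed
  then show ?thesis
    by (simp add: trivial_limit_within)
qed

text \<open>The anchor is the value at the last registered move. One count per size \<open>e\<close>
  takes the place of upcrossing numbers, which would need a pair of levels.\<close>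

primrec osc_anchor :: "(nat \<Rightarrow> real) \<Rightarrow> real \<Rightarrow> nat \<Rightarrow> real" where
  "osc_anchor x e 0 = x 0"
| "osc_anchor x e (Suc j) =
    (if \<bar>x (Suc j) - osc_anchor x e j\<bar> > e then x (Suc j) else osc_anchor x e j)"

primrec osc_count :: "(nat \<Rightarrow> real) \<Rightarrow> real \<Rightarrow> nat \<Rightarrow> nat" where
  "osc_count x e 0 = 0"
| "osc_count x e (Suc j) =
    (if \<bar>x (Suc j) - osc_anchor x e j\<bar> > e then Suc (osc_count x e j) else osc_count x e j)"

lemma osc_count_mono: "i \<le> j \<Longrightarrow> osc_count x e i \<le> osc_count x e j"
  by (rule lift_Suc_mono_le[of "osc_count x e"]) auto

lemma osc_count_le: "osc_count x e j \<le> j"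
  by (induction j) auto

lemma osc_anchor_close: "0 \<le> e \<Longrightarrow> \<bar>x j - osc_anchor x e j\<bar> \<le> e"
  by (cases j) auto

lemma osc_anchor_eq:
  assumes "i \<le> j" "osc_count x e i = osc_count x e j"
  shows "osc_anchor x e i = osc_anchor x e j"
  using assms
proof (induction j rule: dec_induct)
  case (step n)
  have "osc_count x e i \<le> osc_count x e n" "osc_count x e n \<le> osc_count x e (Suc n)"
    using step(1) by (rule osc_count_mono, intro osc_count_mono) simp
  then have "osc_count x e i = osc_count x e n" "osc_count x e n = osc_count x e (Suc n)"
    using step.prems by simp_all
  then show ?case
    using step by (auto split: if_splits)
qed simp

text \<open>Indices with equal count share their anchor, and each value lies within \<open>e\<close>
  of it; this is where the factor 2 comes from.\<close>

lemma osc_count_less: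
  assumes "i \<le> j" "0 \<le> e" "\<bar>x i - x j\<bar> > 2 * e"
  shows "osc_count x e i < osc_count x e j"
proof (rule ccontr)
  assume "\<not> ?thesis"
  then have "osc_count x e i = osc_count x e j"
    using osc_count_mono[OF assms(1), of x e] by simp
  then have "osc_anchor x e i = osc_anchor x e j"
    by (rule osc_anchor_eq[OF assms(1)])
  with osc_anchor_close[OF assms(2), of x i] osc_anchor_close[OF assms(2), of x j] assms(3)
  show False by linarith
qed

text \<open>The grid with step \<open>1 / fact m\<close> is cut off at time \<open>m\<close>, so
  every nonnegative rational belongs to all late grids. Asking for the bound only for infinitely
  many \<open>m\<close> matches what a finite liminf provides, and it is enough because finitely
  many rationals lie in a common late grid.\<close>

definition finite_oscillation :: "(real \<Rightarrow> real) \<Rightarrow> bool" where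
  "finite_oscillation f \<longleftrightarrow> (\<forall>k::nat. \<exists>K::nat. \<exists>\<^sub>F m in sequentially.
     osc_count (\<lambda>i. f (real i / fact m)) (1 / Suc k) (m * fact m) \<le> K)"

text \<open>A denominator \<open>b \<le> m\<close> divides \<open>fact m\<close>, and a numerator
  \<open>a \<le> m\<close> keeps the fraction below the cut-off \<open>m\<close>.\<close>

lemma Rats_grid:
  assumes "q \<in> Qp"
  shows "\<forall>\<^sub>F m in sequentially. \<exists>i \<le> m * fact m. q = real i / fact m"
proof -
  have "q \<in> \<rat>" "q \<ge> 0" using assms by auto
  then obtain a b where ab: "b \<noteq> 0" "\<bar>q\<bar> = real a / real b"
    by (elim Rats_abs_nat_div_natE) auto
  then have q: "q = real a / real b" using \<open>q \<ge> 0\<close> by simp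
  have "\<exists>i \<le> m * fact m. q = real i / fact m" if m: "m \<ge> max a b" for m
  proof -
    have "b dvd fact m"
      using ab(1) m by (intro dvd_fact) auto
    then obtain c :: nat where c: "fact m = b * c" by (auto elim: dvdE)
    have "c \<noteq> 0" using c by (metis fact_nonzero mult_0_right)
    have fr: "(fact m :: real) = real b * real c"
      using c by (metis of_nat_fact of_nat_mult)
    have "a * c \<le> m * fact m"
      unfolding c using m ab(1) by (intro mult_mono) auto
    moreover have "q = real (a * c) / fact m"
      unfolding fr q using ab(1) \<open>c \<noteq> 0\<close> by simp
    ultimately show ?thesis by blast
  qed
  then show ?thesis
    unfolding eventually_sequentially by blast
qed

text \<open>The first \<open>K + 2\<close> points of the chain lie in one grid whose count is at
  most \<open>K\<close>, yet each of the \<open>K + 1\<close> jumps between neighbours raises the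
  count.\<close>

lemma finite_oscillation_no_chain:
  assumes f: "finite_oscillation f" and e: "e > 0"
    and s: "\<And>n. s n \<in> Qp" and jump: "\<And>n::nat. \<bar>f (s (Suc n)) - f (s n)\<bar> > e"
    and mono: "strict_mono s \<or> strict_mono (\<lambda>n. - s n)"
  shows False
proof -
  \<comment> \<open>A jump above \<open>e\<close> exceeds twice \<open>1 / Suc k\<close>, as
    \<open>osc_count_less\<close> requires.\<close>
  obtain k :: nat where k: "1 / Suc k < e / 2"
    using e by (metis nat_approx_posE half_gt_zero)
  obtain K where K: "\<exists>\<^sub>F m in sequentially.
     osc_count (\<lambda>i. f (real i / fact m)) (1 / Suc k) (m * fact m) \<le> K"
    using f unfolding finite_oscillation_def by blast
  have "\<forall>\<^sub>F m in sequentially. \<forall>n\<in>{..Suc K}. \<exists>i \<le> m * fact m. s n = real i / fact m"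
    by (intro eventually_ball_finite) (use Rats_grid s in auto)
  then obtain m where m: "\<forall>n\<in>{..Suc K}. \<exists>i \<le> m * fact m. s n = real i / fact m"
      "osc_count (\<lambda>i. f (real i / fact m)) (1 / Suc k) (m * fact m) \<le> K"
    using frequently_ex[OF frequently_eventually_frequently[OF K]] by blast
  then obtain i where i: "\<And>n. n \<le> Suc K \<Longrightarrow> i n \<le> m * fact m \<and> s n = real (i n) / fact m"
    unfolding Ball_def atMost_iff by metis
  define c where "c = osc_count (\<lambda>i. f (real i / fact m)) (1 / Suc k)"
  have step: "c (i n) < c (i n')" if "n \<le> Suc K" "n' \<le> Suc K" "n = Suc n' \<or> n' = Suc n" "s n < s n'" for n n'
    unfolding c_def
  proof (rule osc_count_less)
    have "real (i n) / fact m < real (i n') / fact m"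
      using that(4) i[OF that(1)] i[OF that(2)] by simp
    then show "i n \<le> i n'" by (simp add: divide_less_cancel)
    have "\<bar>f (s n) - f (s n')\<bar> > e"
      using jump[of n] jump[of n'] that(3) by (auto simp: abs_minus_commute)
    then show "\<bar>f (real (i n) / fact m) - f (real (i n') / fact m)\<bar> > 2 * (1 / Suc k)"
      using i[OF that(1)] i[OF that(2)] k by simp
  qed simp
  have top: "c (i n) \<le> K" if "n \<le> Suc K" for n
    using osc_count_mono[of "i n" "m * fact m" "\<lambda>i. f (real i / fact m)" "1 / Suc k"] i[OF that] m(2)
    unfolding c_def by linarith
  show False
    using mono
  proof
    assume "strict_mono s"
    have "n \<le> c (i n)" if "n \<le> Suc K" for n
      using that
    proof (induction n)
      case (Suc n)
      then show ?case
        using step[of n "Suc n"] strict_monoD[OF \<open>strict_mono s\<close>, of n "Suc n"] by simp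
    qed simp
    from this[of "Suc K"] top[of "Suc K"] show False by simp
  next
    assume "strict_mono (\<lambda>n. - s n)"
    \<comment> \<open>A decreasing chain meets the grid in reverse order, so the count is built up
      from the point with index \<open>Suc K\<close>; the claim is empty for \<open>n = 0\<close>
      and gives \<open>Suc K \<le> c (i 0)\<close> at the end.\<close>
    have "Suc K \<le> c (i (Suc K - n)) + (Suc K - n)" if "n \<le> Suc K" for n
      using that
    proof (induction n)
      case (Suc n)
      have "c (i (Suc K - n)) < c (i (Suc K - Suc n))"
      proof (rule step)
        show "s (Suc K - n) < s (Suc K - Suc n)"
          using strict_monoD[OF \<open>strict_mono (\<lambda>n. - s n)\<close>, of "Suc K - Suc n" "Suc K - n"] Suc.prems
          by auto
      qed (use Suc.prems in auto)
      then show ?case using Suc by linarith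
    qed simp
    from this[of "Suc K"] top[of 0] show False by simp
  qed
qed

text \<open>Negated Cauchy criterion. If for every precision \<open>f\<close> were eventually close
  to some value, these values would form a Cauchy sequence, as two of them are compared at a common
  point of the nontrivial filter, and their limit would be a limit of \<open>f\<close>.\<close>

lemma no_limit_imp_frequently_far:
  fixes f :: "'b \<Rightarrow> real"
  assumes "\<nexists>l. (f \<longlongrightarrow> l) Fl" and "Fl \<noteq> bot"
  obtains e where "e > 0" "\<And>y. \<exists>\<^sub>F q in Fl. \<bar>f q - y\<bar> > e"
proof (rule ccontr)
  assume "\<not> thesis"
  then have "\<forall>e>0. \<exists>y. \<not> (\<exists>\<^sub>F q in Fl. \<bar>f q - y\<bar> > e)" using that by blast
  then have "\<exists>y. \<forall>\<^sub>F q in Fl. \<bar>f q - y\<bar> \<le> e" if "e > 0" for e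
    using that by (auto simp: frequently_def not_less)
  then have "\<forall>n. \<exists>y. \<forall>\<^sub>F q in Fl. \<bar>f q - y\<bar> \<le> 1 / Suc n" by simp
  then obtain y where y: "\<And>n. \<forall>\<^sub>F q in Fl. \<bar>f q - y n\<bar> \<le> 1 / Suc n" by metis
  have close: "\<bar>y m - y n\<bar> \<le> 1 / Suc m + 1 / Suc n" for m n
  proof -
    have "\<forall>\<^sub>F q in Fl. \<bar>y m - y n\<bar> \<le> 1 / Suc m + 1 / Suc n"
      using y[of m] y[of n] by eventually_elim linarith
    then show ?thesis using assms(2) by simp
  qed
  have "Cauchy y"
  proof (rule metric_CauchyI)
    fix e :: real assume "e > 0"
    then obtain k :: nat where k: "1 / Suc k < e / 2" by (metis nat_approx_posE half_gt_zero)
    have "dist (y m) (y n) < e" if "m \<ge> k" "n \<ge> k" for m n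
    proof -
      have "1 / real (Suc m) \<le> 1 / Suc k" "1 / real (Suc n) \<le> 1 / Suc k"
        using that by (auto simp: frac_le)
      then show ?thesis using close[of m n] k unfolding dist_real_def by linarith
    qed
    then show "\<exists>M. \<forall>m\<ge>M. \<forall>n\<ge>M. dist (y m) (y n) < e" by blast
  qed
  then obtain l where l: "y \<longlonglongrightarrow> l" using convergent_eq_Cauchy convergent_def by blast
  have "(f \<longlongrightarrow> l) Fl"
  proof (rule tendstoI)
    fix e :: real assume "e > 0"
    then obtain k :: nat where k: "1 / Suc k < e / 2" by (metis nat_approx_posE half_gt_zero)
    have "\<forall>\<^sub>F n in sequentially. dist (y n) l < e / 2 \<and> n \<ge> k"
      using tendstoD[OF l, of "e / 2"] \<open>e > 0\<close> eventually_ge_at_top[of k] by (auto intro: eventually_conj)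
    then obtain n where n: "dist (y n) l < e / 2" "n \<ge> k" by (auto dest: eventually_happens)
    have n1: "1 / real (Suc n) \<le> 1 / Suc k" using n(2) by (auto simp: frac_le)
    show "\<forall>\<^sub>F q in Fl. dist (f q) l < e"
      using y[of n]
    proof eventually_elim
      case (elim q)
      then show ?case using n n1 k unfolding dist_real_def by linarith
    qed
  qed
  with assms(1) show False by blast
qed

text \<open>Without a limit, points far from the value at the current point occur arbitrarily close
  to \<open>t\<close>. Dependent choice turns this into a strictly decreasing chain of rationals
  with jumps above \<open>e\<close>, which finite oscillation forbids.\<close>

lemma finite_oscillation_right_limit:
  assumes f: "finite_oscillation f" and t: "0 \<le> t"
  shows "\<exists>l. (f \<longlongrightarrow> l) (at t within (Qp \<inter> {t<..}))"
proof (rule ccontr)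
  assume "\<not> ?thesis"
  then obtain e where e: "e > 0"
      "\<And>y. \<exists>\<^sub>F q in at t within (Qp \<inter> {t<..}). \<bar>f q - y\<bar> > e"
    using no_limit_imp_frequently_far at_Qp_right_nontrivial[OF t] by metis
  have step: "\<exists>q. (q \<in> Qp \<and> t < q) \<and> \<bar>f q - f p\<bar> > e \<and> q < p" if "p \<in> Qp \<and> t < p" for p
  proof -
    have "\<forall>\<^sub>F q in at t within (Qp \<inter> {t<..}). q \<in> Qp \<and> t < q \<and> q < p"
      using that unfolding eventually_at
      by (intro exI[of _ "p - t"]) (auto simp: dist_real_def)
    with e(2)[of "f p"] have "\<exists>\<^sub>F q in at t within (Qp \<inter> {t<..}). \<bar>f q - f p\<bar> > e \<and> q \<in> Qp \<and> t < q \<and> q < p"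
      by (rule frequently_eventually_frequently)
    then show ?thesis by (auto dest: frequently_ex)
  qed
  obtain q0 where q0: "q0 \<in> Qp" "t < q0" by (rule Qp_dense[of t "t + 1"]) (use t in auto)
  obtain s where s: "\<And>n::nat. s n \<in> Qp \<and> t < s n" "\<And>n. \<bar>f (s (Suc n)) - f (s n)\<bar> > e \<and> s (Suc n) < s n"
    using dependent_nat_choice[of "\<lambda>_ q. q \<in> Qp \<and> t < q" "\<lambda>_ p q. \<bar>f q - f p\<bar> > e \<and> q < p"] step q0 by blast
  show False
    by (rule finite_oscillation_no_chain[OF f e(1), of s])
      (use s in \<open>auto simp only: strict_mono_Suc_iff neg_less_iff_less\<close>)
qed

lemma finite_oscillation_left_limit:
  assumes f: "finite_oscillation f" and t: "0 < t"
  shows "\<exists>l. (f \<longlongrightarrow> l) (at t within (Qp \<inter> {..<t}))"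
proof (rule ccontr)
  assume "\<not> ?thesis"
  then obtain e where e: "e > 0"
      "\<And>y. \<exists>\<^sub>F q in at t within (Qp \<inter> {..<t}). \<bar>f q - y\<bar> > e"
    using no_limit_imp_frequently_far at_Qp_left_nontrivial[OF t] by metis
  have step: "\<exists>q. (q \<in> Qp \<and> q < t) \<and> \<bar>f q - f p\<bar> > e \<and> p < q" if "p \<in> Qp \<and> p < t" for p
  proof -
    have "\<forall>\<^sub>F q in at t within (Qp \<inter> {..<t}). q \<in> Qp \<and> q < t \<and> p < q"
      using that unfolding eventually_at
      by (intro exI[of _ "t - p"]) (auto simp: dist_real_def)
    with e(2)[of "f p"] have "\<exists>\<^sub>F q in at t within (Qp \<inter> {..<t}). \<bar>f q - f p\<bar> > e \<and> q \<in> Qp \<and> q < t \<and> p < q"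
      by (rule frequently_eventually_frequently)
    then show ?thesis by (auto dest: frequently_ex)
  qed
  obtain q0 where q0: "q0 \<in> Qp" "q0 < t" using t by (intro that[of 0]) auto
  obtain s where s: "\<And>n::nat. s n \<in> Qp \<and> s n < t" "\<And>n. \<bar>f (s (Suc n)) - f (s n)\<bar> > e \<and> s n < s (Suc n)"
    using dependent_nat_choice[of "\<lambda>_ q. q \<in> Qp \<and> q < t" "\<lambda>_ p q. \<bar>f q - f p\<bar> > e \<and> p < q"] step q0 by blast
  show False
    by (rule finite_oscillation_no_chain[OF f e(1), of s])
      (use s in \<open>auto simp only: strict_mono_Suc_iff neg_less_iff_less\<close>)
qed

text \<open>Time \<open>t\<close> itself is left out, so the regularised path ignores the value of
  \<open>f\<close> at \<open>t\<close>; this makes it right continuous.\<close>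

definition right_lim :: "(real \<Rightarrow> real) \<Rightarrow> real \<Rightarrow> real" where
  "right_lim f t = Lim (at t within (Qp \<inter> {t<..})) f"

lemma right_lim_tendsto:
  assumes "finite_oscillation f" "0 \<le> t"
  shows "(f \<longlongrightarrow> right_lim f t) (at t within (Qp \<inter> {t<..}))"
proof -
  obtain l where l: "(f \<longlongrightarrow> l) (at t within (Qp \<inter> {t<..}))"
    using finite_oscillation_right_limit[OF assms] by blast
  with tendsto_Lim[OF at_Qp_right_nontrivial[OF assms(2)] l] show ?thesis
    by (simp add: right_lim_def)
qed

text \<open>The left end \<open>t = a\<close> is allowed although the bound is assumed only beyond
  \<open>a\<close>. The same estimate thus serves right continuity and left limits.\<close>

lemma right_lim_in_interval:
  assumes f: "finite_oscillation f" and a: "0 \<le> a" "a \<le> t" "t < b"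
    and bound: "\<And>q. q \<in> Qp \<Longrightarrow> a < q \<Longrightarrow> q < b \<Longrightarrow> \<bar>f q - l\<bar> \<le> e"
  shows "\<bar>right_lim f t - l\<bar> \<le> e"
proof -
  have t: "0 \<le> t" using a by simp
  have "((\<lambda>q. \<bar>f q - l\<bar>) \<longlongrightarrow> \<bar>right_lim f t - l\<bar>) (at t within (Qp \<inter> {t<..}))"
    by (intro tendsto_intros right_lim_tendsto f t)
  moreover have "\<forall>\<^sub>F q in at t within (Qp \<inter> {t<..}). \<bar>f q - l\<bar> \<le> e"
    unfolding eventually_at using bound a
    by (intro exI[of _ "b - t"]) (auto simp: dist_real_def)
  ultimately show ?thesis
    by (rule tendsto_upperbound) (rule at_Qp_right_nontrivial[OF t])
qed

lemma right_lim_cadlag: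
  assumes f: "finite_oscillation f"
  shows "0 \<le> t \<Longrightarrow> continuous (at_right t) (right_lim f)"
    and "0 < t \<Longrightarrow> \<exists>l. (right_lim f \<longlongrightarrow> l) (at_left t)"
proof -
  assume t: "0 \<le> t"
  show "continuous (at_right t) (right_lim f)"
    unfolding continuous_within
  proof (rule tendstoI)
    fix e :: real assume e: "e > 0"
    have "\<forall>\<^sub>F q in at t within (Qp \<inter> {t<..}). dist (f q) (right_lim f t) < e / 2"
      using tendstoD[OF right_lim_tendsto[OF f t], of "e / 2"] e by simp
    then obtain d where d: "d > 0"
        "\<And>q. q \<in> Qp \<Longrightarrow> t < q \<Longrightarrow> q < t + d \<Longrightarrow> dist (f q) (right_lim f t) < e / 2"
      unfolding eventually_at dist_real_def by auto
    have "dist (right_lim f s) (right_lim f t) < e" if "t < s" "s < t + d" for s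
    proof -
      have "\<bar>right_lim f s - right_lim f t\<bar> \<le> e / 2"
        by (rule right_lim_in_interval[OF f t, of s "t + d"])
          (use that d in \<open>auto simp: dist_real_def less_imp_le\<close>)
      then show ?thesis using e by (simp add: dist_real_def)
    qed
    then show "\<forall>\<^sub>F s in at_right t. dist (right_lim f s) (right_lim f t) < e"
      using d(1) unfolding eventually_at by (intro exI[of _ d]) (auto simp: dist_real_def)
  qed
next
  assume t: "0 < t"
  obtain l where l: "(f \<longlongrightarrow> l) (at t within (Qp \<inter> {..<t}))"
    using finite_oscillation_left_limit[OF f t] by blast
  have "(right_lim f \<longlongrightarrow> l) (at_left t)"
  proof (rule tendstoI)
    fix e :: real assume e: "e > 0"
    have "\<forall>\<^sub>F q in at t within (Qp \<inter> {..<t}). dist (f q) l < e / 2"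
      using tendstoD[OF l, of "e / 2"] e by simp
    then obtain d where d: "d > 0"
        "\<And>q. q \<in> Qp \<Longrightarrow> q < t \<Longrightarrow> t - d < q \<Longrightarrow> dist (f q) l < e / 2"
      unfolding eventually_at dist_real_def by auto
    have "dist (right_lim f s) l < e" if "s < t" "max 0 (t - d) < s" for s
    proof -
      have "\<bar>right_lim f s - l\<bar> \<le> e / 2"
        by (rule right_lim_in_interval[OF f, of "max 0 (t - d)" s t])
          (use that d in \<open>auto simp: dist_real_def less_imp_le\<close>)
      then show ?thesis using e by (simp add: dist_real_def)
    qed
    then show "\<forall>\<^sub>F s in at_left t. dist (right_lim f s) l < e"
      using d(1) t unfolding eventually_at by (intro exI[of _ "min d t"]) (auto simp: dist_real_def)
  qed
  then show "\<exists>l. (right_lim f \<longlongrightarrow> l) (at_left t)" by blast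
qed

section \<open>Conditional probabilities along a filtration\<close>

locale filtered_prob_space = prob_space P for P :: "'a measure" +
  fixes H :: "real \<Rightarrow> 'a set set"
  assumes H_sigma_algebra: "0 \<le> t \<Longrightarrow> sigma_algebra (space P) (H t)"
    and H_sub: "0 \<le> t \<Longrightarrow> H t \<subseteq> events"
    and H_mono: "0 \<le> s \<Longrightarrow> s \<le> t \<Longrightarrow> H s \<subseteq> H t"
begin

text \<open>The sets \<open>H t\<close> packaged as a measure space, the form in which
  \<open>real_cond_exp\<close> and measurability of functions accept a sub-sigma-algebra.\<close>

definition HM :: "real \<Rightarrow> 'a measure" where
  "HM t = sigma (space P) (H t)"

lemma space_HM [simp]: "space (HM t) = space P"
  by (simp add: HM_def space_measure_of_conv)

lemma sets_HM: "0 \<le> t \<Longrightarrow> sets (HM t) = H t"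
  unfolding HM_def by (rule sigma_algebra.sets_measure_of_eq[OF H_sigma_algebra])

lemma subalgebra_HM: "0 \<le> t \<Longrightarrow> subalgebra P (HM t)"
  using H_sub by (auto simp: subalgebra_def sets_HM)

lemma subalgebra_HM_mono: "0 \<le> s \<Longrightarrow> s \<le> t \<Longrightarrow> subalgebra (HM t) (HM s)"
  using H_mono[of s t] by (auto simp: subalgebra_def sets_HM)

lemma finite_subalgebra: "0 \<le> t \<Longrightarrow> finite_measure_subalgebra P (HM t)"
  by unfold_locales (rule subalgebra_HM)

text \<open>The clipping changes the conditional probability only on a null set and makes its bounds
  hold everywhere.\<close>

definition cond_pr :: "'a set \<Rightarrow> real \<Rightarrow> 'a \<Rightarrow> real" where
  "cond_pr A t \<omega> = max 0 (min 1 (real_cond_exp P (HM t) (indicator A) \<omega>))"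

lemma cond_pr_bounds: "0 \<le> cond_pr A t \<omega>" "cond_pr A t \<omega> \<le> 1"
  by (auto simp: cond_pr_def)

lemma cond_pr_measurable_HM [measurable]: "cond_pr A t \<in> borel_measurable (HM t)"
  unfolding cond_pr_def[abs_def] by measurable

lemma cond_pr_measurable_later:
  "0 \<le> s \<Longrightarrow> s \<le> t \<Longrightarrow> cond_pr A s \<in> borel_measurable (HM t)"
  by (rule measurable_from_subalg[OF subalgebra_HM_mono]) auto

lemma cond_pr_measurable: "0 \<le> t \<Longrightarrow> cond_pr A t \<in> borel_measurable P"
  by (rule measurable_from_subalg[OF subalgebra_HM]) auto

lemma cond_pr_eq_real_cond_exp:
  assumes A: "A \<in> events" and t: "0 \<le> t"
  shows "AE \<omega> in P. cond_pr A t \<omega> = real_cond_exp P (HM t) (indicator A) \<omega>"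
proof -
  interpret finite_measure_subalgebra P "HM t" using finite_subalgebra[OF t] .
  have i: "integrable P (indicator A :: 'a \<Rightarrow> real)" using A by (simp add: emeasure_eq_measure)
  have "AE \<omega> in P. real_cond_exp P (HM t) (indicator A) \<omega> \<le> 1"
    by (rule real_cond_exp_le_c[OF i]) (auto simp: indicator_def)
  moreover have "AE \<omega> in P. real_cond_exp P (HM t) (indicator A) \<omega> \<ge> 0"
    by (rule real_cond_exp_ge_c[OF i]) (auto simp: indicator_def)
  ultimately show ?thesis
    by eventually_elim (auto simp: cond_pr_def)
qed

lemma integrable_bounded:
  fixes g :: "'a \<Rightarrow> real"
  assumes "g \<in> borel_measurable P" "\<And>\<omega>. \<omega> \<in> space P \<Longrightarrow> \<bar>g \<omega>\<bar> \<le> C"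
  shows "integrable P g"
  by (rule integrable_const_bound[of _ C]) (use assms in auto)

lemma cond_pr_integral_mult:
  assumes A: "A \<in> events" and t: "0 \<le> t" and a: "a \<in> borel_measurable (HM t)"
    and C: "\<And>\<omega>. \<omega> \<in> space P \<Longrightarrow> \<bar>a \<omega>\<bar> \<le> C"
  shows "(\<integral>\<omega>. a \<omega> * cond_pr A t \<omega> \<partial>P) = (\<integral>\<omega>. a \<omega> * indicator A \<omega> \<partial>P)"
proof -
  interpret finite_measure_subalgebra P "HM t" using finite_subalgebra[OF t] .
  have aP: "a \<in> borel_measurable P" using measurable_from_subalg[OF subalgebra_HM[OF t] a] .
  have "integrable P (\<lambda>\<omega>. a \<omega> * indicator A \<omega>)"
    using aP A by (intro integrable_bounded[of _ C]) (auto simp: indicator_def C intro: order_trans[OF abs_ge_zero C])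
  then have "(\<integral>\<omega>. a \<omega> * real_cond_exp P (HM t) (indicator A) \<omega> \<partial>P) = (\<integral>\<omega>. a \<omega> * indicator A \<omega> \<partial>P)"
    using A a by (intro real_cond_exp_intg) auto
  moreover have "(\<integral>\<omega>. a \<omega> * cond_pr A t \<omega> \<partial>P) = (\<integral>\<omega>. a \<omega> * real_cond_exp P (HM t) (indicator A) \<omega> \<partial>P)"
    using aP cond_pr_measurable[OF t] measurable_from_subalg[OF subalgebra_HM[OF t] borel_measurable_cond_exp]
      cond_pr_eq_real_cond_exp[OF A t]
    by (intro integral_cong_AE) auto
  ultimately show ?thesis by simp
qed

lemma cond_pr_integral_on:
  assumes A: "A \<in> events" and t: "0 \<le> t" and B: "B \<in> H t"
  shows "(\<integral>\<omega>. indicator B \<omega> * cond_pr A t \<omega> \<partial>P) = prob (A \<inter> B)"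
proof -
  have "B \<in> sets (HM t)" using B by (simp add: sets_HM[OF t])
  then have "(\<integral>\<omega>. indicator B \<omega> * cond_pr A t \<omega> \<partial>P) = (\<integral>\<omega>. indicator B \<omega> * indicator A \<omega> \<partial>P)"
    by (intro cond_pr_integral_mult[OF A t, of _ 1]) (auto simp: indicator_def)
  also have "\<dots> = (\<integral>\<omega>. indicator (A \<inter> B) \<omega> \<partial>P)"
    by (intro Bochner_Integration.integral_cong) (auto simp: indicator_def)
  finally show ?thesis
    using sets.sets_into_space[OF A] by (simp add: Int_absorb2 le_infI1)
qed

lemma cond_pr_unique:
  assumes A: "A \<in> events" and t: "0 \<le> t" and g: "g \<in> borel_measurable (HM t)"
    and C: "\<And>\<omega>. \<omega> \<in> space P \<Longrightarrow> \<bar>g \<omega>\<bar> \<le> C"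
    and eq: "\<And>B. B \<in> H t \<Longrightarrow> (\<integral>\<omega>. indicator B \<omega> * g \<omega> \<partial>P) = prob (A \<inter> B)"
  shows "AE \<omega> in P. cond_pr A t \<omega> = g \<omega>"
proof -
  interpret finite_measure_subalgebra P "HM t" using finite_subalgebra[OF t] .
  have "AE \<omega> in P. real_cond_exp P (HM t) (indicator A) \<omega> = g \<omega>"
  proof (rule real_cond_exp_charact)
    show "integrable P (indicator A :: 'a \<Rightarrow> real)" using A by (simp add: emeasure_eq_measure)
    show "integrable P g"
      by (rule integrable_bounded[of _ C]) (use measurable_from_subalg[OF subalgebra_HM[OF t] g] C in auto)
    fix B assume "B \<in> sets (HM t)"
    then have B: "B \<in> H t" "B \<in> events" using sets_HM[OF t] H_sub[OF t] by auto
    have "(\<integral>\<omega>. indicator B \<omega> * indicator A \<omega> \<partial>P) = (\<integral>\<omega>. indicat_real (A \<inter> B) \<omega> \<partial>P)"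
      by (intro Bochner_Integration.integral_cong) (auto simp: indicator_def)
    also have "\<dots> = prob (A \<inter> B)" using sets.sets_into_space[OF A] by (simp add: Int_absorb2 le_infI1)
    finally show "(LINT \<omega>:B|P. indicator A \<omega>) = (LINT \<omega>:B|P. g \<omega>)"
      using eq[OF B(1)] by (simp add: set_lebesgue_integral_def)
  qed (rule g)
  with cond_pr_eq_real_cond_exp[OF A t] show ?thesis by eventually_elim simp
qed

lemma cond_pr_cong:
  assumes A: "A \<in> events" and B: "B \<in> events" and t: "0 \<le> t"
    and eq: "AE \<omega> in P. \<omega> \<in> A \<longleftrightarrow> \<omega> \<in> B"
  shows "AE \<omega> in P. cond_pr A t \<omega> = cond_pr B t \<omega>"
proof (rule cond_pr_unique[OF A t, of _ 1])
  fix C assume C: "C \<in> H t"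
  then have "C \<in> events" using H_sub[OF t] by auto
  then have "prob (A \<inter> C) = prob (B \<inter> C)"
    using A B eq by (intro finite_measure_eq_AE) auto
  then show "(\<integral>\<omega>. indicator C \<omega> * cond_pr B t \<omega> \<partial>P) = prob (A \<inter> C)"
    by (simp add: cond_pr_integral_on[OF B t C])
qed (auto simp: cond_pr_bounds)

lemma cond_pr_compl:
  assumes A: "A \<in> events" and t: "0 \<le> t"
  shows "AE \<omega> in P. cond_pr (space P - A) t \<omega> = 1 - cond_pr A t \<omega>"
proof (rule cond_pr_unique[of _ _ _ 1])
  fix C assume C: "C \<in> H t"
  then have [measurable]: "C \<in> events" using H_sub[OF t] by auto
  note cond_pr_measurable[OF t, measurable]
  have "(\<integral>\<omega>. indicator C \<omega> * (1 - cond_pr A t \<omega>) \<partial>P) = (\<integral>\<omega>. indicator C \<omega> - indicator C \<omega> * cond_pr A t \<omega> \<partial>P)"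
    by (simp add: algebra_simps)
  also have "\<dots> = (\<integral>\<omega>. indicator C \<omega> \<partial>P) - (\<integral>\<omega>. indicator C \<omega> * cond_pr A t \<omega> \<partial>P)"
    by (intro Bochner_Integration.integral_diff integrable_bounded[of _ 1])
      (auto simp: cond_pr_bounds indicator_def)
  also have "\<dots> = prob C - prob (A \<inter> C)"
    using cond_pr_integral_on[OF A t C] by simp
  also have "\<dots> = prob ((space P - A) \<inter> C)"
    using A finite_measure_Diff'[of C A] sets.sets_into_space[OF \<open>C \<in> events\<close>]
    by (simp add: Int_Diff[symmetric] Int_commute inf.absorb2)
  finally show "(\<integral>\<omega>. indicator C \<omega> * (1 - cond_pr A t \<omega>) \<partial>P) = prob ((space P - A) \<inter> C)" .
qed (use A t in \<open>auto simp: cond_pr_bounds\<close>)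

lemma cond_pr_Un_disjoint:
  assumes A: "A \<in> events" and B: "B \<in> events" and d: "A \<inter> B = {}" and t: "0 \<le> t"
  shows "AE \<omega> in P. cond_pr (A \<union> B) t \<omega> = cond_pr A t \<omega> + cond_pr B t \<omega>"
proof (rule cond_pr_unique[of _ _ _ 2])
  fix C assume C: "C \<in> H t"
  then have [measurable]: "C \<in> events" using H_sub[OF t] by auto
  note cond_pr_measurable[OF t, measurable]
  have "(\<integral>\<omega>. indicator C \<omega> * (cond_pr A t \<omega> + cond_pr B t \<omega>) \<partial>P)
      = (\<integral>\<omega>. indicator C \<omega> * cond_pr A t \<omega> + indicator C \<omega> * cond_pr B t \<omega> \<partial>P)"
    by (simp add: algebra_simps)
  also have "\<dots> = (\<integral>\<omega>. indicator C \<omega> * cond_pr A t \<omega> \<partial>P) + (\<integral>\<omega>. indicator C \<omega> * cond_pr B t \<omega> \<partial>P)"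
    by (intro Bochner_Integration.integral_add integrable_bounded[of _ 1])
      (auto simp: cond_pr_bounds indicator_def)
  also have "\<dots> = prob (A \<inter> C) + prob (B \<inter> C)"
    using cond_pr_integral_on[OF A t C] cond_pr_integral_on[OF B t C] by simp
  also have "\<dots> = prob ((A \<union> B) \<inter> C)"
    using A B d by (subst finite_measure_Union[symmetric]) (auto simp: Int_Un_distrib2)
  finally show "(\<integral>\<omega>. indicator C \<omega> * (cond_pr A t \<omega> + cond_pr B t \<omega>) \<partial>P) = prob ((A \<union> B) \<inter> C)" .
next
  fix \<omega> show "\<bar>cond_pr A t \<omega> + cond_pr B t \<omega>\<bar> \<le> 2"
    using cond_pr_bounds[of A t \<omega>] cond_pr_bounds[of B t \<omega>] by linarith
qed (use A B t in auto)

lemma cond_pr_empty: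
  assumes "0 \<le> t" shows "AE \<omega> in P. cond_pr {} t \<omega> = 0"
  by (rule cond_pr_unique[of _ _ _ 0]) (use assms in auto)

lemma cond_pr_zero_on:
  assumes A: "A \<in> events" and t: "0 \<le> t" and B: "B \<in> H t" and d: "A \<inter> B = {}"
  shows "AE \<omega> in P. \<omega> \<in> B \<longrightarrow> cond_pr A t \<omega> = 0"
proof -
  have [measurable]: "B \<in> events" using B H_sub[OF t] by auto
  note cond_pr_measurable[OF t, measurable]
  have "(\<integral>\<omega>. indicator B \<omega> * cond_pr A t \<omega> \<partial>P) = 0"
    using cond_pr_integral_on[OF A t B] d by simp
  moreover have "integrable P (\<lambda>\<omega>. indicator B \<omega> * cond_pr A t \<omega>)"
    by (intro integrable_bounded[of _ 1]) (auto simp: cond_pr_bounds indicator_def)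
  ultimately have "AE \<omega> in P. indicator B \<omega> * cond_pr A t \<omega> = 0"
    by (subst (asm) integral_nonneg_eq_0_iff_AE) (auto simp: cond_pr_bounds)
  then show ?thesis by eventually_elim (auto simp: indicator_def)
qed

section \<open>Maximal inequalities and path regularity of conditional probabilities\<close>

text \<open>\<open>B q\<close> is the event that \<open>q\<close> is the first index at which
  \<open>U\<close> occurs. Summing over these disjoint pieces replaces optional stopping at a
  discrete stopping time.\<close>

lemma first_entrance:
  assumes J: "finite J" "J \<subseteq> {0..}" and U: "\<And>q. q \<in> J \<Longrightarrow> U q \<in> H q"
  obtains B where "\<And>q. q \<in> J \<Longrightarrow> B q \<in> H q" "\<And>q. B q \<subseteq> U q" "disjoint_family_on B J"
    "(\<Union>q\<in>J. B q) = (\<Union>q\<in>J. U q)"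
proof
  define B where "B q = U q - (\<Union>p\<in>{p\<in>J. p < q}. U p)" for q
  show "B q \<in> H q" if q: "q \<in> J" for q
  proof -
    interpret sigma_algebra "space P" "H q" using J q by (intro H_sigma_algebra) auto
    have "U p \<in> H q" if "p \<in> J" "p < q" for p
      using U[OF that(1)] H_mono[of p q] that J by auto
    then show ?thesis
      unfolding B_def using U[OF q] J by (intro Diff finite_UN) auto
  qed
  show "disjoint_family_on B J"
    unfolding disjoint_family_on_def B_def
  proof (intro ballI impI)
    fix m n assume "m \<in> J" "n \<in> J" "m \<noteq> n"
    then show "(U m - (\<Union>p\<in>{p \<in> J. p < m}. U p)) \<inter> (U n - (\<Union>p\<in>{p \<in> J. p < n}. U p)) = {}"
      by (cases "m < n") auto
  qed
  have "\<omega> \<in> (\<Union>q\<in>J. B q)" if q: "q \<in> J" "\<omega> \<in> U q" for q \<omega>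
  proof -
    let ?K = "{q\<in>J. \<omega> \<in> U q}"
    have fin: "finite ?K" "?K \<noteq> {}" using J q by auto
    have "Min ?K \<in> ?K" using fin by (rule Min_in)
    moreover have "\<omega> \<notin> U p" if "p \<in> J" "p < Min ?K" for p
      using Min_le[OF fin(1), of p] that by auto
    ultimately have "\<omega> \<in> B (Min ?K)" unfolding B_def by auto
    then show ?thesis using \<open>Min ?K \<in> ?K\<close> by blast
  qed
  then show "(\<Union>q\<in>J. B q) = (\<Union>q\<in>J. U q)"
    unfolding B_def by blast
  show "B q \<subseteq> U q" for q by (auto simp: B_def)
qed

lemma prob_UN_countable_le:
  assumes D: "countable D" and U: "\<And>q. q \<in> D \<Longrightarrow> U q \<in> events"
    and bound: "\<And>J. finite J \<Longrightarrow> J \<subseteq> D \<Longrightarrow> prob (\<Union>q\<in>J. U q) \<le> c"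
  shows "prob (\<Union>q\<in>D. U q) \<le> c"
proof (cases "D = {}")
  case True
  then show ?thesis using bound[of "{}"] by simp
next
  case False
  define W where "W n = (\<Union>i\<le>n. U (from_nat_into D i))" for n
  have r: "from_nat_into D i \<in> D" for i using False by (rule from_nat_into)
  have "(\<lambda>n. prob (W n)) \<longlonglongrightarrow> prob (\<Union>n. W n)"
    by (rule finite_Lim_measure_incseq)
      (use r U in \<open>auto simp: W_def incseq_def intro!: sets.finite_UN intro: order_trans\<close>)
  moreover have "(\<Union>n. W n) = (\<Union>q\<in>D. U q)"
  proof (intro equalityI subsetI)
    fix x assume "x \<in> (\<Union>q\<in>D. U q)"
    then obtain q where q: "q \<in> D" "x \<in> U q" by blast
    obtain i where "from_nat_into D i = q" using from_nat_into_surj[OF D q(1)] by blast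
    with q(2) show "x \<in> (\<Union>n. W n)" unfolding W_def by blast
  qed (use r in \<open>auto simp only: W_def UN_iff\<close>)
  moreover have "prob (W n) \<le> c" for n
  proof -
    have "W n = (\<Union>q\<in>from_nat_into D ` {..n}. U q)" unfolding W_def by blast
    also have "prob \<dots> \<le> c" by (rule bound) (use r in blast)+
    finally show ?thesis .
  qed
  ultimately show ?thesis
    by (metis LIMSEQ_le_const2)
qed

text \<open>Doob's maximal inequality. On the first-entrance piece \<open>B q\<close> the martingale
  exceeds \<open>c\<close>, and its integral over \<open>B q\<close> is the probability of
  \<open>A \<inter> B q\<close>; summing over \<open>q\<close> gives the bound for finite
  \<open>J\<close>, and continuity from below does the rest.\<close>

lemma cond_pr_maximal:
  assumes A: "A \<in> events" and c: "0 < c"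
  shows "c * prob (\<Union>q\<in>Qp. {\<omega>\<in>space P. cond_pr A q \<omega> > c}) \<le> prob A"
proof -
  let ?U = "\<lambda>q. {\<omega>\<in>space P. cond_pr A q \<omega> > c}"
  have UH: "?U q \<in> H q" if "0 \<le> q" for q
  proof -
    have "{\<omega>\<in>space (HM q). cond_pr A q \<omega> > c} \<in> sets (HM q)" by measurable
    then show ?thesis by (simp add: sets_HM[OF that])
  qed
  have "prob (\<Union>q\<in>Qp. ?U q) \<le> prob A / c"
  proof (rule prob_UN_countable_le[OF countable_Qp])
    show "?U q \<in> events" if "q \<in> Qp" for q using UH[of q] H_sub[of q] that by auto
    fix J assume J: "finite J" "J \<subseteq> Qp"
    obtain B where B: "\<And>q. q \<in> J \<Longrightarrow> B q \<in> H q" "\<And>q. B q \<subseteq> ?U q" "disjoint_family_on B J"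
        "(\<Union>q\<in>J. B q) = (\<Union>q\<in>J. ?U q)"
      by (rule first_entrance[of J ?U]) (use J UH in auto)
    have BE: "B q \<in> events" if "q \<in> J" for q using B(1)[OF that] H_sub[of q] J that by auto
    have "c * prob (B q) \<le> prob (A \<inter> B q)" if q: "q \<in> J" for q
    proof -
      have q0: "0 \<le> q" using J q by auto
      have "c * prob (B q) = (\<integral>\<omega>. indicator (B q) \<omega> * c \<partial>P)" using BE[OF q] by simp
      also have "\<dots> \<le> (\<integral>\<omega>. indicator (B q) \<omega> * cond_pr A q \<omega> \<partial>P)"
        using BE[OF q] B(2)[of q] cond_pr_measurable[OF q0] c
        by (intro integral_mono integrable_bounded[of _ "max 1 c"])
          (auto simp: indicator_def cond_pr_bounds max.coboundedI1 intro: less_imp_le)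
      also have "\<dots> = prob (A \<inter> B q)" by (rule cond_pr_integral_on[OF A q0 B(1)[OF q]])
      finally show ?thesis .
    qed
    then have "c * (\<Sum>q\<in>J. prob (B q)) \<le> (\<Sum>q\<in>J. prob (A \<inter> B q))"
      unfolding sum_distrib_left by (intro sum_mono)
    also have "(\<Sum>q\<in>J. prob (B q)) = prob (\<Union>q\<in>J. B q)"
      using J(1) B(3) BE by (intro finite_measure_finite_Union[symmetric]) auto
    also have "(\<Sum>q\<in>J. prob (A \<inter> B q)) = prob (\<Union>q\<in>J. A \<inter> B q)"
      using J(1) B(3) BE A by (intro finite_measure_finite_Union[symmetric]) (auto simp: disjoint_family_on_def)
    also have "\<dots> \<le> prob A"
      using A by (intro finite_measure_mono) auto
    finally show "prob (\<Union>q\<in>J. ?U q) \<le> prob A / c"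
      using c unfolding B(4) by (simp add: field_simps)
  qed
  then show ?thesis using c by (simp add: field_simps)
qed

text \<open>The first-entrance argument with the inequality reversed: once the conditional
  probability of \<open>A\<close> has dropped below \<open>c\<close>, the event \<open>A\<close>
  occurs with proportion at most \<open>c\<close>. This is the quantitative form of absorption of a
  nonnegative martingale at zero.\<close>

lemma cond_pr_minimal:
  assumes A: "A \<in> events" and c: "0 < c"
  shows "prob (\<Union>q\<in>Qp. A \<inter> {\<omega>\<in>space P. cond_pr A q \<omega> < c}) \<le> c"
proof -
  let ?U = "\<lambda>q. {\<omega>\<in>space P. cond_pr A q \<omega> < c}"
  have UH: "?U q \<in> H q" if "0 \<le> q" for q
  proof -
    have "{\<omega>\<in>space (HM q). cond_pr A q \<omega> < c} \<in> sets (HM q)" by measurable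
    then show ?thesis by (simp add: sets_HM[OF that])
  qed
  show ?thesis
  proof (rule prob_UN_countable_le[OF countable_Qp])
    show "A \<inter> ?U q \<in> events" if "q \<in> Qp" for q using UH[of q] H_sub[of q] that A by auto
    fix J assume J: "finite J" "J \<subseteq> Qp"
    obtain B where B: "\<And>q. q \<in> J \<Longrightarrow> B q \<in> H q" "\<And>q. B q \<subseteq> ?U q" "disjoint_family_on B J"
        "(\<Union>q\<in>J. B q) = (\<Union>q\<in>J. ?U q)"
      by (rule first_entrance[of J ?U]) (use J UH in auto)
    have BE: "B q \<in> events" if "q \<in> J" for q using B(1)[OF that] H_sub[of q] J that by auto
    have le: "prob (A \<inter> B q) \<le> c * prob (B q)" if q: "q \<in> J" for q
    proof -
      have q0: "0 \<le> q" using J q by auto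
      have "prob (A \<inter> B q) = (\<integral>\<omega>. indicator (B q) \<omega> * cond_pr A q \<omega> \<partial>P)"
        by (rule cond_pr_integral_on[OF A q0 B(1)[OF q], symmetric])
      also have "\<dots> \<le> (\<integral>\<omega>. indicator (B q) \<omega> * c \<partial>P)"
        using BE[OF q] B(2)[of q] cond_pr_measurable[OF q0] c
        by (intro integral_mono integrable_bounded[of _ "max 1 c"])
          (auto simp: indicator_def cond_pr_bounds max.coboundedI1 intro: less_imp_le)
      also have "\<dots> = c * prob (B q)" using BE[OF q] by simp
      finally show ?thesis .
    qed
    have "(\<Union>q\<in>J. A \<inter> ?U q) = (\<Union>q\<in>J. A \<inter> B q)" using B(4) by blast
    then have "prob (\<Union>q\<in>J. A \<inter> ?U q) = prob (\<Union>q\<in>J. A \<inter> B q)" by simp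
    also have "\<dots> = (\<Sum>q\<in>J. prob (A \<inter> B q))"
      using J(1) B(3) BE A by (intro finite_measure_finite_Union) (auto simp: disjoint_family_on_def)
    also have "\<dots> \<le> (\<Sum>q\<in>J. c * prob (B q))" by (intro sum_mono le)
    also have "\<dots> = c * prob (\<Union>q\<in>J. B q)"
      using J(1) B(3) BE by (subst finite_measure_finite_Union) (auto simp: sum_distrib_left)
    also have "\<dots> \<le> c" using c by (simp add: mult_le_cancel_left1)
    finally show "prob (\<Union>q\<in>J. A \<inter> ?U q) \<le> c" .
  qed
qed

text \<open>The part of \<open>A\<close> on which the path drops below \<open>1 / Suc k\<close> has
  probability at most \<open>1 / Suc k\<close>, so the intersection over \<open>k\<close> is null. A
  lower bound uniform in time survives passage to right limits, unlike mere positivity.\<close>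

lemma cond_pr_bounded_below_on:
  assumes A: "A \<in> events"
  shows "AE \<omega> in P. \<omega> \<in> A \<longrightarrow> (\<exists>k::nat. \<forall>q\<in>Qp. 1 / Suc k \<le> cond_pr A q \<omega>)"
proof -
  define N where "N k = (\<Union>q\<in>Qp. A \<inter> {\<omega>\<in>space P. cond_pr A q \<omega> < 1 / Suc k})" for k :: nat
  have [measurable]: "N k \<in> events" for k
    unfolding N_def using A cond_pr_measurable by (intro sets.countable_UN' countable_Qp) auto
  have bound: "prob (\<Inter>k. N k) \<le> 1 / Suc k" for k
  proof -
    have "prob (\<Inter>k. N k) \<le> prob (N k)" by (intro finite_measure_mono) auto
    also have "\<dots> \<le> 1 / Suc k" unfolding N_def by (rule cond_pr_minimal[OF A]) simp
    finally show ?thesis .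
  qed
  have "prob (\<Inter>k. N k) \<le> 0"
    by (rule LIMSEQ_le_const[OF LIMSEQ_Suc[OF lim_1_over_n]]) (use bound in auto)
  then have "prob (\<Inter>k. N k) = 0" using measure_nonneg[of P "\<Inter>k. N k"] by linarith
  then have "(\<Inter>k. N k) \<in> null_sets P" by (auto simp: null_sets_def emeasure_eq_measure)
  from AE_not_in[OF this] show ?thesis
  proof (rule AE_mp, intro AE_I2 impI)
    fix \<omega> assume "\<omega> \<in> space P" "\<omega> \<notin> (\<Inter>k. N k)" "\<omega> \<in> A"
    then show "\<exists>k::nat. \<forall>q\<in>Qp. 1 / Suc k \<le> cond_pr A q \<omega>"
      unfolding N_def by (auto simp: not_less)
  qed
qed

text \<open>At a fixed level \<open>c\<close> the maximal inequality bounds the exceedance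
  probability by \<open>prob (A n) / c\<close>, which tends to 0, so almost surely some
  \<open>n\<close> is never exceeded. Applied later to the tails of a disjoint union.\<close>

lemma cond_pr_uniformly_vanishing:
  assumes A: "\<And>n. A n \<in> events" and lim: "(\<lambda>n. prob (A n)) \<longlonglongrightarrow> 0" and c: "0 < c"
  shows "AE \<omega> in P. \<exists>n. \<forall>q\<in>Qp. cond_pr (A n) q \<omega> \<le> c"
proof -
  define N where "N k = (\<Union>q\<in>Qp. {\<omega>\<in>space P. cond_pr (A k) q \<omega> > c})" for k :: nat
  have [measurable]: "N k \<in> events" for k
    unfolding N_def using A cond_pr_measurable by (intro sets.countable_UN' countable_Qp) auto
  have "c * prob (\<Inter>k. N k) \<le> prob (A k)" for k
  proof -
    have "c * prob (\<Inter>k. N k) \<le> c * prob (N k)"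
      using c by (intro mult_left_mono finite_measure_mono) auto
    also have "\<dots> \<le> prob (A k)" unfolding N_def by (rule cond_pr_maximal[OF A c])
    finally show ?thesis .
  qed
  then have "c * prob (\<Inter>k. N k) \<le> 0"
    using LIMSEQ_le_const[OF lim] by blast
  then have "prob (\<Inter>k. N k) = 0"
    using c measure_nonneg[of P "\<Inter>k. N k"] by (auto simp: mult_le_0_iff intro: antisym)
  then have "(\<Inter>k. N k) \<in> null_sets P" by (auto simp: null_sets_def emeasure_eq_measure)
  from AE_not_in[OF this] show ?thesis
  proof (rule AE_mp, intro AE_I2 impI)
    fix \<omega> assume "\<omega> \<in> space P" "\<omega> \<notin> (\<Inter>k. N k)"
    then show "\<exists>n. \<forall>q\<in>Qp. cond_pr (A n) q \<omega> \<le> c"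
      unfolding N_def by (auto simp: not_less)
  qed
qed

text \<open>With \<open>a j\<close> the anchor and \<open>c j\<close> the count of the greedy oscillation procedure run along the
  martingale \<open>x j\<close>, the expectation of \<open>(x j)\<^sup>2 - e\<^sup>2 * c j - (x j - a j)\<^sup>2\<close> is nondecreasing in \<open>j\<close>:
  each increment dominates \<open>2 * a j * (x (Suc j) - x j)\<close>, which has mean zero.\<close>

lemma expectation_osc_count_le:
  assumes A: "A \<in> events" and s: "mono s" "\<And>j. 0 \<le> s j" and e: "0 < e"
  shows "(\<lambda>\<omega>. real (osc_count (\<lambda>i. cond_pr A (s i) \<omega>) e n)) \<in> borel_measurable (HM (s n))"
    and "e\<^sup>2 * (\<integral>\<omega>. real (osc_count (\<lambda>i. cond_pr A (s i) \<omega>) e n) \<partial>P) \<le> 1"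
proof -
  define x where "x j \<omega> = cond_pr A (s j) \<omega>" for j \<omega>
  define a where "a j \<omega> = osc_anchor (\<lambda>i. x i \<omega>) e j" for j \<omega>
  define c where "c j \<omega> = real (osc_count (\<lambda>i. x i \<omega>) e j)" for j \<omega>
  have x_meas: "x i \<in> borel_measurable (HM (s j))" if "i \<le> j" for i j
    unfolding x_def[abs_def] using that s by (intro cond_pr_measurable_later monoD[OF s(1)]) auto
  have ac_meas: "a j \<in> borel_measurable (HM (s j)) \<and> c j \<in> borel_measurable (HM (s j))" for j
  proof (induction j)
    case 0
    show ?case using x_meas[of 0 0] by (simp add: a_def c_def)
  next
    case (Suc j)
    note sub = measurable_from_subalg[OF subalgebra_HM_mono[OF s(2) monoD[OF s(1)]], of j "Suc j"]
    have [measurable]: "a j \<in> borel_measurable (HM (s (Suc j)))" "c j \<in> borel_measurable (HM (s (Suc j)))"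
        "x (Suc j) \<in> borel_measurable (HM (s (Suc j)))"
      using Suc x_meas[of "Suc j" "Suc j"] by (auto intro: sub)
    have "a (Suc j) = (\<lambda>\<omega>. if \<bar>x (Suc j) \<omega> - a j \<omega>\<bar> > e then x (Suc j) \<omega> else a j \<omega>)"
         "c (Suc j) = (\<lambda>\<omega>. if \<bar>x (Suc j) \<omega> - a j \<omega>\<bar> > e then c j \<omega> + 1 else c j \<omega>)"
      by (auto simp: a_def c_def fun_eq_iff)
    then show ?case by simp
  qed
  show "(\<lambda>\<omega>. real (osc_count (\<lambda>i. cond_pr A (s i) \<omega>) e n)) \<in> borel_measurable (HM (s n))"
    using ac_meas[of n] unfolding c_def[abs_def] x_def by simp
  have x01: "0 \<le> x j \<omega>" "x j \<omega> \<le> 1" for j \<omega> by (auto simp: x_def cond_pr_bounds)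
  have a01: "0 \<le> a j \<omega> \<and> a j \<omega> \<le> 1" for j \<omega>
    by (induction j) (auto simp: a_def x01)
  have c_bound: "0 \<le> c j \<omega>" "c j \<omega> \<le> real j" for j \<omega>
    using osc_count_le[of "\<lambda>i. x i \<omega>" e j] by (auto simp: c_def)
  have toP: "f \<in> borel_measurable P" if "f \<in> borel_measurable (HM (s j))" for f :: "'a \<Rightarrow> real" and j
    by (rule measurable_from_subalg[OF subalgebra_HM[OF s(2)] that])
  have [measurable]: "x j \<in> borel_measurable P" "a j \<in> borel_measurable P" "c j \<in> borel_measurable P" for j
    using x_meas[of j j] ac_meas[of j] by (auto intro: toP)
  have ix: "integrable P (\<lambda>\<omega>. (x j \<omega>)\<^sup>2)" for j
    by (rule integrable_bounded[of _ 1]) (auto simp: x01 power_le_one abs_le_iff)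
  have ic: "integrable P (\<lambda>\<omega>. e\<^sup>2 * c j \<omega>)" for j
    by (rule integrable_bounded[of _ "e\<^sup>2 * j"]) (auto simp: c_bound abs_mult mult_left_mono)
  have id: "integrable P (\<lambda>\<omega>. (x j \<omega> - a j \<omega>)\<^sup>2)" for j
  proof (rule integrable_bounded[of _ 1])
    fix \<omega>
    have "\<bar>x j \<omega> - a j \<omega>\<bar> \<le> 1" using x01[of j \<omega>] a01[of j \<omega>] by linarith
    then show "\<bar>(x j \<omega> - a j \<omega>)\<^sup>2\<bar> \<le> 1" by (simp add: abs_square_le_1)
  qed measurable
  have im: "integrable P (\<lambda>\<omega>. a j \<omega> * x i \<omega>)" for i j
  proof (rule integrable_bounded[of _ 1])
    fix \<omega>
    show "\<bar>a j \<omega> * x i \<omega>\<bar> \<le> 1"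
      using x01[of i \<omega>] a01[of j \<omega>] by (simp add: abs_mult mult_le_one)
  qed measurable
  define \<Phi> where "\<Phi> j = (\<integral>\<omega>. (x j \<omega>)\<^sup>2 - e\<^sup>2 * c j \<omega> - (x j \<omega> - a j \<omega>)\<^sup>2 \<partial>P)" for j
  have "0 \<le> \<Phi> j" for j
  proof (induction j)
    case 0
    show ?case by (simp add: \<Phi>_def a_def c_def)
  next
    case (Suc j)
    \<comment> \<open>\<open>a j\<close> is known at time \<open>s j\<close>, hence at every later
      \<open>s i\<close>, and both sides equal the integral of \<open>a j\<close> over
      \<open>A\<close>.\<close>
    have zero: "(\<integral>\<omega>. a j \<omega> * x (Suc j) \<omega> \<partial>P) = (\<integral>\<omega>. a j \<omega> * x j \<omega> \<partial>P)"
    proof -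
      have "(\<integral>\<omega>. a j \<omega> * x i \<omega> \<partial>P) = (\<integral>\<omega>. a j \<omega> * indicator A \<omega> \<partial>P)" if "j \<le> i" for i
        unfolding x_def
      proof (rule cond_pr_integral_mult[OF A s(2), of _ _ 1])
        show "a j \<in> borel_measurable (HM (s i))"
          using ac_meas[of j]
          by (intro measurable_from_subalg[OF subalgebra_HM_mono[OF s(2) monoD[OF s(1) that]]]) simp
      qed (use a01 in auto)
      from this[of j] this[of "Suc j"] show ?thesis by simp
    qed
    have "\<Phi> j = \<Phi> j + 2 * ((\<integral>\<omega>. a j \<omega> * x (Suc j) \<omega> \<partial>P) - (\<integral>\<omega>. a j \<omega> * x j \<omega> \<partial>P))"
      using zero by simp
    also have "\<dots> = (\<integral>\<omega>. ((x j \<omega>)\<^sup>2 - e\<^sup>2 * c j \<omega> - (x j \<omega> - a j \<omega>)\<^sup>2)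
        + 2 * (a j \<omega> * x (Suc j) \<omega> - a j \<omega> * x j \<omega>) \<partial>P)"
      unfolding \<Phi>_def using ix ic id im by simp
    also have "\<dots> \<le> \<Phi> (Suc j)"
      unfolding \<Phi>_def
    proof (rule integral_mono)
      fix \<omega>
      show "(x j \<omega>)\<^sup>2 - e\<^sup>2 * c j \<omega> - (x j \<omega> - a j \<omega>)\<^sup>2 + 2 * (a j \<omega> * x (Suc j) \<omega> - a j \<omega> * x j \<omega>)
        \<le> (x (Suc j) \<omega>)\<^sup>2 - e\<^sup>2 * c (Suc j) \<omega> - (x (Suc j) \<omega> - a (Suc j) \<omega>)\<^sup>2"
      \<comment> \<open>Up to the common term \<open>e\<^sup>2 * c j\<close>, the left side
        collapses to \<open>2 * a j * x (Suc j) - (a j)\<^sup>2\<close>. Without a move this equals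
        the right side. With a move the last square vanishes, and
        \<open>(x (Suc j) - a j)\<^sup>2 \<ge> e\<^sup>2\<close> pays for the extra count.\<close>
      proof (cases "\<bar>x (Suc j) \<omega> - a j \<omega>\<bar> > e")
        case True
        then have "e\<^sup>2 \<le> (x (Suc j) \<omega> - a j \<omega>)\<^sup>2"
          using e by (metis abs_le_square_iff abs_of_pos less_imp_le)
        moreover have "a (Suc j) \<omega> = x (Suc j) \<omega>" "c (Suc j) \<omega> = c j \<omega> + 1"
          using True by (auto simp: a_def c_def)
        ultimately show ?thesis
          by (simp add: power2_eq_square algebra_simps)
      next
        case False
        then have "a (Suc j) \<omega> = a j \<omega>" "c (Suc j) \<omega> = c j \<omega>" by (auto simp: a_def c_def)
        then show ?thesis by (simp add: power2_eq_square algebra_simps)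
      qed
    qed (use ix ic id im in auto)
    finally show ?case using Suc by simp
  qed
  then have "0 \<le> \<Phi> n" .
  also have "\<Phi> n = (\<integral>\<omega>. (x n \<omega>)\<^sup>2 - (x n \<omega> - a n \<omega>)\<^sup>2 \<partial>P) - e\<^sup>2 * (\<integral>\<omega>. c n \<omega> \<partial>P)"
    unfolding \<Phi>_def using ix[of n] ic[of n] id[of n] e by (simp add: integrable_mult_left_iff)
  also have "(\<integral>\<omega>. (x n \<omega>)\<^sup>2 - (x n \<omega> - a n \<omega>)\<^sup>2 \<partial>P) \<le> (\<integral>\<omega>. 1 \<partial>P)"
  proof (rule integral_mono)
    fix \<omega>
    have "(x n \<omega>)\<^sup>2 \<le> 1" by (simp add: x01 power_le_one)
    moreover have "0 \<le> (x n \<omega> - a n \<omega>)\<^sup>2" by simp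
    ultimately show "(x n \<omega>)\<^sup>2 - (x n \<omega> - a n \<omega>)\<^sup>2 \<le> 1" by linarith
  qed (use ix id in auto)
  finally show "e\<^sup>2 * (\<integral>\<omega>. real (osc_count (\<lambda>i. cond_pr A (s i) \<omega>) e n) \<partial>P) \<le> 1"
    by (simp add: c_def[abs_def] x_def prob_space)
qed

text \<open>The expected counts are at most \<open>(Suc k)\<^sup>2\<close> on every grid, so by
  Fatou their liminf is almost surely finite, that is, the counts are bounded for infinitely many
  \<open>m\<close>.\<close>

lemma cond_pr_finite_oscillation:
  assumes A: "A \<in> events"
  obtains N where "N \<in> sigma_sets (space P) (\<Union>t\<in>{0..}. H t)" "N \<in> null_sets P"
    "\<And>\<omega>. \<omega> \<in> space P - N \<Longrightarrow> finite_oscillation (\<lambda>q. cond_pr A q \<omega>)"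
proof -
  let ?HI = "sigma (space P) (\<Union>t\<in>{0..}. H t)"
  define c where "c k m \<omega> = osc_count (\<lambda>i. cond_pr A (real i / fact m) \<omega>) (1 / Suc k) (m * fact m)"
    for k m :: nat and \<omega>
  define u where "u k m \<omega> = ennreal (real (c k m \<omega>))" for k m \<omega>
  have sub: "(\<Union>t\<in>{0..}. H t) \<subseteq> Pow (space P)"
    using H_sub sets.sets_into_space by blast
  have sets_HI: "sets ?HI = sigma_sets (space P) (\<Union>t\<in>{0..}. H t)"
    using sub by simp
  have HI_P: "subalgebra P ?HI"
    unfolding subalgebra_def sets_HI
    using H_sub by (auto intro!: sets.sigma_sets_subset simp: space_measure_of_conv)
  have HM_HI: "subalgebra ?HI (HM t)" if "0 \<le> t" for t
    unfolding subalgebra_def sets_HI sets_HM[OF that] using that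
    by (auto simp: space_measure_of_conv intro!: sigma_sets.Basic)
  have mono: "mono (\<lambda>i. real i / fact m)" for m by (auto simp: mono_def divide_right_mono)
  note osc = expectation_osc_count_le[OF A mono, of _ "1 / Suc k" "m * fact m" for k m]
  have [measurable]: "u k m \<in> borel_measurable ?HI" for k m
    unfolding u_def[abs_def] c_def
    by (intro measurable_compose[OF _ measurable_ennreal] measurable_from_subalg[OF HM_HI osc(1)]) auto
  have uP: "u k m \<in> borel_measurable P" for k m
    by (rule measurable_from_subalg[OF HI_P]) measurable
  \<comment> \<open>An explicit set instead of an arbitrary exceptional one: it is measurable for
    the sigma-algebra generated by all \<open>H t\<close>, the form in which completeness later
    places it in \<open>H 0\<close>.\<close>
  define N where "N = {\<omega>\<in>space ?HI. \<exists>k. liminf (\<lambda>m. u k m \<omega>) = \<infinity>}"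
  have N_HI: "N \<in> sets ?HI" unfolding N_def by measurable
  have "AE \<omega> in P. liminf (\<lambda>m. u k m \<omega>) \<noteq> \<infinity>" for k
  proof (rule nn_integral_PInf_AE)
    show "(\<lambda>\<omega>. liminf (\<lambda>m. u k m \<omega>)) \<in> borel_measurable P" using uP by measurable
    have "(\<integral>\<^sup>+\<omega>. u k m \<omega> \<partial>P) \<le> ennreal ((real (Suc k))\<^sup>2)" for m
    proof -
      have int: "integrable P (\<lambda>\<omega>. real (c k m \<omega>))"
      proof (rule integrable_bounded[of _ "real (m * fact m)"])
        show "(\<lambda>\<omega>. real (c k m \<omega>)) \<in> borel_measurable P"
          unfolding c_def by (rule measurable_from_subalg[OF subalgebra_HM osc(1)]) auto
      qed (unfold c_def, use osc_count_le in \<open>simp del: of_nat_mult\<close>)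
      have "(\<integral>\<^sup>+\<omega>. u k m \<omega> \<partial>P) = ennreal (\<integral>\<omega>. real (c k m \<omega>) \<partial>P)"
        unfolding u_def using int by (intro nn_integral_eq_integral) auto
      also have "\<dots> \<le> ennreal ((real (Suc k))\<^sup>2)"
      proof (rule ennreal_leI)
        have "(1 / Suc k)\<^sup>2 * (\<integral>\<omega>. real (c k m \<omega>) \<partial>P) \<le> 1"
          unfolding c_def by (rule osc(2)) auto
        then show "(\<integral>\<omega>. real (c k m \<omega>) \<partial>P) \<le> (real (Suc k))\<^sup>2"
          by (simp add: power_divide field_simps)
      qed
      finally show ?thesis .
    qed
    then have "liminf (\<lambda>m. \<integral>\<^sup>+\<omega>. u k m \<omega> \<partial>P) \<le> ennreal ((real (Suc k))\<^sup>2)"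
      by (intro Liminf_le) auto
    with nn_integral_liminf[of "u k" P] uP
    have "(\<integral>\<^sup>+\<omega>. liminf (\<lambda>m. u k m \<omega>) \<partial>P) \<le> ennreal ((real (Suc k))\<^sup>2)"
      by (meson order_trans)
    then show "(\<integral>\<^sup>+\<omega>. liminf (\<lambda>m. u k m \<omega>) \<partial>P) \<noteq> \<infinity>"
      by (auto simp: top_unique)
  qed
  then have "AE \<omega> in P. \<forall>k. liminf (\<lambda>m. u k m \<omega>) \<noteq> \<infinity>"
    by (subst AE_all_countable) simp
  then have "AE \<omega> in P. \<omega> \<notin> N"
    by eventually_elim (auto simp: N_def)
  then have N_null: "N \<in> null_sets P"
    using N_HI HI_P by (subst AE_iff_null_sets) (auto simp: subalgebra_def)
  have "finite_oscillation (\<lambda>q. cond_pr A q \<omega>)" if \<omega>: "\<omega> \<in> space P - N" for \<omega>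
    unfolding finite_oscillation_def
  proof
    fix k
    have fin: "liminf (\<lambda>m. u k m \<omega>) \<noteq> \<infinity>"
      using \<omega> by (auto simp: N_def space_measure_of_conv)
    have "\<exists>K::nat. \<exists>\<^sub>F m in sequentially. c k m \<omega> \<le> K"
    proof (rule ccontr)
      assume "\<not> ?thesis"
      then have ev: "\<forall>\<^sub>F m in sequentially. K < c k m \<omega>" for K
        by (auto simp: frequently_def not_le)
      have "of_nat K \<le> liminf (\<lambda>m. u k m \<omega>)" for K
        by (rule Liminf_bounded) (use ev[of K] in eventually_elim, auto simp: u_def ennreal_of_nat_eq_real_of_nat)
      then have "liminf (\<lambda>m. u k m \<omega>) = \<infinity>"
        by (metis ennreal_Ex_less_of_nat infinity_ennreal_def leD top.not_eq_extremum)
      with fin show False by simp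
    qed
    then show "\<exists>K. \<exists>\<^sub>F m in sequentially.
        osc_count (\<lambda>i. cond_pr A (real i / fact m) \<omega>) (1 / Suc k) (m * fact m) \<le> K"
      unfolding c_def .
  qed
  with that[OF _ N_null] N_HI sets_HI show thesis by simp
qed

text \<open>The right limit at \<open>t\<close> is measurable for every \<open>H s\<close> with
  \<open>s > t\<close>, hence for \<open>H t\<close> by right continuity. Since
  \<open>cadlag_paths\<close> speaks of every path, paths in the null set \<open>N\<close> are
  replaced by 0, which keeps \<open>b\<close> adapted because \<open>N\<close> lies in
  \<open>H 0\<close>.\<close>

lemma cond_pr_cadlag_version:
  assumes A: "A \<in> events"
    and rc: "\<And>t. 0 \<le> t \<Longrightarrow> H t = (\<Inter>s\<in>{t<..}. H s)"
    and null: "\<And>N. N \<in> sigma_sets (space P) (\<Union>t\<in>{0..}. H t) \<Longrightarrow> N \<in> null_sets P \<Longrightarrow> N \<in> H 0"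
  obtains b N where "adapted (space P) H b" "cadlag_paths (space P) b" "N \<in> null_sets P"
    "\<And>\<omega> t. \<omega> \<in> space P - N \<Longrightarrow> 0 \<le> t \<Longrightarrow>
       ((\<lambda>q. cond_pr A q \<omega>) \<longlongrightarrow> b t \<omega>) (at t within (Qp \<inter> {t<..}))"
proof -
  obtain N where N: "N \<in> sigma_sets (space P) (\<Union>t\<in>{0..}. H t)" "N \<in> null_sets P"
    and osc: "\<And>\<omega>. \<omega> \<in> space P - N \<Longrightarrow> finite_oscillation (\<lambda>q. cond_pr A q \<omega>)"
    using cond_pr_finite_oscillation[OF A] by blast
  have N0: "N \<in> H 0" using null[OF N] .
  define b where "b t \<omega> = (if \<omega> \<in> N then 0 else right_lim (\<lambda>q. cond_pr A q \<omega>) t)" for t \<omega>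
  have lim: "((\<lambda>q. cond_pr A q \<omega>) \<longlongrightarrow> b t \<omega>) (at t within (Qp \<inter> {t<..}))"
    if "\<omega> \<in> space P - N" "0 \<le> t" for \<omega> t
    using right_lim_tendsto[OF osc[OF that(1)] that(2)] that(1) by (simp add: b_def)
  have meas: "b t \<in> borel_measurable (HM s)" if t: "0 \<le> t" and s: "t < s" for t s
  proof -
    \<comment> \<open>Rational times tending to \<open>t\<close> from the right but staying below
      \<open>s\<close>, so that all the approximating variables are measurable at time
      \<open>s\<close>.\<close>
    have "\<exists>d. d \<in> Qp \<and> t < d \<and> d < min s (t + 1 / Suc n)" for n
      by (rule Qp_dense[of t "min s (t + 1 / Suc n)"]) (use s t in auto)
    then obtain d where d: "\<And>n. d n \<in> Qp \<and> t < d n \<and> d n < min s (t + 1 / Suc n)" by metis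
    have "(\<lambda>n. t + 1 / Suc n) \<longlonglongrightarrow> t + 0"
      by (intro tendsto_add tendsto_const LIMSEQ_Suc[OF lim_1_over_n])
    then have dt: "d \<longlonglongrightarrow> t"
      by (intro tendsto_sandwich[of "\<lambda>_. t" d sequentially "\<lambda>n. t + 1 / Suc n" t]) (use d in \<open>auto intro!: always_eventually less_imp_le\<close>)
    have dlim: "filterlim d (at t within (Qp \<inter> {t<..})) sequentially"
      unfolding filterlim_at using dt d by (auto intro!: always_eventually)
    have N_s: "N \<in> sets (HM s)"
      using N0 H_mono[of 0 s] t s by (auto simp: sets_HM)
    have "(\<lambda>\<omega>. if \<omega> \<in> N then 0 else cond_pr A (d n) \<omega>) \<in> borel_measurable (HM s)" for n
    proof -
      have [measurable]: "cond_pr A (d n) \<in> borel_measurable (HM s)"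
        using d[of n] by (intro cond_pr_measurable_later) auto
      show ?thesis using N_s by measurable
    qed
    moreover have "(\<lambda>n. if \<omega> \<in> N then 0 else cond_pr A (d n) \<omega>) \<longlonglongrightarrow> b t \<omega>" if "\<omega> \<in> space (HM s)" for \<omega>
    proof (cases "\<omega> \<in> N")
      case False
      with that have "\<omega> \<in> space P - N" by simp
      from filterlim_compose[OF lim[OF this t] dlim] False show ?thesis by simp
    qed (simp add: b_def)
    ultimately show ?thesis
      by (rule borel_measurable_LIMSEQ_real[rotated])
  qed
  have "adapted (space P) H b"
    unfolding adapted_def
  proof (intro allI impI ballI)
    fix t :: real and B :: "real set" assume t: "0 \<le> t" and B: "B \<in> sets borel"
    have "{\<omega>\<in>space P. b t \<omega> \<in> B} \<in> H s" if "t < s" for s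
      using measurable_sets[OF meas[OF t that] B] t that
      by (simp add: sets_HM vimage_def Int_def conj_commute)
    then show "{\<omega>\<in>space P. b t \<omega> \<in> B} \<in> H t" by (subst rc[OF t]) auto
  qed
  moreover have "cadlag_paths (space P) b"
    unfolding cadlag_paths_def
  proof (intro ballI conjI allI impI)
    fix \<omega> t assume \<omega>: "\<omega> \<in> space P"
    show "continuous (at_right t) (\<lambda>s. b s \<omega>)" if "0 \<le> t"
      using right_lim_cadlag(1)[OF osc that, of \<omega>] \<omega> by (cases "\<omega> \<in> N") (auto simp: b_def)
    show "\<exists>l. ((\<lambda>s. b s \<omega>) \<longlongrightarrow> l) (at_left t)" if "0 < t"
      using right_lim_cadlag(2)[OF osc that, of \<omega>] \<omega> by (cases "\<omega> \<in> N") (auto simp: b_def)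
  qed
  ultimately show thesis using that N(2) lim by blast
qed

end

section \<open>Optional sets\<close>

text \<open>Exchange of a limit with an infinite sum. The bound \<open>C\<close> makes the limiting
  series summable, and the tail estimate, valid along the filter for one fixed \<open>n\<close>,
  controls both \<open>h\<close> and the series by the same partial sum.\<close>

lemma tendsto_suminf_of_uniform_tail:
  fixes f :: "nat \<Rightarrow> 'b \<Rightarrow> real"
  assumes Fl: "Fl \<noteq> bot" and nn: "\<And>i q. 0 \<le> f i q" and h: "\<And>q. h q \<le> C"
    and dom: "\<And>n. \<forall>\<^sub>F q in Fl. (\<Sum>i<n. f i q) \<le> h q"
    and unif: "\<And>e. 0 < e \<Longrightarrow> \<exists>n. \<forall>\<^sub>F q in Fl. h q \<le> (\<Sum>i<n. f i q) + e"
    and lim: "\<And>i. (f i \<longlongrightarrow> l i) Fl"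
  shows "(h \<longlongrightarrow> suminf l) Fl"
proof (rule tendstoI)
  have slim: "((\<lambda>q. \<Sum>i<n. f i q) \<longlongrightarrow> (\<Sum>i<n. l i)) Fl" for n
    by (intro tendsto_sum lim)
  have l_nn: "0 \<le> l i" for i
    by (rule tendsto_lowerbound[OF lim _ Fl]) (simp add: nn)
  have "(\<Sum>i<n. l i) \<le> C" for n
    by (rule tendsto_upperbound[OF slim _ Fl])
      (use dom[of n] in eventually_elim, use h order_trans in blast)
  then have summ: "summable l"
    by (intro summableI_nonneg_bounded l_nn)
  fix e :: real assume e: "0 < e"
  obtain n where n: "\<forall>\<^sub>F q in Fl. h q \<le> (\<Sum>i<n. f i q) + e / 3"
    using unif[of "e / 3"] e by auto
  have "(\<Sum>i<m. l i) \<le> (\<Sum>i<n. l i) + e / 3" for m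
    by (rule tendsto_le[OF Fl tendsto_add[OF slim tendsto_const] slim])
      (use n dom[of m] in eventually_elim, linarith)
  then have up: "suminf l \<le> (\<Sum>i<n. l i) + e / 3"
    using summ by (intro suminf_le_const) auto
  have lo: "(\<Sum>i<n. l i) \<le> suminf l"
    using summ l_nn by (intro sum_le_suminf) auto
  have "\<forall>\<^sub>F q in Fl. dist (\<Sum>i<n. f i q) (\<Sum>i<n. l i) < e / 3"
    using tendstoD[OF slim, of "e / 3"] e by simp
  with n dom[of n] show "\<forall>\<^sub>F q in Fl. dist (h q) (suminf l) < e"
    by eventually_elim (use up lo e in \<open>unfold dist_real_def, linarith\<close>)
qed

text \<open>Good-sets induction: complements keep the exceptional set, countable unions unite them.
  The predicate \<open>R\<close> confines the comparison to a region; it is instantiated with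
  \<open>True\<close> and with the event that \<tau> exceeds a given time.\<close>

lemma sigma_sets_agree_off_null:
  assumes A: "A \<in> sigma_sets \<Omega> X" and T: "sigma_algebra \<Omega> T"
    and Z0: "{} \<in> Z" and ZU: "\<And>f :: nat \<Rightarrow> 'a set. range f \<subseteq> Z \<Longrightarrow> (\<Union>i. f i) \<in> Z"
    and X: "\<And>B. B \<in> X \<Longrightarrow> \<exists>B0\<in>T. \<exists>N\<in>Z. \<forall>\<omega>\<in>\<Omega> - N. R \<omega> \<longrightarrow> (\<omega> \<in> B \<longleftrightarrow> \<omega> \<in> B0)"
  shows "\<exists>A0\<in>T. \<exists>N\<in>Z. \<forall>\<omega>\<in>\<Omega> - N. R \<omega> \<longrightarrow> (\<omega> \<in> A \<longleftrightarrow> \<omega> \<in> A0)"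
proof -
  interpret sigma_algebra \<Omega> T by (rule T)
  from A show ?thesis
  proof induction
    case (Compl A)
    then obtain A0 N where "A0 \<in> T" "N \<in> Z" "\<forall>\<omega>\<in>\<Omega> - N. R \<omega> \<longrightarrow> (\<omega> \<in> A \<longleftrightarrow> \<omega> \<in> A0)" by blast
    then show ?case by (intro bexI[of _ "\<Omega> - A0"] bexI[of _ N]) auto
  next
    case (Union A)
    then obtain A0 N where *: "\<And>i. A0 i \<in> T" "\<And>i. N i \<in> Z"
        "\<And>i. \<forall>\<omega>\<in>\<Omega> - N i. R \<omega> \<longrightarrow> (\<omega> \<in> A i \<longleftrightarrow> \<omega> \<in> A0 i)" by metis
    then have "(\<Union>i. N i) \<in> Z" "(\<Union>i. A0 i) \<in> T" by (auto intro!: ZU)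
    with *(3) show ?case by (intro bexI[of _ "\<Union>i. A0 i"] bexI[of _ "\<Union>i. N i"]) auto
  qed (use X Z0 in auto)
qed

lemma cadlag_adapted_optional:
  assumes "adapted \<Omega> F X" "cadlag_paths \<Omega> X"
  shows "(\<lambda>(t, \<omega>). X t \<omega>) \<in> borel_measurable (optional_measure \<Omega> F)"
proof (rule measurableI)
  let ?gen = "{{(t, \<omega>) \<in> {0..} \<times> \<Omega>. X t \<omega> \<in> B} | X B.
        adapted \<Omega> F X \<and> cadlag_paths \<Omega> X \<and> B \<in> sets (borel :: real measure)}"
  fix B :: "real set" assume "B \<in> sets borel"
  then have "{(t, \<omega>) \<in> {0..} \<times> \<Omega>. X t \<omega> \<in> B} \<in> ?gen" using assms by blast
  moreover have "?gen \<subseteq> Pow ({0..} \<times> \<Omega>)" by auto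
  ultimately have "{(t, \<omega>) \<in> {0..} \<times> \<Omega>. X t \<omega> \<in> B} \<in> sets (optional_measure \<Omega> F)"
    unfolding optional_measure_def by (subst sets_measure_of) (auto intro: sigma_sets.Basic)
  moreover have "(\<lambda>(t, \<omega>). X t \<omega>) -` B \<inter> space (optional_measure \<Omega> F) = {(t, \<omega>) \<in> {0..} \<times> \<Omega>. X t \<omega> \<in> B}"
    unfolding optional_measure_def by (auto simp: space_measure_of_conv)
  ultimately show "(\<lambda>(t, \<omega>). X t \<omega>) -` B \<inter> space (optional_measure \<Omega> F) \<in> sets (optional_measure \<Omega> F)" by simp
qed simp

lemma space_optional_measure [simp]: "space (optional_measure \<Omega> F) = {0..} \<times> \<Omega>"
  by (simp add: optional_measure_def space_measure_of_conv)

lemma sigma_algebra_empty: "sigma_algebra \<Omega> S \<Longrightarrow> {} \<in> S"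
  unfolding sigma_algebra_iff2 by blast

text \<open>A jump of \<open>f\<close> above the level \<open>d\<close> at time \<open>t\<close> is the first time after some \<open>p < t\<close> at which
  \<open>f\<close> exceeds \<open>d\<close>; without such a jump \<open>f\<close> stays above \<open>d\<close> on an interval reaching beyond \<open>t\<close>
  and starting at or before \<open>t\<close>.\<close>

lemma cadlag_superlevel_iff:
  fixes f :: "real \<Rightarrow> real"
  assumes t: "0 \<le> t" and rc: "continuous (at_right t) f"
    and ll: "0 < t \<Longrightarrow> \<exists>l. (f \<longlongrightarrow> l) (at_left t)"
  shows "c < f t \<longleftrightarrow> (\<exists>d\<in>\<rat> \<inter> {c<..}. \<exists>p\<in>Qp.
      (p \<le> t \<and> \<not> (\<forall>r\<in>Qp. t < r \<longrightarrow> (\<exists>q\<in>Qp. q < r \<and> p \<le> q \<and> f q \<le> d))) \<or>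
      ((\<forall>r\<in>Qp. t < r \<longrightarrow> (\<exists>q\<in>Qp. q < r \<and> p < q \<and> d < f q)) \<and> \<not> (\<exists>q\<in>Qp. q < t \<and> p < q \<and> d < f q)))"
    (is "_ \<longleftrightarrow> (\<exists>d\<in>_. \<exists>p\<in>Qp. ?P d p \<or> ?R d p)")
proof
  have rl: "(f \<longlongrightarrow> f t) (at_right t)" using rc by (simp add: continuous_within)
  assume c: "c < f t"
  have right: "\<exists>r\<in>Qp. t < r \<and> (\<forall>s. t \<le> s \<longrightarrow> s < r \<longrightarrow> d < f s)" if d: "d < f t" for d
  proof -
    have "\<forall>\<^sub>F s in at_right t. d < f s" using order_tendstoD(1)[OF rl d] .
    then obtain b where b: "t < b" "\<forall>s>t. s < b \<longrightarrow> d < f s"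
      unfolding eventually_at_right_field by blast
    obtain r where r: "r \<in> Qp" "t < r" "r < b" using Qp_dense[OF t b(1)] by blast
    have "d < f s" if "t \<le> s" "s < r" for s using that b(2) r d by (cases "s = t") auto
    with r show ?thesis by blast
  qed
  show "\<exists>d\<in>\<rat> \<inter> {c<..}. \<exists>p\<in>Qp. ?P d p \<or> ?R d p"
  proof (cases "t = 0")
    case True
    obtain d where d: "d \<in> \<rat>" "c < d" "d < f t" using Rats_dense_in_real[OF c] by blast
    obtain r where r: "r \<in> Qp" "t < r" "\<forall>s. t \<le> s \<longrightarrow> s < r \<longrightarrow> d < f s" using right[OF d(3)] by blast
    have "?P d 0" using r True by (auto simp: not_le intro!: bexI[of _ r])
    then show ?thesis using d by (intro bexI[of _ d] bexI[of _ 0]) auto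
  next
    case False
    then have t0: "0 < t" using t by simp
    then obtain l where l: "(f \<longlongrightarrow> l) (at_left t)" using ll by blast
    have left: "\<exists>p\<in>Qp. p < t \<and> (\<forall>s. p \<le> s \<longrightarrow> s < t \<longrightarrow> U (f s))" if ev: "\<forall>\<^sub>F s in at_left t. U (f s)" for U
    proof -
      obtain b where b: "b < t" "\<forall>s>b. s < t \<longrightarrow> U (f s)"
        using ev unfolding eventually_at_left_field by blast
      obtain p where "p \<in> Qp" "max 0 b < p" "p < t"
        using Qp_dense[of "max 0 b" t] b(1) t0 by auto
      with b show ?thesis by (intro bexI[of _ p]) auto
    qed
    show ?thesis
    \<comment> \<open>If the left limit exceeds \<open>c\<close>, one interval around
      \<open>t\<close> stays above some rational \<open>d > c\<close>. Otherwise any rational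
      \<open>d\<close> between \<open>c\<close> and \<open>f t\<close> separates the recent past
      from the present, so \<open>t\<close> is the first exceedance of \<open>d\<close> after a
      suitable \<open>p\<close>.\<close>
    proof (cases "c < l")
      case True
      then obtain d where d: "d \<in> \<rat>" "c < d" "d < min l (f t)"
        using Rats_dense_in_real[of c "min l (f t)"] c by auto
      obtain r where r: "r \<in> Qp" "t < r" "\<forall>s. t \<le> s \<longrightarrow> s < r \<longrightarrow> d < f s" using right[of d] d by auto
      have "\<forall>\<^sub>F s in at_left t. d < f s" using order_tendstoD(1)[OF l, of d] d by simp
      from left[OF this] obtain p where p: "p \<in> Qp" "p < t" "\<forall>s. p \<le> s \<longrightarrow> s < t \<longrightarrow> d < f s" by blast
      have "d < f q" if "p \<le> q" "q < r" for q
        using that p(3) r(3) by (cases "q < t") auto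
      then have "\<not> (\<exists>q\<in>Qp. q < r \<and> p \<le> q \<and> f q \<le> d)" by (auto simp: not_le[symmetric])
      then have "?P d p" using r(1,2) p(2) by auto
      then show ?thesis using d p by (intro bexI[of _ d] bexI[of _ p]) auto
    next
      case False
      obtain d where d: "d \<in> \<rat>" "c < d" "d < f t" using Rats_dense_in_real[OF c] by blast
      obtain r where r: "r \<in> Qp" "t < r" "\<forall>s. t \<le> s \<longrightarrow> s < r \<longrightarrow> d < f s" using right[OF d(3)] by blast
      have "\<forall>\<^sub>F s in at_left t. f s < d" using order_tendstoD(2)[OF l, of d] d False by simp
      from left[OF this] obtain p where p: "p \<in> Qp" "p < t" "\<forall>s. p \<le> s \<longrightarrow> s < t \<longrightarrow> f s < d" by blast
      have "?R d p"
      proof (intro conjI ballI impI)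
        fix r' assume "r' \<in> Qp" "t < r'"
        obtain q where q: "q \<in> Qp" "t < q" "q < min r r'"
          using Qp_dense[OF t, of "min r r'"] r(2) \<open>t < r'\<close> by auto
        with r(3) p(2) show "\<exists>q\<in>Qp. q < r' \<and> p < q \<and> d < f q" by (intro bexI[of _ q]) auto
      next
        show "\<not> (\<exists>q\<in>Qp. q < t \<and> p < q \<and> d < f q)" using p(3) by (meson less_imp_le not_less_iff_gr_or_eq)
      qed
      then show ?thesis using d p by (intro bexI[of _ d] bexI[of _ p]) auto
    qed
  qed
next
  have rl: "(f \<longlongrightarrow> f t) (at_right t)" using rc by (simp add: continuous_within)
  assume "\<exists>d\<in>\<rat> \<inter> {c<..}. \<exists>p\<in>Qp. ?P d p \<or> ?R d p"
  then obtain d p where d: "c < d" and PR: "?P d p \<or> ?R d p" by blast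
  show "c < f t"
  proof (rule ccontr)
    assume "\<not> c < f t"
    then have "f t < d" using d by simp
    then have "\<forall>\<^sub>F s in at_right t. f s < d" using order_tendstoD(2)[OF rl] by blast
    then obtain b where b: "t < b" "\<forall>s>t. s < b \<longrightarrow> f s < d"
      unfolding eventually_at_right_field by blast
    \<comment> \<open>On this interval \<open>?P\<close> would put a rational value above
      \<open>d\<close>. \<open>?R\<close> also fails there: it demands exceedances before every
      rational beyond \<open>t\<close> but none before \<open>t\<close>, so one of them would fall
      in this interval.\<close>
    have below: "f s < d" if "t \<le> s" "s < b" for s
      using that b(2) \<open>f t < d\<close> by (cases "s = t") auto
    from PR show False
    proof
      assume "?P d p"
      then obtain r where r: "t < r" "p \<le> t" "\<not> (\<exists>q\<in>Qp. q < r \<and> p \<le> q \<and> f q \<le> d)" by blast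
      obtain q where q: "q \<in> Qp" "t < q" "q < min r b" by (rule Qp_dense[OF t, of "min r b"]) (use r(1) b(1) in auto)
      then have "p \<le> q" "q < r" using r(2) by auto
      then have "d < f q" using r(3) q(1) not_le by blast
      moreover have "f q < d" using q by (intro below) auto
      ultimately show False by simp
    next
      assume R: "?R d p"
      obtain r where r: "r \<in> Qp" "t < r" "r < b" using Qp_dense[OF t b(1)] by blast
      then obtain q where q: "q \<in> Qp" "q < r" "p < q" "d < f q" using R by blast
      then have "t \<le> q" using R by (intro leI notI) blast
      then show False using below[of q] q r by simp
    qed
  qed
qed

text \<open>\<open>J t\<close> says that the infimum of the rationals \<open>q\<close> with
  \<open>\<omega> \<in> A q\<close> is at most \<open>t\<close>. Its indicator is nondecreasing and
  right continuous in \<open>t\<close>, hence cadlag, and right continuity of the filtration makes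
  it adapted.\<close>

lemma optional_debut:
  assumes F: "\<And>t. 0 \<le> t \<Longrightarrow> sigma_algebra \<Omega> (F t)" "\<And>s t. 0 \<le> s \<Longrightarrow> s \<le> t \<Longrightarrow> F s \<subseteq> F t"
    and rc: "\<And>t. 0 \<le> t \<Longrightarrow> F t = (\<Inter>s\<in>{t<..}. F s)"
    and A: "\<And>q. q \<in> Qp \<Longrightarrow> A q \<in> F q"
  shows "{(t, \<omega>) \<in> {0..} \<times> \<Omega>. \<forall>r\<in>Qp. t < r \<longrightarrow> (\<exists>q\<in>Qp. q < r \<and> \<omega> \<in> A q)} \<in> sets (optional_measure \<Omega> F)"
proof -
  define J where "J t \<omega> \<longleftrightarrow> (\<forall>r\<in>Qp. t < r \<longrightarrow> (\<exists>q\<in>Qp. q < r \<and> \<omega> \<in> A q))" for t \<omega>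
  define X :: "real \<Rightarrow> 'a \<Rightarrow> real" where "X t \<omega> = (if J t \<omega> then 1 else 0)" for t \<omega>
  have J_in: "{\<omega>\<in>\<Omega>. J t \<omega>} \<in> F t" if t: "0 \<le> t" for t
  proof -
    have "{\<omega>\<in>\<Omega>. J t \<omega>} \<in> F s" if s: "t < s" for s
    proof -
      interpret sigma_algebra \<Omega> "F s" by (rule F) (use t s in simp)
      have A_s: "A q \<in> F s" if "q \<in> Qp" "q < s" for q
        using A[OF that(1)] F(2)[of q s] that by auto
      have "countable (Qp \<inter> {t<..<s})" using countable_Qp by (rule countable_subset[rotated]) auto
      moreover have "Qp \<inter> {t<..<s} \<noteq> {}" using Qp_dense[OF t s] by (metis IntI empty_iff greaterThanLessThan_iff)
      moreover have "(\<Union>q\<in>Qp \<inter> {..<r}. A q) \<in> F s" if "r < s" for r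
        using that A_s by (intro countable_UN' countable_subset[OF _ countable_Qp]) auto
      ultimately have "(\<Inter>r\<in>Qp \<inter> {t<..<s}. \<Union>q\<in>Qp \<inter> {..<r}. A q) \<in> F s"
        by (intro countable_INT') auto
      \<comment> \<open>The condition gets weaker as \<open>r\<close> grows, so testing
        \<open>r\<close> between \<open>t\<close> and \<open>s\<close> suffices; only events before
        \<open>s\<close> are then involved.\<close>
      moreover have "{\<omega>\<in>\<Omega>. J t \<omega>} = (\<Inter>r\<in>Qp \<inter> {t<..<s}. \<Union>q\<in>Qp \<inter> {..<r}. A q)"
      proof (intro equalityI subsetI INT_I)
        fix \<omega> r assume "\<omega> \<in> {\<omega>\<in>\<Omega>. J t \<omega>}" "r \<in> Qp \<inter> {t<..<s}"
        then show "\<omega> \<in> (\<Union>q\<in>Qp \<inter> {..<r}. A q)" unfolding J_def by auto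
      next
        fix \<omega> assume \<omega>: "\<omega> \<in> (\<Inter>r\<in>Qp \<inter> {t<..<s}. \<Union>q\<in>Qp \<inter> {..<r}. A q)"
        have ex: "\<exists>q\<in>Qp. q < min r s \<and> \<omega> \<in> A q" if tr: "t < r" for r
        proof -
          obtain r' where r': "r' \<in> Qp" "t < r'" "r' < min r s"
            by (rule Qp_dense[OF t, of "min r s"]) (use tr s in auto)
          then have "\<omega> \<in> (\<Union>q\<in>Qp \<inter> {..<r'}. A q)" by (intro INT_D[OF \<omega>]) simp
          then obtain q where "q \<in> Qp" "q < r'" "\<omega> \<in> A q" by auto
          with r' show ?thesis by (intro bexI[of _ q]) auto
        qed
        then have "J t \<omega>" unfolding J_def by auto
        moreover obtain q where "q \<in> Qp" "q < s" "\<omega> \<in> A q" using ex[OF s] by auto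
        then have "\<omega> \<in> \<Omega>" using A_s sets_into_space by blast
        ultimately show "\<omega> \<in> {\<omega>\<in>\<Omega>. J t \<omega>}" by simp
      qed
      ultimately show ?thesis by simp
    qed
    then show ?thesis by (subst rc[OF t]) auto
  qed
  have "adapted \<Omega> F X"
    unfolding adapted_def
  proof (intro allI impI ballI)
    fix t :: real and B :: "real set" assume t: "0 \<le> t"
    interpret sigma_algebra \<Omega> "F t" by (rule F(1)[OF t])
    have "{\<omega>\<in>\<Omega>. X t \<omega> \<in> B} = (if 1 \<in> B then {\<omega>\<in>\<Omega>. J t \<omega>} else {}) \<union> (if 0 \<in> B then \<Omega> - {\<omega>\<in>\<Omega>. J t \<omega>} else {})"
      by (auto simp: X_def split: if_splits)
    also have "\<dots> \<in> F t"
      using J_in[OF t] compl_sets[OF J_in[OF t]] by (cases "1 \<in> B"; cases "0 \<in> B") (simp_all only: if_True if_False Un empty_sets)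
    finally show "{\<omega>\<in>\<Omega>. X t \<omega> \<in> B} \<in> F t" .
  qed
  moreover have "cadlag_paths \<Omega> X"
    unfolding cadlag_paths_def
  proof (intro ballI conjI allI impI)
    fix \<omega> and t :: real
    have up: "J s' \<omega>" if "J s \<omega>" "s \<le> s'" for s s' using that unfolding J_def by auto
    show "continuous (at_right t) (\<lambda>s. X s \<omega>)" if "0 \<le> t"
    proof -
      have "\<exists>b>t. \<forall>s>t. s < b \<longrightarrow> X s \<omega> = X t \<omega>"
      proof (cases "J t \<omega>")
        case True
        then show ?thesis using up by (intro exI[of _ "t + 1"]) (auto simp: X_def intro: less_imp_le)
      next
        case False
        then obtain r where r: "r \<in> Qp" "t < r" "\<not> (\<exists>q\<in>Qp. q < r \<and> \<omega> \<in> A q)" unfolding J_def by blast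
        have "\<not> J s \<omega>" if "s < r" for s using r that unfolding J_def by blast
        with r False show ?thesis by (intro exI[of _ r]) (simp add: X_def)
      qed
      then have "\<forall>\<^sub>F s in at_right t. X s \<omega> = X t \<omega>" unfolding eventually_at_right_field by blast
      then show ?thesis unfolding continuous_within by (rule tendsto_eventually)
    qed
    show "\<exists>l. ((\<lambda>s. X s \<omega>) \<longlongrightarrow> l) (at_left t)" if "0 < t"
    proof (cases "\<exists>s<t. J s \<omega>")
      case True
      then obtain b where b: "b < t" "J b \<omega>" by blast
      then have "\<forall>\<^sub>F s in at_left t. X s \<omega> = 1"
        unfolding eventually_at_left_field using up by (intro exI[of _ b]) (auto simp: X_def intro: less_imp_le)
      then show ?thesis by (blast intro: tendsto_eventually)
    next
      case False
      then have "\<forall>\<^sub>F s in at_left t. X s \<omega> = 0"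
        unfolding eventually_at_left_field by (intro exI[of _ "t - 1"]) (auto simp: X_def)
      then show ?thesis by (blast intro: tendsto_eventually)
    qed
  qed
  ultimately have "(\<lambda>(t, \<omega>). X t \<omega>) \<in> borel_measurable (optional_measure \<Omega> F)"
    by (rule cadlag_adapted_optional)
  then have "(\<lambda>(t, \<omega>). X t \<omega>) -` {1} \<inter> space (optional_measure \<Omega> F) \<in> sets (optional_measure \<Omega> F)"
    by (rule measurable_sets) simp
  also have "(\<lambda>(t, \<omega>). X t \<omega>) -` {1} \<inter> space (optional_measure \<Omega> F) = {(t, \<omega>) \<in> {0..} \<times> \<Omega>. J t \<omega>}"
    by (auto simp: X_def split: if_splits)
  finally show ?thesis unfolding J_def .
qed

lemma optional_time:
  assumes F: "\<And>t. 0 \<le> t \<Longrightarrow> sigma_algebra \<Omega> (F t)"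
  shows "fst \<in> borel_measurable (optional_measure \<Omega> F)"
proof -
  have "(\<lambda>(t, \<omega>). t) \<in> borel_measurable (optional_measure \<Omega> F)"
  proof (rule cadlag_adapted_optional)
    show "adapted \<Omega> F (\<lambda>t \<omega>. t)"
      unfolding adapted_def
    proof (intro allI impI ballI)
      fix t :: real and B :: "real set" assume "0 \<le> t"
      then interpret sigma_algebra \<Omega> "F t" by (rule F)
      show "{\<omega>\<in>\<Omega>. t \<in> B} \<in> F t" by (cases "t \<in> B") auto
    qed
    show "cadlag_paths \<Omega> (\<lambda>t \<omega>. t)"
      unfolding cadlag_paths_def by (auto intro: tendsto_ident_at)
  qed
  then show ?thesis by (simp add: case_prod_beta')
qed

text \<open>Rebuilds a function from its rational superlevel sets. The sets obtained by splitting
  fit together only off a null set; elsewhere they need not even be nested, and the formula still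
  yields a measurable function, infinite suprema being sent to 0.\<close>

definition sup_of_levels :: "(real \<Rightarrow> 'b set) \<Rightarrow> 'b \<Rightarrow> real" where
  "sup_of_levels B x = real_of_ereal (SUP c\<in>\<rat>. if x \<in> B c then ereal c else -\<infinity>)"

lemma sup_of_levels_measurable:
  assumes "\<And>c. c \<in> \<rat> \<Longrightarrow> B c \<in> sets N"
  shows "sup_of_levels B \<in> borel_measurable N"
  unfolding sup_of_levels_def[abs_def]
  using assms countable_rat by (intro borel_measurable_real_of_ereal borel_measurable_SUP measurable_If_set) auto

lemma sup_of_levels_eq:
  assumes "\<And>c. c \<in> \<rat> \<Longrightarrow> x \<in> B c \<longleftrightarrow> c < y"
  shows "sup_of_levels B x = y"
proof -
  have "(SUP c\<in>\<rat>. if x \<in> B c then ereal c else -\<infinity>) = ereal y"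
  proof (rule antisym)
    show "(SUP c\<in>\<rat>. if x \<in> B c then ereal c else -\<infinity>) \<le> ereal y"
      using assms by (intro SUP_least) auto
    show "ereal y \<le> (SUP c\<in>\<rat>. if x \<in> B c then ereal c else -\<infinity>)"
    proof (rule le_SUP_iff[THEN iffD2], intro allI impI)
      fix z assume "z < ereal y"
      then obtain w where w: "z < ereal w" "ereal w < ereal y" using ereal_dense2 by blast
      then obtain c where c: "c \<in> \<rat>" "w < c" "c < y" using Rats_dense_in_real[of w y] by auto
      have "z < ereal c" using w(1) c(2) by (meson ereal_less_eq(3) less_imp_le less_le_trans)
      with c show "\<exists>c\<in>\<rat>. z < (if x \<in> B c then ereal c else -\<infinity>)" using assms by auto
    qed
  qed
  then show ?thesis by (simp add: sup_of_levels_def)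
qed

section \<open>The enlarged filtration\<close>

text \<open>Equivalence is expressed with \<open>completion M\<close> because \<open>sets Q'\<close>
  contains arbitrary subsets of \<open>T\<close>-measurable null sets, which \<open>M\<close> itself
  may fail to measure.\<close>

locale enlargement =
  fixes M :: "'a measure" and F :: "real \<Rightarrow> 'a set set" and \<tau> :: "'a \<Rightarrow> ereal"
    and Q' :: "'a measure"
  assumes prob_M: "prob_space M"
    and filtration: "is_filtration M F"
    and right_continuous: "right_continuous_filtration F"
    and complete: "null_gen M (filt_infty (space M) F) \<subseteq> F 0"
    and tau_measurable: "\<tau> \<in> borel_measurable M"
    and tau_nonneg: "\<forall>\<omega>\<in>space M. 0 \<le> \<tau> \<omega>"
    and prob_Q': "prob_space Q'"
    and space_Q' [simp]: "space Q' = space M"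
    and sets_Q': "sets Q' = sigma_sets (space M) (\<Union>t\<in>{0..}. enlarged M F \<tau> t)"
    and equivalent: "\<forall>A\<in>sets Q'. emeasure Q' A = 0 \<longleftrightarrow> A \<in> null_sets (completion M)"
    and H_hypothesis: "\<forall>X. martingale Q' F X \<longrightarrow> martingale Q' (enlarged M F \<tau>) X"
begin

abbreviation "G \<equiv> enlarged M F \<tau>"

definition tau_sets :: "'a set set" where
  "tau_sets = {\<tau> -` B \<inter> space M | B. B \<in> sets borel}"

definition T :: "'a set set" where
  "T = sig_join (space M) tau_sets (filt_infty (space M) F)"

text \<open>All exceptional sets are enlarged to members of this class: they are
  \<open>M\<close>-measurable, null for both measures, belong to \<open>NG M F \<tau>\<close>, and
  are closed under countable unions.\<close>

definition ZN :: "'a set set" where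
  "ZN = T \<inter> null_sets M"

lemma F_sigma_algebra: "0 \<le> t \<Longrightarrow> sigma_algebra (space M) (F t)"
  and F_sub_M: "0 \<le> t \<Longrightarrow> F t \<subseteq> sets M"
  and F_mono: "0 \<le> s \<Longrightarrow> s \<le> t \<Longrightarrow> F s \<subseteq> F t"
  using filtration by (auto simp: is_filtration_def)

lemma F_right_continuous: "0 \<le> t \<Longrightarrow> F t = (\<Inter>s\<in>{t<..}. F s)"
  using right_continuous unfolding right_continuous_filtration_def by blast

lemma F_sub_infty: "0 \<le> t \<Longrightarrow> F t \<subseteq> filt_infty (space M) F"
  unfolding filt_infty_def by (auto intro: sigma_sets.Basic)

lemma F_infty_sub_M: "filt_infty (space M) F \<subseteq> sets M"
  unfolding filt_infty_def using F_sub_M by (intro sets.sigma_sets_subset) auto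

lemma tau_sets_sub_M: "tau_sets \<subseteq> sets M"
  using tau_measurable by (auto simp: tau_sets_def intro: measurable_sets)

lemma T_gen_Pow: "tau_sets \<union> filt_infty (space M) F \<subseteq> Pow (space M)"
  using tau_sets_sub_M F_infty_sub_M sets.sets_into_space by blast

lemma T_sigma_algebra: "sigma_algebra (space M) T"
  unfolding T_def sig_join_def by (rule sigma_algebra_sigma_sets[OF T_gen_Pow])

lemma T_sub_M: "T \<subseteq> sets M"
  unfolding T_def sig_join_def using tau_sets_sub_M F_infty_sub_M by (intro sets.sigma_sets_subset) auto

lemma F_infty_sub_T: "filt_infty (space M) F \<subseteq> T"
  and tau_sets_sub_T: "tau_sets \<subseteq> T"
  unfolding T_def sig_join_def by (auto intro: sigma_sets.Basic)

lemma F_sub_T: "0 \<le> t \<Longrightarrow> F t \<subseteq> T"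
  using F_sub_infty F_infty_sub_T by blast

lemma empty_in_ZN: "{} \<in> ZN"
  using sigma_algebra_empty[OF T_sigma_algebra] by (auto simp: ZN_def)

lemma ZN_UN: "range (f :: nat \<Rightarrow> 'a set) \<subseteq> ZN \<Longrightarrow> (\<Union>i. f i) \<in> ZN"
  using sigma_algebra.countable_UN[OF T_sigma_algebra, of f UNIV] by (auto simp: ZN_def intro!: null_sets_UN)

lemma NG_eq: "NG M F \<tau> = null_gen M T"
  by (simp add: NG_def T_def tau_sets_def)

lemma NG_gen_Pow: "{A. A \<subseteq> space M \<and> (\<exists>N\<in>T. N \<in> null_sets M \<and> A \<subseteq> N)} \<subseteq> Pow (space M)"
  by auto

lemma subset_ZN_in_NG: "N \<subseteq> Z \<Longrightarrow> Z \<in> ZN \<Longrightarrow> N \<in> NG M F \<tau>"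
  unfolding NG_eq null_gen_def ZN_def
  using T_sub_M sets.sets_into_space by (intro sigma_sets.Basic) blast

lemma NG_sigma_algebra: "sigma_algebra (space M) (NG M F \<tau>)"
  unfolding NG_eq null_gen_def by (rule sigma_algebra_sigma_sets[OF NG_gen_Pow])

lemma sigma_stopped_sub: "sigma_stopped (space M) \<tau> s \<subseteq> tau_sets"
proof
  fix A assume "A \<in> sigma_stopped (space M) \<tau> s"
  then obtain B where B: "A = (\<lambda>\<omega>. min (\<tau> \<omega>) (ereal s)) -` B \<inter> space M" "B \<in> sets borel"
    by (auto simp: sigma_stopped_def)
  have "(\<lambda>x. min x (ereal s)) -` B \<inter> space borel \<in> sets (borel :: ereal measure)"
    using B(2) by (intro measurable_sets[of _ borel borel]) auto
  then show "A \<in> tau_sets"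
    unfolding tau_sets_def using B(1) by (intro CollectI exI[of _ "(\<lambda>x. min x (ereal s)) -` B"]) auto
qed

definition G0 :: "real \<Rightarrow> 'a set set" where
  "G0 t = (\<Inter>s\<in>{t<..}. sig_join (space M) (F s) (sigma_stopped (space M) \<tau> s))"

lemma G_eq: "G t = sigma_sets (space M) (NG M F \<tau> \<union> G0 t)"
  by (simp add: enlarged_def G0_def sig_join_def)

lemma G0_sub_T: "0 \<le> t \<Longrightarrow> G0 t \<subseteq> T"
proof -
  assume t: "0 \<le> t"
  have "G0 t \<subseteq> sig_join (space M) (F (t + 1)) (sigma_stopped (space M) \<tau> (t + 1))"
    unfolding G0_def by auto
  also have "\<dots> \<subseteq> T"
    unfolding sig_join_def
    using F_sub_T[of "t + 1"] t sigma_stopped_sub[of "t + 1"] tau_sets_sub_T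
    by (intro sigma_algebra.sigma_sets_subset[OF T_sigma_algebra]) auto
  finally show ?thesis .
qed

lemma G_gen_Pow: "0 \<le> t \<Longrightarrow> NG M F \<tau> \<union> G0 t \<subseteq> Pow (space M)"
  using G0_sub_T[of t] T_sub_M sets.sets_into_space[of _ M]
    sigma_algebra_iff2[of "space M" "NG M F \<tau>"] NG_sigma_algebra
  by blast

lemma G_sigma_algebra: "0 \<le> t \<Longrightarrow> sigma_algebra (space M) (G t)"
  unfolding G_eq by (intro sigma_algebra_sigma_sets G_gen_Pow)

lemma G_mono: "s \<le> t \<Longrightarrow> G s \<subseteq> G t"
  unfolding G_eq G0_def by (intro sigma_sets_mono') auto

lemma G_sub_Q': "0 \<le> t \<Longrightarrow> G t \<subseteq> sets Q'"
  unfolding sets_Q' by (auto intro: sigma_sets.Basic)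

lemma NG_sub_G: "NG M F \<tau> \<subseteq> G t"
  unfolding G_eq by (auto intro: sigma_sets.Basic)

lemma F_sub_G: "0 \<le> t \<Longrightarrow> F t \<subseteq> G t"
proof
  fix A assume t: "0 \<le> t" and A: "A \<in> F t"
  then have "A \<in> G0 t"
    unfolding G0_def sig_join_def using F_mono[OF t] by (auto intro!: sigma_sets.Basic dest!: less_imp_le)
  then show "A \<in> G t" unfolding G_eq by (auto intro: sigma_sets.Basic)
qed

text \<open>For \<open>s > q\<close> the minimum of \<tau> and \<open>s\<close> is at most
  \<open>q\<close> exactly when \<tau> is, and then it equals \<tau>. The strict inequality matters:
  with \<open>s = q\<close> all values beyond \<open>q\<close> would be merged into
  \<open>q\<close>.\<close>

lemma tau_le_in_G:
  assumes q: "0 \<le> q" and C: "C \<in> sets borel"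
  shows "{\<omega>\<in>space M. \<tau> \<omega> \<in> C \<and> \<tau> \<omega> \<le> ereal q} \<in> G q"
proof -
  have "{\<omega>\<in>space M. \<tau> \<omega> \<in> C \<and> \<tau> \<omega> \<le> ereal q} \<in> sigma_stopped (space M) \<tau> s" if "q < s" for s
  proof -
    have "{\<omega>\<in>space M. \<tau> \<omega> \<in> C \<and> \<tau> \<omega> \<le> ereal q}
        = (\<lambda>\<omega>. min (\<tau> \<omega>) (ereal s)) -` (C \<inter> {..ereal q}) \<inter> space M"
    proof (intro equalityI subsetI)
      fix \<omega> assume \<omega>: "\<omega> \<in> {\<omega>\<in>space M. \<tau> \<omega> \<in> C \<and> \<tau> \<omega> \<le> ereal q}"
      then have "\<tau> \<omega> \<le> ereal s" using that by (auto intro: order_trans)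
      with \<omega> show "\<omega> \<in> (\<lambda>\<omega>. min (\<tau> \<omega>) (ereal s)) -` (C \<inter> {..ereal q}) \<inter> space M"
        by (simp add: min_def)
    qed (use that in \<open>auto simp: min_def split: if_splits\<close>)
    then show ?thesis
      unfolding sigma_stopped_def using C by (intro CollectI exI[of _ "C \<inter> {..ereal q}"]) simp
  qed
  then have "{\<omega>\<in>space M. \<tau> \<omega> \<in> C \<and> \<tau> \<omega> \<le> ereal q} \<in> G0 q"
    unfolding G0_def sig_join_def by (intro INT_I sigma_sets.Basic UnI2) simp
  then show ?thesis unfolding G_eq by (auto intro: sigma_sets.Basic)
qed

section \<open>Null sets and traces of the enlarged sigma-algebras\<close>

text \<open>A generator agrees with the empty set off its covering null set, so any sigma-algebra
  \<open>S\<close> can serve as target.\<close>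

lemma NG_agree: "A \<in> NG M F \<tau> \<Longrightarrow> sigma_algebra (space M) S \<Longrightarrow>
    \<exists>A0\<in>S. \<exists>Z\<in>ZN. \<forall>\<omega>\<in>space M - Z. True \<longrightarrow> (\<omega> \<in> A \<longleftrightarrow> \<omega> \<in> A0)"
  unfolding NG_eq null_gen_def
proof (erule sigma_sets_agree_off_null)
  fix B assume "sigma_algebra (space M) S"
    "B \<in> {A. A \<subseteq> space M \<and> (\<exists>N\<in>T. N \<in> null_sets M \<and> A \<subseteq> N)}"
  then obtain Z where "Z \<in> ZN" "B \<subseteq> Z" "{} \<in> S"
    using sigma_algebra_empty by (auto simp: ZN_def)
  then show "\<exists>B0\<in>S. \<exists>N\<in>ZN. \<forall>\<omega>\<in>space M - N. True \<longrightarrow> (\<omega> \<in> B) = (\<omega> \<in> B0)"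
    by blast
qed (auto intro: empty_in_ZN ZN_UN)

lemma Q'_agree:
  assumes "A \<in> sets Q'"
  shows "\<exists>A0\<in>T. \<exists>Z\<in>ZN. \<forall>\<omega>\<in>space M - Z. True \<longrightarrow> (\<omega> \<in> A \<longleftrightarrow> \<omega> \<in> A0)"
  using assms unfolding sets_Q'
proof (rule sigma_sets_agree_off_null[OF _ T_sigma_algebra empty_in_ZN ZN_UN])
  fix B assume "B \<in> (\<Union>t\<in>{0..}. G t)"
  then obtain t where t: "0 \<le> t" and B: "B \<in> sigma_sets (space M) (NG M F \<tau> \<union> G0 t)"
    by (auto simp: G_eq)
  from B show "\<exists>A0\<in>T. \<exists>Z\<in>ZN. \<forall>\<omega>\<in>space M - Z. True \<longrightarrow> (\<omega> \<in> B \<longleftrightarrow> \<omega> \<in> A0)"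
  proof (rule sigma_sets_agree_off_null[OF _ T_sigma_algebra empty_in_ZN ZN_UN])
    fix B assume "B \<in> NG M F \<tau> \<union> G0 t"
    then show "\<exists>A0\<in>T. \<exists>Z\<in>ZN. \<forall>\<omega>\<in>space M - Z. True \<longrightarrow> (\<omega> \<in> B \<longleftrightarrow> \<omega> \<in> A0)"
      using NG_agree[OF _ T_sigma_algebra] G0_sub_T[OF t] empty_in_ZN by blast
  qed
qed

lemma ZN_null_Q': "Z \<in> ZN \<Longrightarrow> Z \<in> null_sets Q'"
proof -
  assume Z: "Z \<in> ZN"
  then have "Z \<in> sets Q'"
    using subset_ZN_in_NG[of Z Z] NG_sub_G[of 0] G_sub_Q'[of 0] by auto
  moreover have "Z \<in> null_sets (completion M)"
    using Z by (auto simp: ZN_def intro: null_sets_completionI)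
  ultimately show ?thesis using equivalent by (auto simp: null_sets_def)
qed

text \<open>\<open>N\<close> agrees off some \<open>Z\<close> with a set \<open>A0\<close> in
  \<open>T\<close>. Then \<open>A0\<close> is null for the completion, and being
  \<open>M\<close>-measurable it is null for \<open>M\<close>; \<open>A0 \<union> Z\<close> is the
  cover. Through this lemma almost sure statements under \<open>Q'\<close> acquire exceptional sets
  of the kind the conclusion demands.\<close>

lemma null_Q'_sub_ZN:
  assumes N: "N \<in> null_sets Q'"
  obtains Z where "Z \<in> ZN" "N \<subseteq> Z"
proof -
  obtain A0 Z where A0: "A0 \<in> T" and Z: "Z \<in> ZN" and eq: "\<forall>\<omega>\<in>space M - Z. \<omega> \<in> N \<longleftrightarrow> \<omega> \<in> A0"
    using Q'_agree[of N] N by auto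
  have "N \<in> null_sets (completion M)" using N equivalent by auto
  then have "N \<union> Z \<in> null_sets (completion M)"
    using Z by (auto simp: ZN_def intro: null_sets_completionI)
  moreover have A0_M: "A0 \<in> sets M" using A0 T_sub_M by auto
  moreover have "A0 \<subseteq> N \<union> Z" using eq sets.sets_into_space[OF A0_M] by blast
  ultimately have "A0 \<in> null_sets (completion M)"
    using null_sets_completion_subset by blast
  then have "A0 \<in> null_sets M" using A0_M by (simp add: null_sets_completion_iff)
  then have "A0 \<union> Z \<in> ZN"
    using A0 Z sigma_algebra.axioms(1)[OF T_sigma_algebra]
    by (auto simp: ZN_def intro: ring_of_sets.Un[OF algebra.axioms(1)])
  moreover have "N \<subseteq> A0 \<union> Z"
    using eq N sets.sets_into_space[of N Q'] by auto
  ultimately show thesis by (rule that)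
qed

lemma AE_Q'_ZN:
  assumes "AE \<omega> in Q'. P \<omega>"
  obtains Z where "Z \<in> ZN" "\<And>\<omega>. \<omega> \<in> space M - Z \<Longrightarrow> P \<omega>"
proof -
  obtain N where N: "\<And>\<omega>. \<omega> \<in> space Q' - N \<Longrightarrow> P \<omega>" "N \<in> null_sets Q'"
    using AE_E3[OF assms] by blast
  obtain Z where "Z \<in> ZN" "N \<subseteq> Z" using null_Q'_sub_ZN[OF N(2)] by blast
  with N(1) show thesis by (intro that[of Z]) auto
qed

text \<open>Where \<tau> exceeds \<open>s\<close>, the minimum of \<tau> and \<open>s\<close> is the
  constant \<open>s\<close>, so the events it generates become trivial and only \<open>F s\<close>
  remains.\<close>

lemma stopped_join_before_tau:
  assumes s: "0 \<le> s" and A: "A \<in> sig_join (space M) (F s) (sigma_stopped (space M) \<tau> s)"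
  shows "\<exists>A'\<in>F s. \<forall>\<omega>\<in>space M. ereal s < \<tau> \<omega> \<longrightarrow> (\<omega> \<in> A \<longleftrightarrow> \<omega> \<in> A')"
proof -
  interpret Fs: sigma_algebra "space M" "F s" by (rule F_sigma_algebra[OF s])
  have "\<exists>A'\<in>F s. \<exists>Z\<in>{{}}. \<forall>\<omega>\<in>space M - Z. ereal s < \<tau> \<omega> \<longrightarrow> (\<omega> \<in> A \<longleftrightarrow> \<omega> \<in> A')"
    using A unfolding sig_join_def
  proof (rule sigma_sets_agree_off_null[OF _ F_sigma_algebra[OF s]])
    fix B assume "B \<in> F s \<union> sigma_stopped (space M) \<tau> s"
    then show "\<exists>A'\<in>F s. \<exists>Z\<in>{{}}. \<forall>\<omega>\<in>space M - Z. ereal s < \<tau> \<omega> \<longrightarrow> (\<omega> \<in> B \<longleftrightarrow> \<omega> \<in> A')"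
    proof
      assume "B \<in> sigma_stopped (space M) \<tau> s"
      then obtain C where C: "B = (\<lambda>\<omega>. min (\<tau> \<omega>) (ereal s)) -` C \<inter> space M"
        by (auto simp: sigma_stopped_def)
      show ?thesis
        by (rule bexI[of _ "if ereal s \<in> C then space M else {}"]) (auto simp: C min_def)
    qed auto
  qed auto
  then show ?thesis by simp
qed

text \<open>An event of \<open>G0 q\<close> has a trace in \<open>F (s n)\<close> for each
  \<open>s n > q\<close>, but only where \<tau> exceeds \<open>s n\<close>. As \<open>s n\<close>
  decreases to \<open>q\<close>, every point with \<open>q\<close> below \<tau> is eventually
  covered.\<close>

lemma G_before_tau:
  assumes q: "0 \<le> q" and A: "A \<in> G q"
  shows "\<exists>A'\<in>F q. \<exists>Z\<in>ZN. \<forall>\<omega>\<in>space M - Z. ereal q < \<tau> \<omega> \<longrightarrow> (\<omega> \<in> A \<longleftrightarrow> \<omega> \<in> A')"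
  using A unfolding G_eq
proof (rule sigma_sets_agree_off_null[OF _ F_sigma_algebra[OF q] empty_in_ZN ZN_UN])
  fix B assume "B \<in> NG M F \<tau> \<union> G0 q"
  then show "\<exists>A'\<in>F q. \<exists>Z\<in>ZN. \<forall>\<omega>\<in>space M - Z. ereal q < \<tau> \<omega> \<longrightarrow> (\<omega> \<in> B \<longleftrightarrow> \<omega> \<in> A')"
  proof
    assume "B \<in> NG M F \<tau>"
    from NG_agree[OF this F_sigma_algebra[OF q]] show ?thesis by blast
  next
    assume B: "B \<in> G0 q"
    define s where "s n = q + 1 / Suc n" for n
    have s: "q < s n" "0 \<le> s n" for n using q by (auto simp: s_def add_nonneg_nonneg)
    have "\<exists>A'\<in>F (s n). \<forall>\<omega>\<in>space M. ereal (s n) < \<tau> \<omega> \<longrightarrow> (\<omega> \<in> B \<longleftrightarrow> \<omega> \<in> A')" for n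
      using B s[of n] by (intro stopped_join_before_tau) (auto simp: G0_def)
    then obtain A' where A': "\<And>n. A' n \<in> F (s n)"
        "\<And>n \<omega>. \<omega> \<in> space M \<Longrightarrow> ereal (s n) < \<tau> \<omega> \<Longrightarrow> \<omega> \<in> B \<longleftrightarrow> \<omega> \<in> A' n" by metis
    \<comment> \<open>The limsup depends only on late indices, so it lies in \<open>F r\<close> for
      every \<open>r > q\<close>, hence in \<open>F q\<close>; where the traces are eventually
      constant it returns their common value.\<close>
    define L where "L = (\<Inter>m. \<Union>n\<in>{m..}. A' n)"
    have s_lim: "s \<longlonglongrightarrow> q"
      using tendsto_add[OF tendsto_const[of q] LIMSEQ_Suc[OF lim_1_over_n]] by (simp add: s_def[abs_def])
    have s_dec: "s n \<le> s m" if "m \<le> n" for m n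
      using that by (simp add: s_def frac_le)
    have "L \<in> F r" if r: "q < r" for r
    proof -
      interpret Fr: sigma_algebra "space M" "F r" by (rule F_sigma_algebra) (use q r in simp)
      obtain m0 where m0: "s m0 \<le> r"
        using order_tendstoD(2)[OF s_lim r] by (meson eventually_sequentially less_imp_le order_refl)
      have "A' n \<in> F r" if "m0 \<le> n" for n
        using A'(1)[of n] F_mono[OF s(2), of n r] s_dec[OF that] m0 by auto
      then have "(\<Inter>m\<in>{m0..}. \<Union>n\<in>{m..}. A' n) \<in> F r"
        by (intro Fr.countable_INT' image_subsetI Fr.countable_UN') auto
      moreover have "L = (\<Inter>m\<in>{m0..}. \<Union>n\<in>{m..}. A' n)"
        unfolding L_def
      proof (intro equalityI subsetI INT_I)
        fix x m assume x: "x \<in> (\<Inter>m\<in>{m0..}. \<Union>n\<in>{m..}. A' n)"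
        have "x \<in> (\<Union>n\<in>{max m m0..}. A' n)" by (rule INT_D[OF x]) simp
        then show "x \<in> (\<Union>n\<in>{m..}. A' n)" by auto
      qed auto
      ultimately show ?thesis by simp
    qed
    then have "L \<in> F q" by (subst F_right_continuous[OF q]) auto
    moreover have "\<omega> \<in> B \<longleftrightarrow> \<omega> \<in> L" if \<omega>: "\<omega> \<in> space M" "ereal q < \<tau> \<omega>" for \<omega>
    proof -
      have "(\<lambda>n. ereal (s n)) \<longlonglongrightarrow> ereal q" using s_lim by simp
      from order_tendstoD(2)[OF this \<omega>(2)]
      obtain m0 where m0: "\<And>n. m0 \<le> n \<Longrightarrow> ereal (s n) < \<tau> \<omega>" by (auto simp: eventually_sequentially)
      have iff: "\<omega> \<in> B \<longleftrightarrow> \<omega> \<in> A' n" if "m0 \<le> n" for n using A'(2)[OF \<omega>(1) m0[OF that]] .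
      show ?thesis
      proof
        assume "\<omega> \<in> B"
        then have "\<omega> \<in> A' (max m m0)" for m using iff[of "max m m0"] by simp
        then show "\<omega> \<in> L" unfolding L_def by (meson INT_I UN_I atLeast_iff max.cobounded1)
      next
        assume "\<omega> \<in> L"
        then obtain n where "m0 \<le> n" "\<omega> \<in> A' n" unfolding L_def by blast
        then show "\<omega> \<in> B" using iff by simp
      qed
    qed
    ultimately show ?thesis using empty_in_ZN by (intro bexI[of _ L] bexI[of _ "{}"]) auto
  qed
qed

sublocale FQ: filtered_prob_space Q' F
proof (intro filtered_prob_space.intro filtered_prob_space_axioms.intro prob_Q')
  show "F t \<subseteq> sets Q'" if "0 \<le> t" for t using F_sub_G[OF that] G_sub_Q'[OF that] by blast
qed (auto intro: F_sigma_algebra dest: F_mono)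

sublocale GQ: filtered_prob_space Q' G
  by (intro filtered_prob_space.intro filtered_prob_space_axioms.intro prob_Q')
    (auto intro: G_sigma_algebra dest: G_sub_Q' G_mono)

section \<open>Conditional probabilities after the random time\<close>

text \<open>\<open>G t\<close> reveals \<tau> only up to \<open>t\<close>. Integer horizons exhaust
  the finite values, and the value infinity is recovered as the complement of their union.\<close>

lemma T_sub_Q': "T \<subseteq> sets Q'"
  unfolding T_def sig_join_def
proof (rule sigma_algebra.sigma_sets_subset)
  show "sigma_algebra (space M) (sets Q')" using sets.sigma_algebra_axioms[of Q'] by simp
  have "A \<in> sets Q'" if A: "A \<in> tau_sets" for A
  proof -
    obtain K where K: "A = \<tau> -` K \<inter> space M" "K \<in> sets borel" using A by (auto simp: tau_sets_def)
    have bdd: "{\<omega>\<in>space M. \<tau> \<omega> \<in> X \<and> \<tau> \<omega> \<le> ereal (real i)} \<in> sets Q'" if "X \<in> sets borel" for X and i :: nat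
      using tau_le_in_G[of "real i" X] G_sub_Q'[of "real i"] that by auto
    have fin: "(\<Union>i. {\<omega>\<in>space M. \<tau> \<omega> \<in> X \<and> \<tau> \<omega> \<le> ereal (real i)}) = {\<omega>\<in>space M. \<tau> \<omega> \<in> X \<and> \<tau> \<omega> \<noteq> \<infinity>}" for X
    proof -
      have "\<exists>i. \<tau> \<omega> \<le> ereal (real i)" if "\<tau> \<omega> \<noteq> \<infinity>" for \<omega>
        using that by (cases "\<tau> \<omega>") (auto intro: real_arch_simple)
      then show ?thesis by auto
    qed
    have fQ: "{\<omega>\<in>space M. \<tau> \<omega> \<in> X \<and> \<tau> \<omega> \<noteq> \<infinity>} \<in> sets Q'" if "X \<in> sets borel" for X
      unfolding fin[symmetric] by (rule sets.countable_UN) (use bdd[OF that] in blast)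
    have "A = {\<omega>\<in>space M. \<tau> \<omega> \<in> K \<and> \<tau> \<omega> \<noteq> \<infinity>} \<union>
        (if \<infinity> \<in> K then space Q' - {\<omega>\<in>space M. \<tau> \<omega> \<in> UNIV \<and> \<tau> \<omega> \<noteq> \<infinity>} else {})"
      using K(1) by auto
    also have "\<dots> \<in> sets Q'"
      using fQ[OF K(2)] sets.compl_sets[OF fQ[of UNIV]] by (cases "\<infinity> \<in> K") (simp_all only: if_True if_False sets.Un space_in_borel Un_empty_right)
    finally show ?thesis .
  qed
  moreover have "filt_infty (space M) F \<subseteq> sets Q'"
    unfolding filt_infty_def space_Q'[symmetric] using FQ.H_sub
    by (intro sets.sigma_sets_subset) auto
  ultimately show "tau_sets \<union> filt_infty (space M) F \<subseteq> sets Q'" by auto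
qed

lemma cond_pr_F_martingale:
  assumes B: "B \<in> sets Q'"
  shows "martingale Q' F (FQ.cond_pr B)"
  unfolding martingale_def
proof (intro conjI allI impI)
  show "adapted (space Q') F (FQ.cond_pr B)"
    unfolding adapted_def
  proof (intro allI impI ballI)
    fix t :: real and C :: "real set" assume t: "0 \<le> t" and C: "C \<in> sets borel"
    show "{\<omega>\<in>space Q'. FQ.cond_pr B t \<omega> \<in> C} \<in> F t"
      using measurable_sets[OF FQ.cond_pr_measurable_HM C, of B t] FQ.sets_HM[OF t]
      by (simp add: vimage_def Int_def conj_commute)
  qed
  show "integrable Q' (FQ.cond_pr B t)" if "0 \<le> t" for t
    by (rule FQ.integrable_bounded[of _ 1]) (use that FQ.cond_pr_measurable in \<open>auto simp: FQ.cond_pr_bounds\<close>)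
  fix s t A assume s: "0 \<le> s" "s \<le> t" and A: "A \<in> F s"
  then have "A \<in> F t" "0 \<le> t" using F_mono by auto
  with s A show "(LINT \<omega>:A|Q'. FQ.cond_pr B t \<omega>) = (LINT \<omega>:A|Q'. FQ.cond_pr B s \<omega>)"
    using FQ.cond_pr_integral_on[OF B] by (simp add: set_lebesgue_integral_def)
qed

text \<open>The point where hypothesis (H) enters. The \<open>F\<close>-martingale of
  \<open>B\<close> is a \<open>G\<close>-martingale and ends at the indicator of \<open>B\<close>,
  so its integral over a set of \<open>G q\<close> is already that of the indicator.\<close>

lemma cond_pr_G_eq_F:
  assumes n: "0 \<le> n" and B: "B \<in> F n" and q: "0 \<le> q"
  shows "AE \<omega> in Q'. GQ.cond_pr B q \<omega> = FQ.cond_pr B q \<omega>"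
proof -
  have BQ: "B \<in> sets Q'" using FQ.H_sub[OF n] B by blast
  have mart: "martingale Q' G (FQ.cond_pr B)"
    using H_hypothesis cond_pr_F_martingale[OF BQ] by blast
  \<comment> \<open>A time that is no earlier than \<open>q\<close> and at which \<open>B\<close> is
    already known.\<close>
  define m where "m = max q n"
  have m: "q \<le> m" "0 \<le> m" "B \<in> F m"
    using q B F_mono[OF n, of m] by (auto simp: m_def)
  have terminal: "AE \<omega> in Q'. FQ.cond_pr B m \<omega> = indicator B \<omega>"
  proof (rule FQ.cond_pr_unique[OF BQ m(2), of _ 1])
    show "indicator B \<in> borel_measurable (FQ.HM m)"
      using m by (intro borel_measurable_indicator) (simp add: FQ.sets_HM)
    fix C assume "C \<in> F m"
    then have C: "C \<in> sets Q'" using FQ.H_sub[OF m(2)] by blast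
    have "(\<integral>\<omega>. indicator C \<omega> * indicator B \<omega> \<partial>Q') = (\<integral>\<omega>. indicat_real (B \<inter> C) \<omega> \<partial>Q')"
      by (intro Bochner_Integration.integral_cong) (auto simp: indicator_def)
    also have "\<dots> = measure Q' (B \<inter> C)"
      using sets.sets_into_space[OF C] by (simp add: Int_absorb2 le_infI2)
    finally show "(\<integral>\<omega>. indicator C \<omega> * indicator B \<omega> \<partial>Q') = measure Q' (B \<inter> C)" .
  qed (auto simp: indicator_def)
  show ?thesis
  proof (rule GQ.cond_pr_unique[OF BQ q, of _ 1])
    show "FQ.cond_pr B q \<in> borel_measurable (GQ.HM q)"
    proof (rule measurable_from_subalg[OF _ FQ.cond_pr_measurable_HM])
      show "subalgebra (GQ.HM q) (FQ.HM q)"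
        using F_sub_G[OF q] by (simp add: subalgebra_def FQ.sets_HM[OF q] GQ.sets_HM[OF q])
    qed
    fix A assume A: "A \<in> G q"
    then have AQ [measurable]: "A \<in> sets Q'" using GQ.H_sub[OF q] by blast
    note FQ.cond_pr_measurable[OF m(2), measurable] BQ[measurable]
    have "(\<integral>\<omega>. indicator A \<omega> * FQ.cond_pr B q \<omega> \<partial>Q') = (\<integral>\<omega>. indicator A \<omega> * FQ.cond_pr B m \<omega> \<partial>Q')"
      using mart[unfolded martingale_def, THEN conjunct2, THEN conjunct2, rule_format, OF q m(1) A]
      by (simp add: set_lebesgue_integral_def)
    also have "\<dots> = (\<integral>\<omega>. indicat_real (B \<inter> A) \<omega> \<partial>Q')"
      using terminal by (intro integral_cong_AE) (measurable, auto simp: indicator_def)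
    also have "\<dots> = measure Q' (B \<inter> A)"
      using sets.sets_into_space[OF AQ] by (simp add: Int_absorb2 le_infI2)
    finally show "(\<integral>\<omega>. indicator A \<omega> * FQ.cond_pr B q \<omega> \<partial>Q') = measure Q' (B \<inter> A)" .
  qed (auto simp: FQ.cond_pr_bounds)
qed

text \<open>On the event that \<tau> is at most \<open>q\<close>, membership of \<tau> in
  \<open>C\<close> is known to \<open>G q\<close> and factors out; what is left is the
  \<open>G\<close>-martingale of \<open>B\<close>, which (H) identifies with the
  \<open>F\<close>-martingale.\<close>

lemma cond_pr_rectangle_after_tau:
  assumes n: "0 \<le> n" and B: "B \<in> F n" and C: "C \<in> sets borel" and q: "0 \<le> q"
  shows "AE \<omega> in Q'. \<tau> \<omega> \<le> ereal q \<longrightarrow>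
    GQ.cond_pr ({\<omega>\<in>space M. \<tau> \<omega> \<in> C} \<inter> B) q \<omega> = indicator C (\<tau> \<omega>) * FQ.cond_pr B q \<omega>"
proof -
  let ?A = "{\<omega>\<in>space M. \<tau> \<omega> \<in> C} \<inter> B"
  define E where "E = {\<omega>\<in>space M. \<tau> \<omega> \<in> C \<and> \<tau> \<omega> \<le> ereal q}"
  define D where "D = {\<omega>\<in>space M. \<tau> \<omega> \<in> UNIV \<and> \<tau> \<omega> \<le> ereal q}"
  interpret Gq: sigma_algebra "space M" "G q" by (rule G_sigma_algebra[OF q])
  have E: "E \<in> G q" and D: "D \<in> G q"
    unfolding E_def D_def by (rule tau_le_in_G; use C q in simp)+
  have BQ: "B \<in> sets Q'" using FQ.H_sub[OF n] B by blast
  have "\<tau> -` C \<inter> space M \<in> T" using C tau_sets_sub_T by (auto simp: tau_sets_def)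
  with T_sub_Q' have "\<tau> -` C \<inter> space M \<in> sets Q'" by blast
  moreover have "{\<omega>\<in>space M. \<tau> \<omega> \<in> C} = \<tau> -` C \<inter> space M" by auto
  ultimately have AQ: "?A \<in> sets Q'"
    using BQ by (simp only: sets.Int)
  \<comment> \<open>Outside \<open>D\<close> nothing is claimed, so the conditional probability
    itself is inserted there; this makes \<open>g\<close> a full candidate for the uniqueness
    lemma.\<close>
  define g where "g \<omega> = indicator E \<omega> * GQ.cond_pr B q \<omega>
     + indicator (space M - D) \<omega> * GQ.cond_pr ?A q \<omega>" for \<omega>
  have "AE \<omega> in Q'. GQ.cond_pr ?A q \<omega> = g \<omega>"
  proof (rule GQ.cond_pr_unique[OF AQ q, of _ 2])
    have [measurable]: "E \<in> sets (GQ.HM q)" "space M - D \<in> sets (GQ.HM q)"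
      using E D by (auto simp: GQ.sets_HM[OF q])
    show "g \<in> borel_measurable (GQ.HM q)" unfolding g_def[abs_def] by measurable
    fix \<omega> show "\<bar>g \<omega>\<bar> \<le> 2"
      using GQ.cond_pr_bounds[of B q \<omega>] GQ.cond_pr_bounds[of ?A q \<omega>]
      by (auto simp: g_def indicator_def)
  next
    fix K assume K: "K \<in> G q"
    have KQ: "K \<in> sets Q'" "E \<in> sets Q'" "space M - D \<in> sets Q'"
      using K E D GQ.H_sub[OF q] by auto
    have int: "integrable Q' (\<lambda>\<omega>. indicator X \<omega> * GQ.cond_pr Y q \<omega>)" if "X \<in> sets Q'" for X Y
      by (intro GQ.integrable_bounded[of _ 1] borel_measurable_times borel_measurable_indicator that
          GQ.cond_pr_measurable[OF q]) (auto simp: indicator_def GQ.cond_pr_bounds)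
    have "(\<integral>\<omega>. indicator K \<omega> * g \<omega> \<partial>Q') = (\<integral>\<omega>. indicator (E \<inter> K) \<omega> * GQ.cond_pr B q \<omega>
        + indicator ((space M - D) \<inter> K) \<omega> * GQ.cond_pr ?A q \<omega> \<partial>Q')"
      by (intro Bochner_Integration.integral_cong) (auto simp: g_def indicator_def)
    also have "\<dots> = (\<integral>\<omega>. indicator (E \<inter> K) \<omega> * GQ.cond_pr B q \<omega> \<partial>Q')
        + (\<integral>\<omega>. indicator ((space M - D) \<inter> K) \<omega> * GQ.cond_pr ?A q \<omega> \<partial>Q')"
      by (intro Bochner_Integration.integral_add int sets.Int KQ)
    also have "\<dots> = measure Q' (B \<inter> (E \<inter> K)) + measure Q' (?A \<inter> ((space M - D) \<inter> K))"
      by (intro arg_cong2[where f="(+)"] GQ.cond_pr_integral_on[OF BQ q] GQ.cond_pr_integral_on[OF AQ q]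
          Gq.Int Gq.compl_sets E D K)
    also have "\<dots> = measure Q' (B \<inter> (E \<inter> K) \<union> ?A \<inter> ((space M - D) \<inter> K))"
      by (intro FQ.finite_measure_Union[symmetric] sets.Int AQ BQ KQ) (auto simp: E_def D_def)
    also have "B \<inter> (E \<inter> K) \<union> ?A \<inter> ((space M - D) \<inter> K) = ?A \<inter> K"
      by (auto simp: E_def D_def)
    finally show "(\<integral>\<omega>. indicator K \<omega> * g \<omega> \<partial>Q') = measure Q' (?A \<inter> K)" .
  qed
  with cond_pr_G_eq_F[OF n B q] show ?thesis
    using AE_space[of Q'] by eventually_elim (auto simp: g_def E_def D_def indicator_def)
qed

section \<open>Right limits of \<open>G\<close>-martingales as functions of the random time, time
  and state\<close>

definition BO :: "(ereal \<times> real \<times> 'a) measure" where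
  "BO = restrict_space (borel :: ereal measure) {0..} \<Otimes>\<^sub>M optional_measure (space M) F"

text \<open>The quantifier over \<open>t\<close> stands inside the almost sure statement, and one
  function \<open>\<Psi>\<close>, jointly measurable in all its arguments, serves every
  \<open>t\<close>. The martingale itself is evaluated at rational times only.\<close>

definition split_limit :: "'a set \<Rightarrow> (ereal \<times> real \<times> 'a \<Rightarrow> real) \<Rightarrow> bool" where
  "split_limit A \<Psi> \<longleftrightarrow> \<Psi> \<in> borel_measurable BO \<and>
     (AE \<omega> in Q'. \<forall>t\<ge>0. \<tau> \<omega> \<le> ereal t \<longrightarrow>
        ((\<lambda>q. GQ.cond_pr A q \<omega>) \<longlongrightarrow> \<Psi> (\<tau> \<omega>, t, \<omega>)) (at t within (Qp \<inter> {t<..})))"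

lemma AE_Qp:
  assumes "\<And>q. 0 \<le> q \<Longrightarrow> AE \<omega> in Q'. P q \<omega>"
  shows "AE \<omega> in Q'. \<forall>q\<in>Qp. P q \<omega>"
  by (subst AE_ball_countable[OF countable_Qp]) (use assms in auto)

lemma eventually_at_Qp_right: "\<forall>\<^sub>F q in at t within (Qp \<inter> {t<..}). q \<in> Qp \<and> t < q"
  by (auto simp: eventually_at intro: exI[of _ 1])

lemma split_limit_rectangle:
  assumes n: "0 \<le> n" and B: "B \<in> F n" and C: "C \<in> sets borel"
  shows "\<exists>\<Psi>. split_limit ({\<omega>\<in>space M. \<tau> \<omega> \<in> C} \<inter> B) \<Psi>"
proof -
  have BQ: "B \<in> sets Q'" using FQ.H_sub[OF n] B by blast
  obtain b N where b: "adapted (space Q') F b" "cadlag_paths (space Q') b" and N: "N \<in> null_sets Q'"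
    and lim: "\<And>\<omega> t. \<omega> \<in> space Q' - N \<Longrightarrow> 0 \<le> t \<Longrightarrow>
       ((\<lambda>q. FQ.cond_pr B q \<omega>) \<longlongrightarrow> b t \<omega>) (at t within (Qp \<inter> {t<..}))"
  proof (rule FQ.cond_pr_cadlag_version[OF BQ F_right_continuous])
    \<comment> \<open>By equivalence a \<open>Q'\<close>-null set of the sigma-algebra generated by
      \<open>F\<close> is \<open>M\<close>-null, and completeness of \<open>F 0\<close> absorbs
      it.\<close>
    fix N assume N: "N \<in> sigma_sets (space Q') (\<Union>t\<in>{0..}. F t)" "N \<in> null_sets Q'"
    then have N_inf: "N \<in> filt_infty (space M) F" by (simp add: filt_infty_def)
    then have N_M: "N \<in> sets M" using F_infty_sub_M by blast
    have "N \<in> null_sets (completion M)" using N(2) equivalent by auto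
    then have "N \<in> null_sets M" using N_M by (simp add: null_sets_completion_iff)
    then have "N \<in> null_gen M (filt_infty (space M) F)"
      unfolding null_gen_def using N_inf sets.sets_into_space[OF N_M] by (intro sigma_sets.Basic) auto
    then show "N \<in> F 0" using complete by blast
  qed auto
  define \<Psi> where "\<Psi> = (\<lambda>(u, t, \<omega>). indicator C u * b t \<omega>)"
  have "\<Psi> \<in> borel_measurable BO"
  proof -
    have "(\<lambda>x. case snd x of (t, \<omega>) \<Rightarrow> b t \<omega>) \<in> borel_measurable BO"
      unfolding BO_def
      by (rule measurable_compose[OF measurable_snd cadlag_adapted_optional[OF b[unfolded space_Q']]])
    then have 1: "(\<lambda>x. b (fst (snd x)) (snd (snd x))) \<in> borel_measurable BO"
      by (simp add: case_prod_beta)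
    have "(\<lambda>x. indicat_real C (fst x)) \<in> borel_measurable BO"
      unfolding BO_def by (intro measurable_compose[OF measurable_fst] measurable_restrict_space1) (use C in simp)
    with 1 show ?thesis unfolding \<Psi>_def case_prod_beta by measurable
  qed
  moreover have "AE \<omega> in Q'. \<forall>t\<ge>0. \<tau> \<omega> \<le> ereal t \<longrightarrow>
      ((\<lambda>q. GQ.cond_pr ({\<omega>\<in>space M. \<tau> \<omega> \<in> C} \<inter> B) q \<omega>) \<longlongrightarrow> \<Psi> (\<tau> \<omega>, t, \<omega>)) (at t within (Qp \<inter> {t<..}))"
  proof -
    have "AE \<omega> in Q'. \<forall>q\<in>Qp. \<tau> \<omega> \<le> ereal q \<longrightarrow>
        GQ.cond_pr ({\<omega>\<in>space M. \<tau> \<omega> \<in> C} \<inter> B) q \<omega> = indicator C (\<tau> \<omega>) * FQ.cond_pr B q \<omega>"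
      by (rule AE_Qp) (rule cond_pr_rectangle_after_tau[OF n B C])
    then show ?thesis
      using AE_not_in[OF N] AE_space[of Q']
    proof (eventually_elim, intro allI impI)
      fix \<omega> and t :: real
      assume \<omega>: "\<omega> \<in> space Q'" "\<omega> \<notin> N" and t: "0 \<le> t" "\<tau> \<omega> \<le> ereal t"
        and eq: "\<forall>q\<in>Qp. \<tau> \<omega> \<le> ereal q \<longrightarrow>
          GQ.cond_pr ({\<omega>\<in>space M. \<tau> \<omega> \<in> C} \<inter> B) q \<omega> = indicator C (\<tau> \<omega>) * FQ.cond_pr B q \<omega>"
      have "((\<lambda>q. indicator C (\<tau> \<omega>) * FQ.cond_pr B q \<omega>) \<longlongrightarrow> indicator C (\<tau> \<omega>) * b t \<omega>) (at t within (Qp \<inter> {t<..}))"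
        using \<omega> t by (intro tendsto_mult tendsto_const lim) auto
      moreover have "\<forall>\<^sub>F q in at t within (Qp \<inter> {t<..}).
          indicator C (\<tau> \<omega>) * FQ.cond_pr B q \<omega> = GQ.cond_pr ({\<omega>\<in>space M. \<tau> \<omega> \<in> C} \<inter> B) q \<omega>"
        using eventually_at_Qp_right
      proof eventually_elim
        case (elim q)
        then have "\<tau> \<omega> \<le> ereal q" using t(2) by (auto intro: order_trans)
        with eq elim show ?case by simp
      qed
      ultimately show "((\<lambda>q. GQ.cond_pr ({\<omega>\<in>space M. \<tau> \<omega> \<in> C} \<inter> B) q \<omega>) \<longlongrightarrow> \<Psi> (\<tau> \<omega>, t, \<omega>)) (at t within (Qp \<inter> {t<..}))"
        unfolding \<Psi>_def prod.case by (rule Lim_transform_eventually)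
    qed
  qed
  ultimately show ?thesis unfolding split_limit_def by blast
qed

text \<open>The tails \<open>R n\<close> decrease to the empty set, so their martingales become
  small uniformly over rational times. This is the tail condition for exchanging the sum with the
  right limit.\<close>

lemma split_limit_disjoint_UN:
  assumes disj: "disjoint_family A" and A: "\<And>i::nat. A i \<in> sets Q'"
    and \<Psi>: "\<And>i. split_limit (A i) (\<Psi> i)"
  shows "split_limit (\<Union>i. A i) (\<lambda>x. \<Sum>i. \<Psi> i x)"
proof -
  define R where "R n = (\<Union>i\<in>{n..}. A i)" for n
  have RQ [measurable]: "R n \<in> sets Q'" for n unfolding R_def using A by auto
  have R_step: "R n = A n \<union> R (Suc n)" "A n \<inter> R (Suc n) = {}" for n
  proof -
    have "{n..} = insert n {Suc n..}" by auto
    then show "R n = A n \<union> R (Suc n)" by (simp add: R_def)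
    have "A n \<inter> A i = {}" if "Suc n \<le> i" for i
      using disjoint_family_onD[OF disj, of n i] that by simp
    then show "A n \<inter> R (Suc n) = {}" by (auto simp: R_def)
  qed
  have R_empty: "(\<Inter>n. R n) = {}"
  proof -
    have False if x: "\<And>n. x \<in> R n" for x
    proof -
      obtain i where "x \<in> A i" using x[of 0] by (auto simp: R_def)
      moreover obtain j where "j \<ge> Suc i" "x \<in> A j" using x[of "Suc i"] by (auto simp: R_def)
      ultimately show False using disjoint_family_onD[OF disj, of i j] by auto
    qed
    then show ?thesis by blast
  qed
  have "decseq R" unfolding R_def decseq_def by (intro allI impI UN_mono) auto
  then have "(\<lambda>n. measure Q' (R n)) \<longlonglongrightarrow> measure Q' (\<Inter>n. R n)"
    using RQ by (intro FQ.finite_Lim_measure_decseq) auto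
  then have R_lim: "(\<lambda>n. measure Q' (R n)) \<longlonglongrightarrow> 0" by (simp add: R_empty)
  have "AE \<omega> in Q'. \<forall>k::nat. \<exists>n. \<forall>q\<in>Qp. GQ.cond_pr (R n) q \<omega> \<le> 1 / Suc k"
    unfolding AE_all_countable by (intro allI GQ.cond_pr_uniformly_vanishing RQ R_lim) simp
  moreover have "AE \<omega> in Q'. \<forall>q\<in>Qp. \<forall>n. GQ.cond_pr (R n) q \<omega> = GQ.cond_pr (A n) q \<omega> + GQ.cond_pr (R (Suc n)) q \<omega>"
    by (rule AE_Qp, unfold AE_all_countable, subst R_step(1)) (intro allI GQ.cond_pr_Un_disjoint A RQ R_step(2))
  moreover have "AE \<omega> in Q'. \<forall>i. \<forall>t\<ge>0. \<tau> \<omega> \<le> ereal t \<longrightarrow>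
        ((\<lambda>q. GQ.cond_pr (A i) q \<omega>) \<longlongrightarrow> \<Psi> i (\<tau> \<omega>, t, \<omega>)) (at t within (Qp \<inter> {t<..}))"
    unfolding AE_all_countable using \<Psi> unfolding split_limit_def by blast
  ultimately have "AE \<omega> in Q'. \<forall>t\<ge>0. \<tau> \<omega> \<le> ereal t \<longrightarrow>
        ((\<lambda>q. GQ.cond_pr (\<Union>i. A i) q \<omega>) \<longlongrightarrow> (\<Sum>i. \<Psi> i (\<tau> \<omega>, t, \<omega>))) (at t within (Qp \<inter> {t<..}))"
  proof eventually_elim
    case (elim \<omega>)
    have R0: "R 0 = (\<Union>i. A i)" by (simp add: R_def)
    \<comment> \<open>An exact finite decomposition with remainder \<open>R n\<close>, valid at all
      rational times simultaneously.\<close>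
    have sum: "GQ.cond_pr (\<Union>i. A i) q \<omega> = (\<Sum>i<n. GQ.cond_pr (A i) q \<omega>) + GQ.cond_pr (R n) q \<omega>" if "q \<in> Qp" for q n
    proof (induction n)
      case (Suc n)
      moreover have "GQ.cond_pr (R n) q \<omega> = GQ.cond_pr (A n) q \<omega> + GQ.cond_pr (R (Suc n)) q \<omega>"
        using elim(2) that by blast
      ultimately show ?case by (simp only: sum.lessThan_Suc add.assoc)
    qed (simp add: R0)
    show ?case
    proof (intro allI impI, rule tendsto_suminf_of_uniform_tail[where C=1])
      fix t :: real assume t: "0 \<le> t" "\<tau> \<omega> \<le> ereal t"
      show "at t within (Qp \<inter> {t<..}) \<noteq> bot" by (rule at_Qp_right_nontrivial[OF t(1)])
      show "((\<lambda>q. GQ.cond_pr (A i) q \<omega>) \<longlongrightarrow> \<Psi> i (\<tau> \<omega>, t, \<omega>)) (at t within (Qp \<inter> {t<..}))" for i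
        using elim(3) t by simp
      show "\<forall>\<^sub>F q in at t within (Qp \<inter> {t<..}). (\<Sum>i<n. GQ.cond_pr (A i) q \<omega>) \<le> GQ.cond_pr (\<Union>i. A i) q \<omega>" for n
        using eventually_at_Qp_right
        by eventually_elim (simp add: sum[of _ n] GQ.cond_pr_bounds)
      fix e :: real assume "0 < e"
      then obtain k :: nat where k: "1 / Suc k < e" by (metis nat_approx_posE)
      obtain n where n: "\<forall>q\<in>Qp. GQ.cond_pr (R n) q \<omega> \<le> 1 / Suc k" using elim(1) by blast
      have "\<forall>\<^sub>F q in at t within (Qp \<inter> {t<..}). GQ.cond_pr (\<Union>i. A i) q \<omega> \<le> (\<Sum>i<n. GQ.cond_pr (A i) q \<omega>) + e"
        using eventually_at_Qp_right
      proof eventually_elim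
        case (elim q)
        then have q: "q \<in> Qp" ..
        then have "GQ.cond_pr (R n) q \<omega> \<le> 1 / Suc k" using n by blast
        then show ?case unfolding sum[OF q, of n] using k by linarith
      qed
      then show "\<exists>n. \<forall>\<^sub>F q in at t within (Qp \<inter> {t<..}). GQ.cond_pr (\<Union>i. A i) q \<omega> \<le> (\<Sum>i<n. GQ.cond_pr (A i) q \<omega>) + e"
        by blast
    qed (simp_all add: GQ.cond_pr_bounds)
  qed
  moreover have "(\<lambda>x. \<Sum>i. \<Psi> i x) \<in> borel_measurable BO"
    using \<Psi> unfolding split_limit_def by (intro borel_measurable_suminf) blast
  ultimately show ?thesis unfolding split_limit_def by blast
qed

lemma split_limit_compl:
  assumes A: "A \<in> sets Q'" and \<Psi>: "split_limit A \<Psi>"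
  shows "split_limit (space M - A) (\<lambda>x. 1 - \<Psi> x)"
proof -
  have "AE \<omega> in Q'. \<forall>q\<in>Qp. GQ.cond_pr (space M - A) q \<omega> = 1 - GQ.cond_pr A q \<omega>"
    using GQ.cond_pr_compl[OF A] by (intro AE_Qp) simp
  moreover have "AE \<omega> in Q'. \<forall>t\<ge>0. \<tau> \<omega> \<le> ereal t \<longrightarrow>
        ((\<lambda>q. GQ.cond_pr A q \<omega>) \<longlongrightarrow> \<Psi> (\<tau> \<omega>, t, \<omega>)) (at t within (Qp \<inter> {t<..}))"
    using \<Psi> by (simp add: split_limit_def)
  ultimately have "AE \<omega> in Q'. \<forall>t\<ge>0. \<tau> \<omega> \<le> ereal t \<longrightarrow>
        ((\<lambda>q. GQ.cond_pr (space M - A) q \<omega>) \<longlongrightarrow> 1 - \<Psi> (\<tau> \<omega>, t, \<omega>)) (at t within (Qp \<inter> {t<..}))"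
  proof eventually_elim
    case (elim \<omega>)
    show ?case
    proof (intro allI impI)
      fix t :: real assume t: "0 \<le> t" "\<tau> \<omega> \<le> ereal t"
      have "((\<lambda>q. 1 - GQ.cond_pr A q \<omega>) \<longlongrightarrow> 1 - \<Psi> (\<tau> \<omega>, t, \<omega>)) (at t within (Qp \<inter> {t<..}))"
        using elim(2) t by (intro tendsto_diff tendsto_const) auto
      moreover have "\<forall>\<^sub>F q in at t within (Qp \<inter> {t<..}). 1 - GQ.cond_pr A q \<omega> = GQ.cond_pr (space M - A) q \<omega>"
        using eventually_at_Qp_right by eventually_elim (use elim(1) in auto)
      ultimately show "((\<lambda>q. GQ.cond_pr (space M - A) q \<omega>) \<longlongrightarrow> 1 - \<Psi> (\<tau> \<omega>, t, \<omega>)) (at t within (Qp \<inter> {t<..}))"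
        by (rule Lim_transform_eventually)
    qed
  qed
  with \<Psi> show ?thesis unfolding split_limit_def by auto
qed

lemma split_limit_cong:
  assumes A: "A \<in> sets Q'" and B: "B \<in> sets Q'" and eq: "AE \<omega> in Q'. \<omega> \<in> A \<longleftrightarrow> \<omega> \<in> B"
    and \<Psi>: "split_limit B \<Psi>"
  shows "split_limit A \<Psi>"
proof -
  have "AE \<omega> in Q'. \<forall>q\<in>Qp. GQ.cond_pr A q \<omega> = GQ.cond_pr B q \<omega>"
    by (intro AE_Qp GQ.cond_pr_cong A B eq)
  moreover have "AE \<omega> in Q'. \<forall>t\<ge>0. \<tau> \<omega> \<le> ereal t \<longrightarrow>
        ((\<lambda>q. GQ.cond_pr B q \<omega>) \<longlongrightarrow> \<Psi> (\<tau> \<omega>, t, \<omega>)) (at t within (Qp \<inter> {t<..}))"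
    using \<Psi> by (simp add: split_limit_def)
  ultimately have "AE \<omega> in Q'. \<forall>t\<ge>0. \<tau> \<omega> \<le> ereal t \<longrightarrow>
        ((\<lambda>q. GQ.cond_pr A q \<omega>) \<longlongrightarrow> \<Psi> (\<tau> \<omega>, t, \<omega>)) (at t within (Qp \<inter> {t<..}))"
  proof eventually_elim
    case (elim \<omega>)
    show ?case
    proof (intro allI impI)
      fix t :: real assume t: "0 \<le> t" "\<tau> \<omega> \<le> ereal t"
      have "\<forall>\<^sub>F q in at t within (Qp \<inter> {t<..}). GQ.cond_pr B q \<omega> = GQ.cond_pr A q \<omega>"
        using eventually_at_Qp_right by eventually_elim (use elim(1) in auto)
      then show "((\<lambda>q. GQ.cond_pr A q \<omega>) \<longlongrightarrow> \<Psi> (\<tau> \<omega>, t, \<omega>)) (at t within (Qp \<inter> {t<..}))"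
        by (rule Lim_transform_eventually[rotated]) (use elim(2) t in simp)
    qed
  qed
  with \<Psi> show ?thesis unfolding split_limit_def by auto
qed

lemma split_limit_T:
  assumes A: "A \<in> T"
  shows "\<exists>\<Psi>. split_limit A \<Psi>"
proof -
  \<comment> \<open>Two rectangles at levels \<open>n\<close> and \<open>n'\<close> meet in a
    rectangle at level \<open>max n n'\<close>, so \<open>K\<close> is a pi-system. The induction
    then needs only complements and disjoint unions, the operations for which split limits are
    available.\<close>
  define K where "K = {{\<omega>\<in>space M. \<tau> \<omega> \<in> C} \<inter> B | C B n. C \<in> sets borel \<and> 0 \<le> n \<and> B \<in> F n}"
  interpret T: sigma_algebra "space M" T by (rule T_sigma_algebra)
  have F_space: "space M \<in> F t" if "0 \<le> t" for t
    using sigma_algebra.sigma_sets_eq[OF F_sigma_algebra[OF that]] sigma_sets_top by metis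
  have K_T: "K \<subseteq> T"
  proof
    fix X assume "X \<in> K"
    then obtain C B n where X: "X = {\<omega>\<in>space M. \<tau> \<omega> \<in> C} \<inter> B" "C \<in> sets borel" "0 \<le> n" "B \<in> F n"
      unfolding K_def by blast
    have "{\<omega>\<in>space M. \<tau> \<omega> \<in> C} = \<tau> -` C \<inter> space M" by auto
    then have "{\<omega>\<in>space M. \<tau> \<omega> \<in> C} \<in> T" using X(2) tau_sets_sub_T by (auto simp: tau_sets_def)
    moreover have "B \<in> T" using F_sub_T[OF X(3)] X(4) by blast
    ultimately show "X \<in> T" unfolding X(1) by (rule T.Int)
  qed
  have K_Pow: "K \<subseteq> Pow (space M)" unfolding K_def by auto
  have "Int_stable K"
  proof (rule Int_stableI)
    fix X Y assume "X \<in> K" "Y \<in> K"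
    then obtain C B n C' B' n' where X: "X = {\<omega>\<in>space M. \<tau> \<omega> \<in> C} \<inter> B" "C \<in> sets borel" "0 \<le> n" "B \<in> F n"
      and Y: "Y = {\<omega>\<in>space M. \<tau> \<omega> \<in> C'} \<inter> B'" "C' \<in> sets borel" "0 \<le> n'" "B' \<in> F n'"
      unfolding K_def by blast
    interpret Fm: sigma_algebra "space M" "F (max n n')"
      using X(3) by (intro F_sigma_algebra) simp
    have "B \<in> F (max n n')" "B' \<in> F (max n n')"
      using F_mono[OF X(3), of "max n n'"] F_mono[OF Y(3), of "max n n'"] X(4) Y(4) by auto
    then have "B \<inter> B' \<in> F (max n n')" by (rule Fm.Int)
    moreover have "X \<inter> Y = {\<omega>\<in>space M. \<tau> \<omega> \<in> C \<inter> C'} \<inter> (B \<inter> B')" using X(1) Y(1) by auto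
    moreover have "C \<inter> C' \<in> sets borel" using X(2) Y(2) by (rule sets.Int)
    moreover have "0 \<le> max n n'" using X(3) by simp
    ultimately show "X \<inter> Y \<in> K" unfolding K_def by blast
  qed
  note stable = this
  have A_K: "A \<in> sigma_sets (space M) K"
  proof -
    have "F t \<subseteq> K" if "0 \<le> t" for t
    proof
      fix X assume X: "X \<in> F t"
      then have "X = {\<omega>\<in>space M. \<tau> \<omega> \<in> UNIV} \<inter> X"
        using F_sub_M[OF that] sets.sets_into_space by blast
      then show "X \<in> K" unfolding K_def
        by (intro CollectI exI[of _ UNIV] exI[of _ X] exI[of _ t]) (use X that in simp)
    qed
    then have "filt_infty (space M) F \<subseteq> sigma_sets (space M) K"
      unfolding filt_infty_def by (intro sigma_sets_mono') auto
    moreover have "tau_sets \<subseteq> sigma_sets (space M) K"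
    proof
      fix X assume "X \<in> tau_sets"
      then obtain C where "X = \<tau> -` C \<inter> space M" "C \<in> sets borel" by (auto simp: tau_sets_def)
      moreover from this have "X = {\<omega>\<in>space M. \<tau> \<omega> \<in> C} \<inter> space M" by auto
      ultimately have "X \<in> K" unfolding K_def using F_space[of 0] by blast
      then show "X \<in> sigma_sets (space M) K" by (rule sigma_sets.Basic)
    qed
    ultimately have "T \<subseteq> sigma_sets (space M) K"
      unfolding T_def sig_join_def by (intro sigma_sets_mono) auto
    with A show ?thesis by blast
  qed
  have K_Q': "X \<in> sets Q'" if "X \<in> sigma_sets (space M) K" for X
    using that sigma_algebra.sigma_sets_subset[OF T_sigma_algebra K_T] T_sub_Q' by blast
  from stable K_Pow A_K show ?thesis
  proof (induction rule: sigma_sets_induct_disjoint)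
    case (basic A)
    then show ?case using split_limit_rectangle unfolding K_def by blast
  next
    case empty
    have "split_limit {} (\<lambda>_. 0)"
    proof -
      have "AE \<omega> in Q'. \<forall>q\<in>Qp. GQ.cond_pr {} q \<omega> = 0" by (intro AE_Qp GQ.cond_pr_empty)
      then have "AE \<omega> in Q'. \<forall>t\<ge>0. \<tau> \<omega> \<le> ereal t \<longrightarrow>
          ((\<lambda>q. GQ.cond_pr {} q \<omega>) \<longlongrightarrow> 0) (at t within (Qp \<inter> {t<..}))"
      proof eventually_elim
        case (elim \<omega>)
        have "\<forall>\<^sub>F q in at t within (Qp \<inter> {t<..}). GQ.cond_pr {} q \<omega> = 0" for t
          using eventually_at_Qp_right by eventually_elim (use elim in auto)
        then show ?case by (simp add: tendsto_eventually)
      qed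
      then show ?thesis unfolding split_limit_def by simp
    qed
    then show ?case by blast
  next
    case (compl A)
    then show ?case using split_limit_compl K_Q' by blast
  next
    case (union A)
    from union(3) obtain \<Psi> where "\<And>i. split_limit (A i) (\<Psi> i)" by metis
    then show ?case using split_limit_disjoint_UN[of A \<Psi>] union K_Q' by blast
  qed
qed

lemma split_limit_exists:
  assumes A: "A \<in> sets Q'"
  shows "\<exists>\<Psi>. split_limit A \<Psi>"
proof -
  obtain A0 Z where A0: "A0 \<in> T" and Z: "Z \<in> ZN" and eq: "\<forall>\<omega>\<in>space M - Z. \<omega> \<in> A \<longleftrightarrow> \<omega> \<in> A0"
    using Q'_agree[OF A] by auto
  obtain \<Psi> where \<Psi>: "split_limit A0 \<Psi>" using split_limit_T[OF A0] by blast
  have "AE \<omega> in Q'. \<omega> \<in> A \<longleftrightarrow> \<omega> \<in> A0"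
    using AE_not_in[OF ZN_null_Q'[OF Z]] AE_space[of Q'] by eventually_elim (use eq in auto)
  with \<Psi> A A0 T_sub_Q' show ?thesis using split_limit_cong by blast
qed

section \<open>Splitting of optional sets and processes\<close>

text \<open>The splitting formula for indicators, with one null set for all \<open>t\<close>; \<tau>
  is substituted for the first coordinate of \<open>B''\<close>.\<close>

definition splits :: "(real \<times> 'a) set \<Rightarrow> bool" where
  "splits B \<longleftrightarrow> B \<subseteq> {0..} \<times> space M \<and>
     (\<exists>B'\<in>sets (optional_measure (space M) F). \<exists>B''\<in>sets BO. \<exists>Z\<in>ZN. \<forall>\<omega>\<in>space M - Z. \<forall>t\<ge>0.
        (t, \<omega>) \<in> B \<longleftrightarrow> (if ereal t < \<tau> \<omega> then (t, \<omega>) \<in> B' else (\<tau> \<omega>, t, \<omega>) \<in> B''))"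

lemma space_BO: "space BO = {0..} \<times> {0..} \<times> space M"
  by (simp add: BO_def space_pair_measure space_restrict_space)

lemma splits_sigma_algebra: "sigma_algebra ({0..} \<times> space M) {B. splits B}"
  unfolding sigma_algebra_iff2
proof (intro conjI ballI allI impI)
  show "{B. splits B} \<subseteq> Pow ({0..} \<times> space M)" by (auto simp: splits_def)
  show "{} \<in> {B. splits B}"
    using empty_in_ZN by (auto simp: splits_def intro!: bexI[of _ "{}"])
next
  fix B assume "B \<in> {B. splits B}"
  then obtain B' B'' Z where *: "B' \<in> sets (optional_measure (space M) F)" "B'' \<in> sets BO" "Z \<in> ZN"
      "\<And>\<omega> t. \<omega> \<in> space M - Z \<Longrightarrow> 0 \<le> t \<Longrightarrow>
        (t, \<omega>) \<in> B \<longleftrightarrow> (if ereal t < \<tau> \<omega> then (t, \<omega>) \<in> B' else (\<tau> \<omega>, t, \<omega>) \<in> B'')"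
    unfolding splits_def by blast
  have "space (optional_measure (space M) F) - B' \<in> sets (optional_measure (space M) F)"
    "space BO - B'' \<in> sets BO"
    by (rule sets.compl_sets[OF *(1)], rule sets.compl_sets[OF *(2)])
  \<comment> \<open>Nonnegativity of \<tau> places the substituted point in \<open>space BO\<close>,
    so complements can be taken inside that space.\<close>
  moreover have "\<forall>\<omega>\<in>space M - Z. \<forall>t\<ge>0. (t, \<omega>) \<in> {0..} \<times> space M - B \<longleftrightarrow>
     (if ereal t < \<tau> \<omega> then (t, \<omega>) \<in> space (optional_measure (space M) F) - B' else (\<tau> \<omega>, t, \<omega>) \<in> space BO - B'')"
    using *(4) tau_nonneg by (auto simp: space_BO)
  ultimately show "{0..} \<times> space M - B \<in> {B. splits B}"
    using *(3) unfolding splits_def by blast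
next
  fix B :: "nat \<Rightarrow> (real \<times> 'a) set" assume B: "range B \<subseteq> {B. splits B}"
  then have "\<And>i. splits (B i)" by blast
  then obtain B' B'' Z where *: "\<And>i. B' i \<in> sets (optional_measure (space M) F)" "\<And>i. B'' i \<in> sets BO" "\<And>i. Z i \<in> ZN"
      "\<And>i \<omega> t. \<omega> \<in> space M - Z i \<Longrightarrow> 0 \<le> t \<Longrightarrow>
        (t, \<omega>) \<in> B i \<longleftrightarrow> (if ereal t < \<tau> \<omega> then (t, \<omega>) \<in> B' i else (\<tau> \<omega>, t, \<omega>) \<in> B'' i)"
    unfolding splits_def by metis
  have "(\<Union>i. B' i) \<in> sets (optional_measure (space M) F)" "(\<Union>i. B'' i) \<in> sets BO" "(\<Union>i. Z i) \<in> ZN"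
    using *(1,2,3) by (auto intro!: ZN_UN)
  moreover have "\<forall>\<omega>\<in>space M - (\<Union>i. Z i). \<forall>t\<ge>0. (t, \<omega>) \<in> (\<Union>i. B i) \<longleftrightarrow>
     (if ereal t < \<tau> \<omega> then (t, \<omega>) \<in> (\<Union>i. B' i) else (\<tau> \<omega>, t, \<omega>) \<in> (\<Union>i. B'' i))"
    using *(4) by auto
  moreover have "(\<Union>i. B i) \<subseteq> {0..} \<times> space M" using B by (auto simp: splits_def)
  ultimately show "(\<Union>i. B i) \<in> {B. splits B}" unfolding splits_def by blast
qed

lemma splits_optional:
  assumes B: "B \<in> sets (optional_measure (space M) F)"
  shows "splits B"
proof -
  have B0: "B \<subseteq> {0..} \<times> space M" using sets.sets_into_space[OF B] by simp
  have "{0..} \<times> B \<in> sets BO"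
    unfolding BO_def using B by (intro pair_measureI) (auto simp: sets_restrict_space)
  moreover have "\<forall>\<omega>\<in>space M - {}. \<forall>t\<ge>0. (t, \<omega>) \<in> B \<longleftrightarrow>
     (if ereal t < \<tau> \<omega> then (t, \<omega>) \<in> B else (\<tau> \<omega>, t, \<omega>) \<in> {0..} \<times> B)"
    using tau_nonneg by auto
  ultimately show ?thesis unfolding splits_def using B B0 empty_in_ZN by blast
qed

section \<open>Debuts of \<open>G\<close>-events and generation of the optional sets\<close>

text \<open>The stochastic interval from \<open>S\<close> on, where \<open>S\<close> is the infimum
  of the rationals \<open>q\<close> with \<open>\<omega> \<in> A q\<close>. Testing every
  \<open>r > t\<close> captures \<open>S \<le> t\<close> also when the infimum is not
  attained.\<close>

definition debut_set :: "(real \<Rightarrow> 'a set) \<Rightarrow> (real \<times> 'a) set" where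
  "debut_set A = {(t, \<omega>) \<in> {0..} \<times> space M. \<forall>r\<in>Qp. t < r \<longrightarrow> (\<exists>q\<in>Qp. q < r \<and> \<omega> \<in> A q)}"

text \<open>There is room between \<open>t\<close> and \<tau>: restricting \<open>r\<close> to lie
  below an intermediate \<open>u\<close> involves only events at times before \<tau>, where the two
  families are comparable.\<close>

lemma debut_set_before_tau:
  assumes eq: "\<And>q. q \<in> Qp \<Longrightarrow> ereal q < \<tau> \<omega> \<Longrightarrow> \<omega> \<in> A q \<Longrightarrow> \<omega> \<in> A' q"
    and t: "ereal t < \<tau> \<omega>" and in_A: "(t, \<omega>) \<in> debut_set A"
  shows "(t, \<omega>) \<in> debut_set A'"
proof -
  have t0: "0 \<le> t" "\<omega> \<in> space M" using in_A by (auto simp: debut_set_def)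
  obtain u where u: "ereal t < ereal u" "ereal u < \<tau> \<omega>" using ereal_dense2[OF t] by blast
  have "\<exists>q\<in>Qp. q < r \<and> \<omega> \<in> A' q" if tr: "t < r" for r
  proof -
    obtain r' where r': "r' \<in> Qp" "t < r'" "r' < min r u"
      by (rule Qp_dense[OF t0(1), of "min r u"]) (use u tr in auto)
    then obtain q where q: "q \<in> Qp" "q < r'" "\<omega> \<in> A q" using in_A by (auto simp: debut_set_def)
    have "ereal q < ereal u" using q r' by simp
    then have "ereal q < \<tau> \<omega>" using u(2) by (rule less_trans)
    then show ?thesis using eq[OF q(1) _ q(3)] q r' by (intro bexI[of _ q]) auto
  qed
  then show ?thesis using t0 by (simp add: debut_set_def)
qed

text \<open>With \<open>S\<close> the debut of \<open>A\<close> and \<open>\<eta> r = {S \<ge> r}\<close>, the martingale of \<open>\<eta> r\<close> vanishes from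
  \<open>S\<close> on, but on \<open>\<eta> r\<close> it is bounded away from \<open>0\<close>. Hence \<open>S \<le> t\<close> holds iff the right limits at \<open>t\<close> of
  the martingales of \<open>\<eta> r\<close> vanish for all \<open>r > t\<close>.\<close>

lemma splits_debut_set:
  assumes A: "\<And>q. q \<in> Qp \<Longrightarrow> A q \<in> G q"
  shows "splits (debut_set A)"
proof -
  define E where "E r = (\<Union>q\<in>Qp \<inter> {..<r}. A q)" for r
  define \<eta> where "\<eta> r = space M - E r" for r
  have E_G: "E r \<in> G r" if "0 \<le> r" for r
  proof -
    interpret sigma_algebra "space M" "G r" by (rule G_sigma_algebra[OF that])
    have "A q \<in> G r" if "q \<in> Qp" "q < r" for q
      using A[OF that(1)] G_mono[of q r] that by auto
    then show ?thesis
      unfolding E_def by (intro countable_UN' countable_subset[OF _ countable_Qp]) auto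
  qed
  have \<eta>_Q': "\<eta> r \<in> sets Q'" if "0 \<le> r" for r
  proof -
    have "E r \<in> sets Q'" using E_G[OF that] G_sub_Q'[OF that] by blast
    from sets.compl_sets[OF this] show ?thesis by (simp add: \<eta>_def)
  qed
  have "\<forall>r. \<exists>\<Psi>. r \<in> Qp \<longrightarrow> split_limit (\<eta> r) \<Psi>" using split_limit_exists[OF \<eta>_Q'] by auto
  then obtain \<Psi> where \<Psi>: "\<And>r. r \<in> Qp \<Longrightarrow> split_limit (\<eta> r) (\<Psi> r)" by metis
  have "\<forall>q. \<exists>A'. q \<in> Qp \<longrightarrow> A' \<in> F q \<and> (AE \<omega> in Q'. ereal q < \<tau> \<omega> \<longrightarrow> (\<omega> \<in> A q \<longleftrightarrow> \<omega> \<in> A'))"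
  proof (intro allI, cases)
    fix q assume q: "q \<in> Qp"
    then obtain A' Z where *: "A' \<in> F q" "Z \<in> ZN" "\<forall>\<omega>\<in>space M - Z. ereal q < \<tau> \<omega> \<longrightarrow> (\<omega> \<in> A q \<longleftrightarrow> \<omega> \<in> A')"
      using G_before_tau[OF _ A[OF q]] by auto
    have "AE \<omega> in Q'. ereal q < \<tau> \<omega> \<longrightarrow> (\<omega> \<in> A q \<longleftrightarrow> \<omega> \<in> A')"
      using AE_not_in[OF ZN_null_Q'[OF *(2)]] AE_space[of Q'] by eventually_elim (use *(3) in auto)
    with *(1) show "\<exists>A'. q \<in> Qp \<longrightarrow> A' \<in> F q \<and> (AE \<omega> in Q'. ereal q < \<tau> \<omega> \<longrightarrow> (\<omega> \<in> A q \<longleftrightarrow> \<omega> \<in> A'))" by blast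
  qed blast
  then obtain A' where A': "\<And>q. q \<in> Qp \<Longrightarrow> A' q \<in> F q"
      "\<And>q. q \<in> Qp \<Longrightarrow> AE \<omega> in Q'. ereal q < \<tau> \<omega> \<longrightarrow> (\<omega> \<in> A q \<longleftrightarrow> \<omega> \<in> A' q)" by metis
  define B'' where "B'' = {x\<in>space BO. \<forall>r\<in>Qp. fst (snd x) < r \<longrightarrow> \<Psi> r x = 0}"
  have B'_opt: "debut_set A' \<in> sets (optional_measure (space M) F)"
    unfolding debut_set_def by (rule optional_debut[OF F_sigma_algebra F_mono F_right_continuous A'(1)])
  have B''_BO: "B'' \<in> sets BO"
  proof -
    have time: "(\<lambda>x. fst (snd x)) \<in> borel_measurable BO"
      unfolding BO_def by (rule measurable_compose[OF measurable_snd optional_time[OF F_sigma_algebra]])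
    have "{x\<in>space BO. fst (snd x) < r \<longrightarrow> \<Psi> r x = 0} \<in> sets BO" if "r \<in> Qp" for r
    proof -
      have "\<Psi> r \<in> borel_measurable BO" using \<Psi>[OF that] by (simp add: split_limit_def)
      with time show ?thesis by measurable
    qed
    then have "(\<Inter>r\<in>Qp. {x\<in>space BO. fst (snd x) < r \<longrightarrow> \<Psi> r x = 0}) \<in> sets BO"
      by (intro sets.countable_INT' countable_Qp) (auto intro: exI[of _ 0])
    also have "(\<Inter>r\<in>Qp. {x\<in>space BO. fst (snd x) < r \<longrightarrow> \<Psi> r x = 0}) = B''"
      unfolding B''_def by (auto intro: bexI[of _ 0])
    finally show ?thesis .
  qed
  have a: "AE \<omega> in Q'. \<forall>q\<in>Qp. ereal q < \<tau> \<omega> \<longrightarrow> (\<omega> \<in> A q \<longleftrightarrow> \<omega> \<in> A' q)"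
    by (subst AE_ball_countable[OF countable_Qp]) (use A'(2) in blast)
  \<comment> \<open>For \<open>q < r\<close> the event \<open>E q\<close>, known at time
    \<open>q\<close>, is disjoint from \<open>\<eta> r\<close>, so on it the conditional probability
    of \<open>\<eta> r\<close> is already 0.\<close>
  have b: "AE \<omega> in Q'. \<forall>r\<in>Qp. \<forall>q\<in>Qp. q < r \<longrightarrow> \<omega> \<in> E q \<longrightarrow> GQ.cond_pr (\<eta> r) q \<omega> = 0"
  proof (rule AE_Qp, rule AE_Qp)
    fix r q :: real assume r: "0 \<le> r" and q: "0 \<le> q"
    show "AE \<omega> in Q'. q < r \<longrightarrow> \<omega> \<in> E q \<longrightarrow> GQ.cond_pr (\<eta> r) q \<omega> = 0"
    proof (cases "q < r")
      case True
      then have "\<eta> r \<inter> E q = {}" by (auto simp: \<eta>_def E_def)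
      from GQ.cond_pr_zero_on[OF \<eta>_Q'[OF r] q E_G[OF q] this] show ?thesis by eventually_elim simp
    qed simp
  qed
  have c: "AE \<omega> in Q'. \<forall>r\<in>Qp. \<omega> \<in> \<eta> r \<longrightarrow> (\<exists>k::nat. \<forall>q\<in>Qp. 1 / Suc k \<le> GQ.cond_pr (\<eta> r) q \<omega>)"
    by (intro AE_Qp GQ.cond_pr_bounded_below_on \<eta>_Q')
  have d: "AE \<omega> in Q'. \<forall>r\<in>Qp. \<forall>t\<ge>0. \<tau> \<omega> \<le> ereal t \<longrightarrow>
        ((\<lambda>q. GQ.cond_pr (\<eta> r) q \<omega>) \<longlongrightarrow> \<Psi> r (\<tau> \<omega>, t, \<omega>)) (at t within (Qp \<inter> {t<..}))"
    by (subst AE_ball_countable[OF countable_Qp]) (use \<Psi> in \<open>auto simp: split_limit_def\<close>)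
  have "AE \<omega> in Q'. \<forall>t\<ge>0. (t, \<omega>) \<in> debut_set A \<longleftrightarrow>
      (if ereal t < \<tau> \<omega> then (t, \<omega>) \<in> debut_set A' else (\<tau> \<omega>, t, \<omega>) \<in> B'')"
    using a b c d AE_space[of Q']
  proof (eventually_elim, intro allI impI)
    fix \<omega> and t :: real
    assume a: "\<forall>q\<in>Qp. ereal q < \<tau> \<omega> \<longrightarrow> (\<omega> \<in> A q \<longleftrightarrow> \<omega> \<in> A' q)"
      and b: "\<forall>r\<in>Qp. \<forall>q\<in>Qp. q < r \<longrightarrow> \<omega> \<in> E q \<longrightarrow> GQ.cond_pr (\<eta> r) q \<omega> = 0"
      and c: "\<forall>r\<in>Qp. \<omega> \<in> \<eta> r \<longrightarrow> (\<exists>k::nat. \<forall>q\<in>Qp. 1 / Suc k \<le> GQ.cond_pr (\<eta> r) q \<omega>)"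
      and d: "\<forall>r\<in>Qp. \<forall>t\<ge>0. \<tau> \<omega> \<le> ereal t \<longrightarrow>
        ((\<lambda>q. GQ.cond_pr (\<eta> r) q \<omega>) \<longlongrightarrow> \<Psi> r (\<tau> \<omega>, t, \<omega>)) (at t within (Qp \<inter> {t<..}))"
      and \<omega>: "\<omega> \<in> space Q'" and t: "0 \<le> t"
    show "(t, \<omega>) \<in> debut_set A \<longleftrightarrow>
      (if ereal t < \<tau> \<omega> then (t, \<omega>) \<in> debut_set A' else (\<tau> \<omega>, t, \<omega>) \<in> B'')"
    proof (cases "ereal t < \<tau> \<omega>")
      case True
      have "(t, \<omega>) \<in> debut_set A \<longleftrightarrow> (t, \<omega>) \<in> debut_set A'"
        using debut_set_before_tau[of \<omega> A A' t] debut_set_before_tau[of \<omega> A' A t] a True by blast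
      with True show ?thesis by simp
    next
      case False
      then have \<tau>t: "\<tau> \<omega> \<le> ereal t" by simp
      have deb: "(t, \<omega>) \<in> debut_set A \<longleftrightarrow> (\<forall>r\<in>Qp. t < r \<longrightarrow> \<omega> \<in> E r)"
        using t \<omega> by (auto simp: debut_set_def E_def)
      have inB: "(\<tau> \<omega>, t, \<omega>) \<in> B'' \<longleftrightarrow> (\<forall>r\<in>Qp. t < r \<longrightarrow> \<Psi> r (\<tau> \<omega>, t, \<omega>) = 0)"
        using t \<omega> tau_nonneg by (simp add: B''_def space_BO)
      have lim: "((\<lambda>q. GQ.cond_pr (\<eta> r) q \<omega>) \<longlongrightarrow> \<Psi> r (\<tau> \<omega>, t, \<omega>)) (at t within (Qp \<inter> {t<..}))"
        if "r \<in> Qp" for r using d that t \<tau>t by simp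
      have "(\<forall>r\<in>Qp. t < r \<longrightarrow> \<omega> \<in> E r) \<longleftrightarrow> (\<forall>r\<in>Qp. t < r \<longrightarrow> \<Psi> r (\<tau> \<omega>, t, \<omega>) = 0)"
      proof (intro iffI ballI impI)
        \<comment> \<open>The hypothesis is used at rationals \<open>q\<close> between
          \<open>t\<close> and \<open>r\<close>: it puts \<omega> in each such \<open>E q\<close>,
          where the martingale of \<open>\<eta> r\<close> vanishes, and so does its right
          limit.\<close>
        fix r assume in_E: "\<forall>r\<in>Qp. t < r \<longrightarrow> \<omega> \<in> E r" and r: "r \<in> Qp" "t < r"
        have "\<forall>\<^sub>F q in at t within (Qp \<inter> {t<..}). q < r"
          using r(2) unfolding eventually_at by (intro exI[of _ "r - t"]) (auto simp: dist_real_def)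
        with eventually_at_Qp_right[of t]
        have "\<forall>\<^sub>F q in at t within (Qp \<inter> {t<..}). GQ.cond_pr (\<eta> r) q \<omega> = 0"
          by eventually_elim (use in_E b r(1) in blast)
        then have "((\<lambda>q. GQ.cond_pr (\<eta> r) q \<omega>) \<longlongrightarrow> 0) (at t within (Qp \<inter> {t<..}))"
          by (rule tendsto_eventually)
        from tendsto_unique[OF at_Qp_right_nontrivial[OF t] lim[OF r(1)] this]
        show "\<Psi> r (\<tau> \<omega>, t, \<omega>) = 0" .
      next
        fix r assume zero: "\<forall>r\<in>Qp. t < r \<longrightarrow> \<Psi> r (\<tau> \<omega>, t, \<omega>) = 0" and r: "r \<in> Qp" "t < r"
        show "\<omega> \<in> E r"
        proof (rule ccontr)
          \<comment> \<open>The uniform lower bound on \<open>\<eta> r\<close> passes to the right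
            limit and keeps it positive.\<close>
          assume "\<omega> \<notin> E r"
          then have "\<omega> \<in> \<eta> r" using \<omega> by (simp add: \<eta>_def)
          then obtain k :: nat where k: "\<forall>q\<in>Qp. 1 / Suc k \<le> GQ.cond_pr (\<eta> r) q \<omega>" using c r(1) by blast
          have "1 / Suc k \<le> \<Psi> r (\<tau> \<omega>, t, \<omega>)"
            by (rule tendsto_lowerbound[OF lim[OF r(1)] _ at_Qp_right_nontrivial[OF t]])
              (use eventually_at_Qp_right in eventually_elim, use k in blast)
          moreover have "\<Psi> r (\<tau> \<omega>, t, \<omega>) = 0" using zero r by blast
          ultimately show False by simp
        qed
      qed
      with deb inB False show ?thesis by simp
    qed
  qed
  then obtain Z where Z: "Z \<in> ZN" and main: "\<And>\<omega>. \<omega> \<in> space M - Z \<Longrightarrow> \<forall>t\<ge>0. (t, \<omega>) \<in> debut_set A \<longleftrightarrow>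
      (if ereal t < \<tau> \<omega> then (t, \<omega>) \<in> debut_set A' else (\<tau> \<omega>, t, \<omega>) \<in> B'')"
    by (rule AE_Q'_ZN) blast
  have "debut_set A \<subseteq> {0..} \<times> space M" by (auto simp: debut_set_def)
  then show ?thesis
    unfolding splits_def using B'_opt B''_BO Z main by blast
qed

text \<open>In the path criterion each condition becomes a set already known to split:
  \<open>A1 d p\<close> yields the debut of values at most \<open>d\<close> from \<open>p\<close>
  on, \<open>A2 d p\<close> that of values above \<open>d\<close> after \<open>p\<close>.\<close>

lemma splits_superlevel:
  assumes X: "adapted (space M) G X" "cadlag_paths (space M) X"
  shows "splits {(t, \<omega>) \<in> {0..} \<times> space M. c < X t \<omega>}"
proof -
  interpret S: sigma_algebra "{0..} \<times> space M" "{B. splits B}" by (rule splits_sigma_algebra)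
  define A1 where "A1 d p q = (if p \<le> q then {\<omega>\<in>space M. X q \<omega> \<in> {..d}} else {})" for d p q
  define A2 where "A2 d p q = (if p < q then {\<omega>\<in>space M. X q \<omega> \<in> {d<..}} else {})" for d p q
  define after where "after q = {x\<in>{0..} \<times> space M. q < fst x}" for q :: real
  define from_on where "from_on p = {x\<in>{0..} \<times> space M. p \<le> fst x}" for p :: real
  have in_G: "{\<omega>\<in>space M. X q \<omega> \<in> B} \<in> G q" if "q \<in> Qp" "B \<in> sets borel" for q B
    using X(1) that by (auto simp: adapted_def)
  have empty_G: "{} \<in> G q" if "q \<in> Qp" for q
    using that by (intro sigma_algebra_empty[OF G_sigma_algebra]) auto
  have A_G: "A1 d p q \<in> G q" "A2 d p q \<in> G q" if "q \<in> Qp" for d p q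
    unfolding A1_def A2_def using in_G[OF that, of "{..d}"] in_G[OF that, of "{d<..}"] empty_G[OF that]
    by (simp_all only: split: if_split) auto
  note time = optional_time[where F=F, OF F_sigma_algebra]
  have after_S: "splits (after q)" and from_S: "splits (from_on q)" for q
  proof -
    have "{x\<in>space (optional_measure (space M) F). q < fst x} \<in> sets (optional_measure (space M) F)"
         "{x\<in>space (optional_measure (space M) F). q \<le> fst x} \<in> sets (optional_measure (space M) F)"
      using time by measurable
    then show "splits (after q)" "splits (from_on q)"
      by (auto intro!: splits_optional simp: after_def from_on_def)
  qed
  \<comment> \<open>The open counterpart of a debut interval: some exceedance strictly before
    \<open>t\<close>. A family nonempty at the single index \<open>q\<close> has debut
    \<open>q\<close> on \<open>A2 d p q\<close>, and \<open>after q\<close> removes time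
    \<open>q\<close> itself.\<close>
  define past where "past d p = (\<Union>q\<in>Qp. after q \<inter> debut_set (\<lambda>q'. if q' = q then A2 d p q else {}))" for d p
  have past_S: "splits (past d p)" for d p
  proof -
    have "debut_set (\<lambda>q'. if q' = q then A2 d p q else {}) \<in> {B. splits B}" if "q \<in> Qp" for q
      using A_G empty_G by (auto intro!: splits_debut_set)
    then have "past d p \<in> {B. splits B}"
      unfolding past_def using after_S by (intro S.countable_UN' countable_Qp image_subsetI S.Int) auto
    then show ?thesis by simp
  qed
  have past_iff: "(t, \<omega>) \<in> past d p \<longleftrightarrow> (\<exists>q\<in>Qp. q < t \<and> p < q \<and> d < X q \<omega>)"
    if t: "0 \<le> t" and \<omega>: "\<omega> \<in> space M" for d p t \<omega>
  proof
    assume "(t, \<omega>) \<in> past d p"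
    then obtain q where q: "q \<in> Qp" "q < t" "(t, \<omega>) \<in> debut_set (\<lambda>q'. if q' = q then A2 d p q else {})"
      by (auto simp: past_def after_def)
    obtain r where r: "r \<in> Qp" "t < r" by (rule Qp_dense[OF t, of "t + 1"]) auto
    with q(3) have "\<omega> \<in> A2 d p q" by (auto simp: debut_set_def split: if_splits)
    with q show "\<exists>q\<in>Qp. q < t \<and> p < q \<and> d < X q \<omega>"
      by (intro bexI[of _ q]) (auto simp: A2_def split: if_splits)
  next
    assume "\<exists>q\<in>Qp. q < t \<and> p < q \<and> d < X q \<omega>"
    then obtain q where q: "q \<in> Qp" "q < t" "p < q" "d < X q \<omega>" by blast
    then have "(t, \<omega>) \<in> after q \<inter> debut_set (\<lambda>q'. if q' = q then A2 d p q else {})"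
      using t \<omega> by (auto simp: after_def debut_set_def A2_def intro!: bexI[of _ q])
    with q(1) show "(t, \<omega>) \<in> past d p" unfolding past_def by blast
  qed
  have "{(t, \<omega>) \<in> {0..} \<times> space M. c < X t \<omega>} = (\<Union>d\<in>\<rat> \<inter> {c<..}. \<Union>p\<in>Qp.
      (from_on p - debut_set (A1 d p)) \<union> (debut_set (A2 d p) - past d p))" (is "?L = ?R")
  proof (rule set_eqI)
    fix x :: "real \<times> 'a"
    obtain t \<omega> where x: "x = (t, \<omega>)" by (cases x)
    show "x \<in> ?L \<longleftrightarrow> x \<in> ?R"
    proof (cases "0 \<le> t \<and> \<omega> \<in> space M")
      case True
      then have t: "0 \<le> t" and \<omega>: "\<omega> \<in> space M" by auto
      have 1: "x \<in> from_on p - debut_set (A1 d p) \<longleftrightarrow>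
          p \<le> t \<and> \<not> (\<forall>r\<in>Qp. t < r \<longrightarrow> (\<exists>q\<in>Qp. q < r \<and> p \<le> q \<and> X q \<omega> \<le> d))" for d p
      proof -
        have "\<omega> \<in> A1 d p q \<longleftrightarrow> p \<le> q \<and> X q \<omega> \<le> d" for q using \<omega> by (simp add: A1_def)
        then show ?thesis using t \<omega> by (simp add: from_on_def debut_set_def x)
      qed
      have 2: "x \<in> debut_set (A2 d p) - past d p \<longleftrightarrow>
          (\<forall>r\<in>Qp. t < r \<longrightarrow> (\<exists>q\<in>Qp. q < r \<and> p < q \<and> d < X q \<omega>)) \<and> \<not> (\<exists>q\<in>Qp. q < t \<and> p < q \<and> d < X q \<omega>)" for d p
      proof -
        have "\<omega> \<in> A2 d p q \<longleftrightarrow> p < q \<and> d < X q \<omega>" for q using \<omega> by (simp add: A2_def)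
        then show ?thesis using t \<omega> past_iff[OF t \<omega>] by (simp add: debut_set_def x)
      qed
      have "x \<in> ?L \<longleftrightarrow> c < X t \<omega>" using x t \<omega> by simp
      also have "\<dots> \<longleftrightarrow> x \<in> ?R"
        unfolding UN_iff Un_iff 1 2
        using X(2) \<omega> t by (intro cadlag_superlevel_iff[of t "\<lambda>s. X s \<omega>"]) (auto simp: cadlag_paths_def)
      finally show ?thesis .
    qed (auto simp: x from_on_def debut_set_def)
  qed
  also have "\<dots> \<in> {B. splits B}"
  proof (intro S.countable_UN' image_subsetI S.Un S.Diff)
    show "countable (\<rat> \<inter> {c<..})" using countable_rat by (rule countable_subset[rotated]) auto
  qed (use countable_Qp from_S past_S splits_debut_set A_G in auto)
  finally show ?thesis by simp
qed

lemma splits_optional_G: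
  assumes B: "B \<in> sets (optional_measure (space M) G)"
  shows "splits B"
proof -
  let ?\<Omega> = "{0..} \<times> space M"
  interpret S: sigma_algebra ?\<Omega> "{B. splits B}" by (rule splits_sigma_algebra)
  let ?gen = "{{(t, \<omega>) \<in> ?\<Omega>. X t \<omega> \<in> B} | X B.
        adapted (space M) G X \<and> cadlag_paths (space M) X \<and> B \<in> sets (borel :: real measure)}"
  have gen: "splits {(t, \<omega>) \<in> ?\<Omega>. X t \<omega> \<in> B}"
    if X: "adapted (space M) G X" "cadlag_paths (space M) X" and B: "B \<in> sets borel"
    for X :: "real \<Rightarrow> 'a \<Rightarrow> real" and B
  proof -
    let ?N = "sigma ?\<Omega> {B. splits B}"
    have sets_N: "sets ?N = {B. splits B}" by (rule S.sets_measure_of_eq)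
    have space_N: "space ?N = ?\<Omega>" by (simp add: space_measure_of_conv)
    have "(\<lambda>(t, \<omega>). X t \<omega>) \<in> borel_measurable ?N"
      unfolding borel_measurable_iff_greater
    proof
      fix c
      have "{w \<in> space ?N. c < (case w of (t, \<omega>) \<Rightarrow> X t \<omega>)} = {(t, \<omega>) \<in> ?\<Omega>. c < X t \<omega>}"
        unfolding space_N by auto
      with splits_superlevel[OF X, of c]
      show "{w \<in> space ?N. c < (case w of (t, \<omega>) \<Rightarrow> X t \<omega>)} \<in> sets ?N" unfolding sets_N by simp
    qed
    from measurable_sets[OF this B]
    have "(\<lambda>(t, \<omega>). X t \<omega>) -` B \<inter> ?\<Omega> \<in> {B. splits B}" unfolding sets_N space_N .
    also have "(\<lambda>(t, \<omega>). X t \<omega>) -` B \<inter> ?\<Omega> = {(t, \<omega>) \<in> ?\<Omega>. X t \<omega> \<in> B}" by auto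
    finally show "splits {(t, \<omega>) \<in> ?\<Omega>. X t \<omega> \<in> B}" by simp
  qed
  have "sigma_sets ?\<Omega> ?gen \<subseteq> {B. splits B}"
    by (rule S.sigma_sets_subset) (use gen in blast)
  moreover have "?gen \<subseteq> Pow ?\<Omega>" by auto
  then have "sets (optional_measure (space M) G) = sigma_sets ?\<Omega> ?gen"
    unfolding optional_measure_def by (rule sets_measure_of)
  ultimately show ?thesis using B by blast
qed

theorem optional_splitting: "global_optional_splitting M F \<tau>"
  unfolding global_optional_splitting_def
proof (intro allI impI)
  fix Y assume Y: "optional_process (space M) G Y"
  define L where "L c = {x\<in>{0..} \<times> space M. c < (case x of (t, \<omega>) \<Rightarrow> Y t \<omega>)}" for c
  have "splits (L c)" for c
  proof (rule splits_optional_G)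
    have "{x\<in>space (optional_measure (space M) G). c < (case x of (t, \<omega>) \<Rightarrow> Y t \<omega>)} \<in> sets (optional_measure (space M) G)"
      using Y unfolding optional_process_def by (intro borel_measurable_less) auto
    then show "L c \<in> sets (optional_measure (space M) G)" by (simp add: L_def)
  qed
  then obtain B' B'' Z where B: "\<And>c. B' c \<in> sets (optional_measure (space M) F)" "\<And>c. B'' c \<in> sets BO" "\<And>c. Z c \<in> ZN"
    and eq: "\<And>c \<omega> t. \<omega> \<in> space M - Z c \<Longrightarrow> 0 \<le> t \<Longrightarrow>
        (t, \<omega>) \<in> L c \<longleftrightarrow> (if ereal t < \<tau> \<omega> then (t, \<omega>) \<in> B' c else (\<tau> \<omega>, t, \<omega>) \<in> B'' c)"
    unfolding splits_def by metis
  \<comment> \<open>Only rational levels are needed to rebuild \<open>Y\<close>, so countably many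
    exceptional sets are united.\<close>
  define N0 where "N0 = (\<Union>i. Z (from_nat_into \<rat> i))"
  have N0: "N0 \<in> ZN" unfolding N0_def using B(3) by (intro ZN_UN) auto
  have Z_N0: "Z c \<subseteq> N0" if "c \<in> \<rat>" for c
    using from_nat_into_surj[OF countable_rat that] unfolding N0_def by blast
  define Y' where "Y' t \<omega> = sup_of_levels B' (t, \<omega>)" for t \<omega>
  define Y'' where "Y'' u t \<omega> = sup_of_levels B'' (u, t, \<omega>)" for u t \<omega>
  have "optional_process (space M) F Y'"
    using sup_of_levels_measurable[of B' "optional_measure (space M) F"] B(1)
    by (simp add: optional_process_def Y'_def)
  moreover have "(\<lambda>(u, (t, \<omega>)). Y'' u t \<omega>) \<in>
      borel_measurable (restrict_space (borel :: ereal measure) {0..} \<Otimes>\<^sub>M optional_measure (space M) F)"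
    using sup_of_levels_measurable[of B'' BO] B(2) by (simp add: Y''_def BO_def)
  moreover have "N0 \<in> NG M F \<tau>" using subset_ZN_in_NG[OF order_refl N0] .
  moreover have "N0 \<in> null_sets (completion M)"
    using N0 by (auto simp: ZN_def intro: null_sets_completionI)
  moreover have "Y t \<omega> = (if ereal t < \<tau> \<omega> then Y' t \<omega> else Y'' (\<tau> \<omega>) t \<omega>)"
    if \<omega>: "\<omega> \<in> space M - N0" and t: "0 \<le> t" for t \<omega>
  proof -
    have L: "(t, \<omega>) \<in> L c \<longleftrightarrow> c < Y t \<omega>" for c using \<omega> t by (simp add: L_def)
    have eqc: "c < Y t \<omega> \<longleftrightarrow> (if ereal t < \<tau> \<omega> then (t, \<omega>) \<in> B' c else (\<tau> \<omega>, t, \<omega>) \<in> B'' c)" if "c \<in> \<rat>" for c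
      using eq[of \<omega> c t] Z_N0[OF that] \<omega> t L[of c] by blast
    show ?thesis
    proof (cases "ereal t < \<tau> \<omega>")
      case True
      then show ?thesis
        unfolding Y'_def using eqc by (simp add: sup_of_levels_eq[of "(t, \<omega>)" B' "Y t \<omega>"])
    next
      case False
      then show ?thesis
        unfolding Y''_def using eqc by (simp add: sup_of_levels_eq[of "(\<tau> \<omega>, t, \<omega>)" B'' "Y t \<omega>"])
    qed
  qed
  ultimately show "\<exists>Y' Y''. optional_process (space M) F Y' \<and>
        (\<lambda>(u, (t, \<omega>)). Y'' u t \<omega>) \<in>
           borel_measurable (restrict_space (borel :: ereal measure) {0..} \<Otimes>\<^sub>M optional_measure (space M) F) \<and>
        (\<exists>N0\<in>NG M F \<tau>. N0 \<in> null_sets (completion M) \<and>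
          (\<forall>\<omega>\<in>space M - N0. \<forall>t\<ge>0.
             Y t \<omega> = (if ereal t < \<tau> \<omega> then Y' t \<omega> else Y'' (\<tau> \<omega>) t \<omega>)))"
    by blast
qed

end

theorem mainTheorem14:
  fixes M :: "'a measure" and F :: "real \<Rightarrow> 'a set set" and \<tau> :: "'a \<Rightarrow> ereal"
    and Q' :: "'a measure"
  assumes "prob_space M"
    and "is_filtration M F"
    and "right_continuous_filtration F"
    and "null_gen M (filt_infty (space M) F) \<subseteq> F 0"
    and "\<tau> \<in> borel_measurable M"
    and "\<forall>\<omega>\<in>space M. 0 \<le> \<tau> \<omega>"
    and "prob_space Q'"
    and "space Q' = space M"
    and "sets Q' = sigma_sets (space M) (\<Union>t\<in>{0..}. enlarged M F \<tau> t)"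
    and "\<forall>A\<in>sets Q'. emeasure Q' A = 0 \<longleftrightarrow> A \<in> null_sets (completion M)"
    and "\<forall>X. martingale Q' F X \<longrightarrow> martingale Q' (enlarged M F \<tau>) X"
  shows "global_optional_splitting M F \<tau>"
  using enlargement.optional_splitting[of M F \<tau> Q'] assms unfolding enlargement_def by blast

end
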